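(* Let $F:U\to\mathbb P^{r',s',t'}$ be a local orthogonal map, where $U\subset\mathbb P^{r,s}$ is a connected open set containing a null point. If $\min\{r',s'\}\le 2\min\{r,s\}-2$, then $F$ is either null or quasi-linear. If in addition $F$ maps at least one positive point to a positive point, or at least one negative point to a negative point, then $F$ is quasi-standard.
   Context: Let $r,s,t\ge 0$ be integers with $n=r+s+t>0$. $\mathbb C^{r,s,t}$ denotes $\mathbb C^n$ equipped with the (possibly degenerate, indefinite) Hermitian form $\langle z,w\rangle_{r,s,t}=\sum_{j=1}^{r}z_j\bar w_j-\sum_{j=r+1}^{r+s}z_j\bar w_j$, and $\mathbb P^{r,s,t}$ is its projectivization; $\mathbb P^{r,s}=\mathbb P^{r,s,0}$. A point $[z]$ is positive, negative or null according as $\langle z,z\rangle_{r,s,t}>0$, $<0$ or $=0$; $[z]\perp[w]$ if $\langle z,w\rangle_{r,s,t}=0$. A complex linear subspace $H$ (or $\mathbb PH$) is a null space if the form vanishes identically on $H$. A holomorphic map $F:U\to\mathbb P^{r',s',t'}$ on a connected open set $U$ containing a null point is a local orthogonal map if $F(p)\perp F(q)$ for all $p,q\in U$ with $p\perp q$. $F$ is linear if it extends to a rational map induced by a linear map of the underlying vector spaces; standard if it is induced by a linear isometry $\mathbb C^{r,s,t}\to\mathbb C^{r',s',t'}$ (a linear map $L$ with $\langle Lu,Lv\rangle_{r',s',t'}=\langle u,v\rangle_{r,s,t}$); null if $F(U)$ is contained in a null space. $F$ is quasi-standard (resp. quasi-linear) if either $F$ is standard (resp. linear), or there is a decomposition $\mathbb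 C^{r',s',t'}=A\oplus B$ into nonzero subspaces with $\langle a,b\rangle_{r',s',t'}=0$ for all $a\in A,b\in B$ such that $\pi_A\circ F$ is standard (resp. linear) and $\pi_B\circ F$ is null, where $\pi_A:\mathbb P^{r',s',t'}\dashrightarrow\mathbb PA$, $\pi_B:\mathbb P^{r',s',t'}\dashrightarrow\mathbb PB$ are induced by the linear projections, and $\mathbb PA,\mathbb PB$ carry the restricted forms. *)

theory Defs
  imports "HOL-Analysis.Analysis"
begin

section \<open>The Hermitian form of C^{r,s,t}\<close>

text \<open>Coordinates are indexed by a finite linearly ordered type; the k-th coordinate
(k = number of strictly smaller indices, counted from 0) has sign +1 for k < r,
-1 for r <= k < r+s, and 0 otherwise.  With CARD('n) = r+s+t this is exactly
the form of C^{r,s,t}.\<close>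

definition idx :: "'n::{finite,linorder} \<Rightarrow> nat" where
  "idx i = card {j. j < i}"

definition sig :: "nat \<Rightarrow> nat \<Rightarrow> 'n::{finite,linorder} \<Rightarrow> complex" where
  "sig r s i = (if idx i < r then 1 else if idx i < r + s then -1 else 0)"

definition hform :: "nat \<Rightarrow> nat \<Rightarrow> complex^('n::{finite,linorder}) \<Rightarrow> complex^('n::{finite,linorder}) \<Rightarrow> complex" where
  "hform r s z w = (\<Sum>i\<in>UNIV. sig r s i * z$i * cnj (w$i))"

section \<open>Projective points, holomorphic maps\<close>

text \<open>Two nonzero vectors represent the same projective point.\<close>
definition pequiv :: "complex^('m::{finite,linorder}) \<Rightarrow> complex^('m::{finite,linorder}) \<Rightarrow> bool" where
  "pequiv x y \<longleftrightarrow> (\<exists>c. c \<noteq> 0 \<and> y = c *s x)"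

definition clinear :: "(complex^('n::{finite,linorder}) \<Rightarrow> complex^('m::{finite,linorder})) \<Rightarrow> bool" where
  "clinear L \<longleftrightarrow> Vector_Spaces.linear ((*s)) ((*s)) L"

text \<open>Holomorphic maps between open subsets of complex vector spaces:
complex-linear Frechet derivative at every point.\<close>
definition cholo_on :: "(complex^('n::{finite,linorder}) \<Rightarrow> complex^('m::{finite,linorder})) \<Rightarrow> (complex^('n::{finite,linorder})) set \<Rightarrow> bool" where
  "cholo_on f V \<longleftrightarrow> open V \<and>
     (\<forall>z\<in>V. \<exists>L. clinear L \<and> (f has_derivative L) (at z))"

text \<open>An open set of projective space is represented by its cone U (a set of nonzero
vectors closed under nonzero scalars).  A map F from it into projective space is
represented by a function giving, for each z in U, a nonzero representative F z
of the image of [z].  It is holomorphic iff it locally admits holomorphic lifts.\<close>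
definition proj_hol_map :: "(complex^('n::{finite,linorder})) set \<Rightarrow> (complex^('n::{finite,linorder}) \<Rightarrow> complex^('m::{finite,linorder})) \<Rightarrow> bool" where
  "proj_hol_map U F \<longleftrightarrow>
     (\<forall>z\<in>U. F z \<noteq> 0) \<and>
     (\<forall>z\<in>U. \<forall>c. c \<noteq> 0 \<longrightarrow> pequiv (F z) (F (c *s z))) \<and>
     (\<forall>z\<in>U. \<exists>V f. z \<in> V \<and> V \<subseteq> U \<and> cholo_on f V \<and>
                 (\<forall>w\<in>V. f w \<noteq> 0 \<and> pequiv (F w) (f w)))"

definition local_orthogonal ::
  "nat \<Rightarrow> nat \<Rightarrow> nat \<Rightarrow> nat \<Rightarrow> (complex^('n::{finite,linorder})) set
     \<Rightarrow> (complex^('n::{finite,linorder}) \<Rightarrow> complex^('m::{finite,linorder})) \<Rightarrow> bool" where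
  "local_orthogonal r s r' s' U F \<longleftrightarrow> proj_hol_map U F \<and>
     (\<forall>p\<in>U. \<forall>q\<in>U. hform r s p q = 0 \<longrightarrow> hform r' s' (F p) (F q) = 0)"

section \<open>Null, linear, standard maps\<close>

definition null_space :: "nat \<Rightarrow> nat \<Rightarrow> (complex^('m::{finite,linorder})) set \<Rightarrow> bool" where
  "null_space r' s' H \<longleftrightarrow> vec.subspace H \<and> (\<forall>x\<in>H. \<forall>y\<in>H. hform r' s' x y = 0)"

text \<open>G (defined on U, G z = 0 meaning undefined) lands in a null space.\<close>
definition null_map :: "nat \<Rightarrow> nat \<Rightarrow> (complex^('n::{finite,linorder})) set
     \<Rightarrow> (complex^('n::{finite,linorder}) \<Rightarrow> complex^('m::{finite,linorder})) \<Rightarrow> bool" where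
  "null_map r' s' U G \<longleftrightarrow> (\<exists>H. null_space r' s' H \<and> (\<forall>z\<in>U. G z \<in> H))"

text \<open>G (a rational map on U, undefined where G z = 0) is linear with values in
the subspace A: it agrees, wherever both are defined, with the rational map
induced by a linear map L into A, which is defined somewhere on U.\<close>
definition linear_into :: "(complex^('m::{finite,linorder})) set \<Rightarrow> (complex^('n::{finite,linorder})) set
     \<Rightarrow> (complex^('n::{finite,linorder}) \<Rightarrow> complex^('m::{finite,linorder})) \<Rightarrow> bool" where
  "linear_into A U G \<longleftrightarrow> (\<exists>L. clinear L \<and> (\<forall>x. L x \<in> A) \<and>
      (\<exists>z\<in>U. L z \<noteq> 0 \<and> G z \<noteq> 0) \<and>
      (\<forall>z\<in>U. L z \<noteq> 0 \<and> G z \<noteq> 0 \<longrightarrow> pequiv (L z) (G z)))"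

text \<open>Same, with L a linear isometry into A (A with the restricted form).\<close>
definition standard_into :: "nat \<Rightarrow> nat \<Rightarrow> nat \<Rightarrow> nat \<Rightarrow> (complex^('m::{finite,linorder})) set
     \<Rightarrow> (complex^('n::{finite,linorder})) set \<Rightarrow> (complex^('n::{finite,linorder}) \<Rightarrow> complex^('m::{finite,linorder})) \<Rightarrow> bool" where
  "standard_into r s r' s' A U G \<longleftrightarrow> (\<exists>L. clinear L \<and> (\<forall>x. L x \<in> A) \<and>
      (\<forall>u v. hform r' s' (L u) (L v) = hform r s u v) \<and>
      (\<exists>z\<in>U. L z \<noteq> 0 \<and> G z \<noteq> 0) \<and>
      (\<forall>z\<in>U. L z \<noteq> 0 \<and> G z \<noteq> 0 \<longrightarrow> pequiv (L z) (G z)))"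

definition is_null where "is_null r' s' U F = null_map r' s' U F"
definition is_linear where "is_linear U F = linear_into UNIV U F"
definition is_standard where "is_standard r s r' s' U F = standard_into r s r' s' UNIV U F"

section \<open>Quasi-linear and quasi-standard maps\<close>

definition orth_decomp :: "nat \<Rightarrow> nat \<Rightarrow> (complex^('m::{finite,linorder})) set \<Rightarrow> (complex^('m::{finite,linorder})) set \<Rightarrow> bool" where
  "orth_decomp r' s' A B \<longleftrightarrow> vec.subspace A \<and> vec.subspace B \<and> A \<noteq> {0} \<and> B \<noteq> {0} \<and>
     A \<inter> B = {0} \<and> (\<forall>x. \<exists>a\<in>A. \<exists>b\<in>B. x = a + b) \<and>
     (\<forall>a\<in>A. \<forall>b\<in>B. hform r' s' a b = 0)"

text \<open>Linear projection onto A along B.\<close>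
definition proj_along :: "(complex^('m::{finite,linorder})) set \<Rightarrow> (complex^('m::{finite,linorder})) set \<Rightarrow> complex^('m::{finite,linorder}) \<Rightarrow> complex^('m::{finite,linorder})" where
  "proj_along A B x = (THE a. a \<in> A \<and> x - a \<in> B)"

definition quasi_linear where
  "quasi_linear r' s' U F \<longleftrightarrow> is_linear U F \<or>
     (\<exists>A B. orth_decomp r' s' A B \<and>
        linear_into A U (\<lambda>z. proj_along A B (F z)) \<and>
        null_map r' s' U (\<lambda>z. proj_along B A (F z)))"

definition quasi_standard where
  "quasi_standard r s r' s' U F \<longleftrightarrow> is_standard r s r' s' U F \<or>
     (\<exists>A B. orth_decomp r' s' A B \<and>
        standard_into r s r' s' A U (\<lambda>z. proj_along A B (F z)) \<and>
        null_map r' s' U (\<lambda>z. proj_along B A (F z)))"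

end

theory Submission
  imports Defs "HOL-Complex_Analysis.Conformal_Mappings"
begin

text \<open>
Near a null point take a holomorphic lift \<open>f\<close> of \<open>F\<close>, modulo the radical of the form on the span
\<open>T\<close> of its values, and let \<open>d k\<close> be the generic dimension of the span of \<open>f P\<close> over
\<open>k\<close>-dimensional subspaces \<open>P\<close>.  With \<open>m = min r s\<close>, null \<open>m\<close>-planes go to null subspaces
of \<open>T\<close>, and they form a totally real uniqueness set among all \<open>m\<close>-planes, so \<open>d m \<le> 2 * m - 2\<close>.
As \<open>d 1 = 1\<close>, some increment \<open>d (k + 1) - d k\<close> with \<open>k < m\<close> is at most one, and this bound persists
for the larger subspaces: a subspace \<open>H\<close> of codimension two has an image of codimension at most two in
\<open>T\<close>.  Orthogonality turns this into \<open>d 2 \<le> 2\<close>, that is, \<open>f\<close> maps lines to lines.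
Hence, seen from \<open>f z\<^sub>0\<close>, the map is given by its derivative at \<open>z\<^sub>0\<close>; comparing two base points shows
that \<open>f\<close> is induced by a linear map \<open>L\<close>, which is conformal because it preserves orthogonality.
\<close>

section \<open>Dimension of holomorphic families of vectors\<close>

text \<open>A lift exists only near a point and only up to a scalar, so every rank statement is
  reduced to one complex variable: rank at least \<delta> is the nonvanishing of one determinant,
  which is holomorphic along complex lines and quadratic paths. The obstacle that shapes the middle
  part is that generic tuples are dense and open while orthogonality is a closed condition, and both
  are needed at once. The remedy is to perturb one tuple into generic position, to bring the other
  back to orthogonality by a linear map near the identity, and to let the openness of genericity
  absorb that correction. The radical has to go because the dimensions of orthogonal subspaces are
  guaranteed to add up to at most \<open>vec.dim T\<close> only for a nondegenerate
  \<open>T\<close>. Null planes are totally real for a concrete reason: in a graph chart they fix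
  the Hermitian part of a matrix and leave its skew-Hermitian part free, so a real parameter made
  imaginary reaches every nearby plane. The bound on \<open>d 2\<close> comes from a generic pair
  orthogonal to \<open>H\<close>. A positive conformal factor can be scaled to 1, which gives the
  quasi-standard case.\<close>

lemma dim_det_witness:
  fixes Y :: "(complex^'m::finite) set"
  assumes "\<delta> \<le> vec.dim Y"
  obtains I :: "'m set" and y e where "card I = \<delta>" "\<And>i. i \<in> I \<Longrightarrow> y i \<in> Y"
    "det (\<chi> i. if i \<in> I then y i else e i :: complex^'m^'m) \<noteq> 0"
proof -
  obtain B where B: "B \<subseteq> Y" "vec.independent B" "card B = vec.dim Y"
    by (rule vec.basis_exists[of Y], rule that)
  have "finite B" using B(2) by (simp add: vec.finiteI_independent)
  then obtain B1 where B1: "B1 \<subseteq> B" "card B1 = \<delta>"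
    using assms B(3) by (metis obtain_subset_with_card_n)
  have iB1: "vec.independent B1" using B(2) B1(1) vec.independent_mono by blast
  obtain B2 where B2: "B1 \<subseteq> B2" "vec.independent B2" "UNIV \<subseteq> vec.span B2"
    by (rule vec.maximal_independent_subset_extend[OF subset_UNIV iB1], rule that)
  have fB2: "finite B2" using B2(2) by (simp add: vec.finiteI_independent)
  have dB2: "vec.dim B2 = CARD('m)"
  proof -
    have "vec.span B2 = UNIV" using B2(3) by auto
    then have "vec.dim B2 = vec.dim (UNIV :: (complex^'m) set)"
      by (metis vec.dim_span)
    then show ?thesis by (simp add: card_cart_basis vec.dimension_def)
  qed
  then have cB2: "card B2 = CARD('m)"
    using B2(2) vec.dim_eq_card_independent by metis
  then obtain h where h: "bij_betw h (UNIV :: 'm set) B2"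
    using fB2 by (metis finite_class.finite_UNIV finite_same_card_bij)
  define I where "I = h -` B1"
  have "h ` I = B1" using h B2(1) unfolding I_def bij_betw_def by auto
  moreover have "inj_on h I" using h by (metis bij_betw_def inj_on_subset subset_UNIV)
  ultimately have cI: "card I = \<delta>" using B1(2) card_image by metis
  let ?A = "\<chi> i. h i :: complex^'m^'m"
  have "rows ?A = B2"
    using h unfolding rows_def row_def bij_betw_def by (auto simp: vec_lambda_eta)
  then have "\<exists>B. B ** ?A = mat 1"
    unfolding matrix_left_invertible_span_rows_gen using B2(3) by auto
  then have "det ?A \<noteq> 0"
    using invertible_left_inverse invertible_det_nz by blast
  moreover have "(\<chi> i. if i \<in> I then h i else h i) = ?A" by simp
  ultimately show ?thesis
    using that[of I h h] cI B1(1) B(1) unfolding I_def by auto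
qed

text \<open>Converse of \<open>dim_det_witness\<close>. The rows outside \<open>I\<close> are filled
  with fixed vectors \<open>e\<close>, so a lower bound on the rank of \<open>Y\<close> becomes the
  nonvanishing of one determinant in the vectors \<open>y\<close> alone, which can be continued
  analytically or perturbed.\<close>

lemma det_witness_dim:
  fixes Y :: "(complex^'m::finite) set"
  assumes d: "det (\<chi> i. if i \<in> I then y i else e i :: complex^'m^'m) \<noteq> 0"
    and yY: "\<And>i. i \<in> I \<Longrightarrow> y i \<in> Y"
  shows "card I \<le> vec.dim Y"
proof -
  let ?r = "\<lambda>i. if i \<in> I then y i else e i"
  let ?A = "\<chi> i. ?r i :: complex^'m^'m"
  have rows: "rows ?A = range ?r"
    unfolding rows_def row_def by (auto simp: vec_lambda_eta)
  have ind: "vec.independent (range ?r)"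
    using d det_dependent_rows[of ?A] rows by auto
  have inj: "inj ?r"
  proof (rule injI, rule ccontr)
    fix i j assume "?r i = ?r j" "i \<noteq> j"
    then show False using d det_identical_rows[of i j ?A]
      by (simp add: row_def vec_lambda_eta)
  qed
  have "vec.independent (?r ` I)"
    by (rule vec.independent_mono[OF ind]) auto
  moreover have "?r ` I \<subseteq> Y" using yY by auto
  ultimately have "card (?r ` I) \<le> vec.dim Y" by (simp add: vec.independent_card_le_dim)
  moreover have "card (?r ` I) = card I" by (rule card_image[OF inj_on_subset[OF inj subset_UNIV]])
  ultimately show ?thesis by (simp only:)
qed

text \<open>A nonzero determinant at \<open>t1\<close>, with its filler rows frozen, becomes a
  holomorphic function of \<open>t\<close>. If the rank stayed below \<delta> on all of
  \<open>X\<close>, this function would vanish on a set with a limit point in the connected open set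
  \<open>J\<close>, hence at \<open>t1\<close>. Only finitely many indices \<open>c i\<close> enter,
  so \<open>A\<close> may be infinite.\<close>

lemma rank_continuation:
  fixes g :: "'c \<Rightarrow> complex \<Rightarrow> complex^'m::finite"
  assumes J: "open J" "connected J"
    and hol: "\<And>c i. c \<in> A \<Longrightarrow> (\<lambda>t. g c t $ i) holomorphic_on J"
    and t1: "t1 \<in> J" "\<delta> \<le> vec.dim ((\<lambda>c. g c t1) ` A)"
    and xi: "\<xi> \<in> J" "\<xi> islimpt X" "X \<subseteq> J"
  shows "\<exists>t\<in>X. \<delta> \<le> vec.dim ((\<lambda>c. g c t) ` A)"
proof (rule ccontr)
  assume neg: "\<not> ?thesis"
  obtain I :: "'m set" and y e where I: "card I = \<delta>"
    and y: "\<And>i. i \<in> I \<Longrightarrow> y i \<in> (\<lambda>c. g c t1) ` A"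
    and dt: "det (\<chi> i. if i \<in> I then y i else e i :: complex^'m^'m) \<noteq> 0"
    using dim_det_witness[OF t1(2)] by blast
  have "\<forall>i. \<exists>c. i \<in> I \<longrightarrow> c \<in> A \<and> y i = g c t1" using y by blast
  then obtain c where c: "\<And>i. i \<in> I \<Longrightarrow> c i \<in> A \<and> y i = g (c i) t1" by metis
  define M where "M t = (\<chi> i. if i \<in> I then g (c i) t else e i :: complex^'m^'m)" for t
  have hM: "(\<lambda>t. det (M t)) holomorphic_on J"
  proof -
    have e: "(\<lambda>t. M t $ i $ j) holomorphic_on J" for i j
      using hol c by (cases "i \<in> I") (auto simp: M_def)
    show ?thesis unfolding det_def by (intro holomorphic_intros e)
  qed
  have zero: "det (M t) = 0" if "t \<in> X" for t
  proof (rule ccontr)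
    assume "det (M t) \<noteq> 0"
    then have "card I \<le> vec.dim ((\<lambda>c. g c t) ` A)"
      unfolding M_def by (rule det_witness_dim) (use c in auto)
    then show False using neg that I by auto
  qed
  have "det (M t1) = 0"
    by (rule analytic_continuation[OF hM J xi(3,1,2) zero t1(1)])
  moreover have "M t1 = (\<chi> i. if i \<in> I then y i else e i)"
    unfolding M_def using c by (auto simp: vec_eq_iff)
  ultimately show False using dt by simp
qed

lemma continuous_on_det: "continuous_on UNIV (det :: complex^'m^'m::finite \<Rightarrow> complex)"
  unfolding det_def[abs_def] by (intro continuous_intros)

text \<open>Lower semicontinuity of rank through finitely many witnesses: \<open>Y'\<close> only has
  to contain perturbations of the vectors \<open>y i\<close>, which suits images of moving
  subspaces. The factor \<open>CARD('m)\<close> in the radius comes from bounding the norm of a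
  matrix by the sum of the norms of its rows.\<close>

lemma rank_open:
  fixes Y :: "(complex^'m::finite) set"
  shows "\<exists>(I :: 'm set) y \<eta>. \<eta> > 0 \<and> (\<forall>i\<in>I. y i \<in> Y) \<and>
    (\<forall>y' Y'. (\<forall>i\<in>I. norm (y' i - y i) < \<eta>) \<longrightarrow> y' ` I \<subseteq> Y' \<longrightarrow> vec.dim Y \<le> vec.dim Y')"
proof -
  define \<delta> where "\<delta> = vec.dim Y"
  obtain I :: "'m set" and y e where I: "card I = \<delta>"
    and y: "\<And>i. i \<in> I \<Longrightarrow> y i \<in> Y"
    and dt: "det (\<chi> i. if i \<in> I then y i else e i :: complex^'m^'m) \<noteq> 0"
    using dim_det_witness[of \<delta> Y] \<delta>_def by blast
  let ?M = "\<lambda>y. \<chi> i. if i \<in> I then y i else e i :: complex^'m^'m"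
  have "open (det -` (- {0 :: complex}) :: (complex^'m^'m) set)"
    using continuous_on_det by (intro open_vimage) auto
  then obtain r where r: "r > 0" "ball (?M y) r \<subseteq> det -` (- {0})"
    using dt unfolding open_contains_ball by blast
  have "\<delta> \<le> vec.dim Y'"
    if n: "\<forall>i\<in>I. norm (y' i - y i) < r / CARD('m)" and sub: "y' ` I \<subseteq> Y'" for y' Y'
  proof -
    have "norm (?M y' - ?M y) \<le> (\<Sum>i\<in>UNIV. norm ((?M y' - ?M y) $ i))"
      unfolding norm_vec_def[of "?M y' - ?M y"] by (rule L2_set_le_sum) auto
    also have "\<dots> < (\<Sum>i\<in>(UNIV :: 'm set). r / CARD('m))"
      by (rule sum_strict_mono) (use n r in auto)
    also have "\<dots> = r" by simp
    finally have "?M y' \<in> ball (?M y) r" by (simp add: dist_norm norm_minus_commute)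
    then have "det (?M y') \<noteq> 0" using r(2) by auto
    then show ?thesis using det_witness_dim[of I y' e Y'] sub I by auto
  qed
  moreover have "r / CARD('m) > 0" using r by simp
  ultimately show ?thesis unfolding \<delta>_def using y by blast
qed

section \<open>Diagonal Hermitian forms and the functionals they represent\<close>

lemma norm_vector_scaleC: "norm (c *s x) = norm c * norm (x :: complex^'n::finite)"
  unfolding norm_vec_def by (simp add: norm_mult L2_set_right_distrib)

text \<open>The weights are arbitrary reals: \<open>real_sig r s\<close> gives
  \<open>hform r s\<close>, and the constant weight 1 gives the Euclidean form, used to pick out
  coordinates. Realness of the weights makes the form Hermitian, see
  \<open>herm_cnj\<close>.\<close>

definition herm :: "('n::finite \<Rightarrow> real) \<Rightarrow> complex^'n \<Rightarrow> complex^'n \<Rightarrow> complex" where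
  "herm \<sigma> z w = (\<Sum>i\<in>UNIV. of_real (\<sigma> i) * z$i * cnj (w$i))"

lemma herm_add_left: "herm \<sigma> (x + y) w = herm \<sigma> x w + herm \<sigma> y w"
  and herm_add_right: "herm \<sigma> w (x + y) = herm \<sigma> w x + herm \<sigma> w y"
  and herm_diff_left: "herm \<sigma> (x - y) w = herm \<sigma> x w - herm \<sigma> y w"
  and herm_diff_right: "herm \<sigma> w (x - y) = herm \<sigma> w x - herm \<sigma> w y"
  and herm_scale_left: "herm \<sigma> (c *s x) w = c * herm \<sigma> x w"
  and herm_scale_right: "herm \<sigma> w (c *s x) = cnj c * herm \<sigma> w x"
  and herm_minus_left: "herm \<sigma> (- x) w = - herm \<sigma> x w"
  and herm_minus_right: "herm \<sigma> w (- x) = - herm \<sigma> w x"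
  and herm_zero_left: "herm \<sigma> 0 w = 0"
  and herm_zero_right: "herm \<sigma> w 0 = 0"
  unfolding herm_def
  by (auto simp: algebra_simps sum.distrib sum_subtractf sum_distrib_left sum_negf intro!: sum.cong)

lemma herm_sum_left: "herm \<sigma> (\<Sum>a\<in>A. g a) w = (\<Sum>a\<in>A. herm \<sigma> (g a) w)"
  by (induction A rule: infinite_finite_induct) (auto simp: herm_zero_left herm_add_left)

lemma herm_sum_right: "herm \<sigma> w (\<Sum>a\<in>A. g a) = (\<Sum>a\<in>A. herm \<sigma> w (g a))"
  by (induction A rule: infinite_finite_induct) (auto simp: herm_zero_right herm_add_right)

lemmas herm_simps = herm_add_left herm_add_right herm_diff_left herm_diff_right
  herm_scale_left herm_scale_right herm_minus_left herm_minus_right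
  herm_zero_left herm_zero_right herm_sum_left herm_sum_right

lemma herm_cnj: "cnj (herm \<sigma> z w) = herm \<sigma> w z"
  unfolding herm_def by (auto simp: algebra_simps intro!: sum.cong)

lemma herm_commute_zero: "herm \<sigma> z w = 0 \<longleftrightarrow> herm \<sigma> w z = 0"
  by (metis herm_cnj complex_cnj_zero_iff)

lemma herm_axis_right: "herm \<sigma> z (axis i 1) = of_real (\<sigma> i) * z$i"
  unfolding herm_def axis_def by (simp add: if_distrib cong: if_cong)

lemma herm_axis_left: "herm \<sigma> (axis i 1) z = of_real (\<sigma> i) * cnj (z$i)"
  unfolding herm_def axis_def by (simp add: if_distrib if_distribR cong: if_cong)

lemma herm_bound: "norm (herm \<sigma> z w) \<le> (\<Sum>i\<in>UNIV. \<bar>\<sigma> i\<bar>) * norm z * norm w"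
proof -
  have "norm (herm \<sigma> z w) \<le> (\<Sum>i\<in>UNIV. norm (of_real (\<sigma> i) * z$i * cnj (w$i)))"
    unfolding herm_def by (rule norm_sum)
  also have "\<dots> \<le> (\<Sum>i\<in>UNIV. \<bar>\<sigma> i\<bar> * (norm z * norm w))"
  proof (rule sum_mono)
    fix i
    have "norm (z$i) * norm (w$i) \<le> norm z * norm w"
      by (rule mult_mono) (auto simp: Finite_Cartesian_Product.norm_nth_le)
    then have "\<bar>\<sigma> i\<bar> * (norm (z$i) * norm (w$i)) \<le> \<bar>\<sigma> i\<bar> * (norm z * norm w)"
      by (rule mult_left_mono) simp
    then show "norm (of_real (\<sigma> i) * z$i * cnj (w$i)) \<le> \<bar>\<sigma> i\<bar> * (norm z * norm w)"
      by (simp add: norm_mult mult.assoc)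
  qed
  finally show ?thesis by (simp only: sum_distrib_right mult.assoc)
qed

text \<open>The representing vector has the values of \<open>\<phi>\<close> on the unit vectors,
  divided by the weights and conjugated, as coordinates; the conjugation is due to antilinearity in
  the second argument.\<close>

lemma herm_rep:
  fixes \<phi> :: "complex^'n::finite \<Rightarrow> complex"
  assumes nz: "\<forall>i. \<sigma> i \<noteq> 0"
    and add: "\<And>x y. \<phi> (x + y) = \<phi> x + \<phi> y" and scale: "\<And>c x. \<phi> (c *s x) = c * \<phi> x"
  obtains w where "\<And>x. \<phi> x = herm \<sigma> x w"
proof -
  have sum: "\<phi> (\<Sum>a\<in>A. g a) = (\<Sum>a\<in>A. \<phi> (g a))" for A :: "'n set" and g
    using scale[of 0 0] by (induction A rule: infinite_finite_induct) (auto simp: add)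
  have "\<phi> x = herm \<sigma> x (\<chi> i. cnj (\<phi> (axis i 1) / of_real (\<sigma> i)))" for x
  proof -
    have "\<phi> x = \<phi> (\<Sum>i\<in>UNIV. x$i *s axis i 1)" by (simp add: basis_expansion)
    also have "\<dots> = (\<Sum>i\<in>UNIV. x$i * \<phi> (axis i 1))" by (simp add: sum scale)
    also have "\<dots> = herm \<sigma> x (\<chi> i. cnj (\<phi> (axis i 1) / of_real (\<sigma> i)))"
      unfolding herm_def using nz by (auto intro!: sum.cong)
    finally show ?thesis .
  qed
  then show ?thesis using that by blast
qed

lemma dual_tuple:
  fixes a :: "'k \<Rightarrow> complex^'n::finite"
  assumes nz: "\<forall>i. \<sigma> i \<noteq> 0" and inj: "inj_on a K" and ind: "vec.independent (a ` K)"
  obtains c where "\<And>i j. i \<in> K \<Longrightarrow> j \<in> K \<Longrightarrow> herm \<sigma> (a j) (c i) = (if i = j then 1 else 0)"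
proof -
  have "\<exists>w. \<forall>j\<in>K. herm \<sigma> (a j) w = (if i = j then 1 else 0)" if "i \<in> K" for i
  proof -
    \<comment> \<open>The scalar functional dual to \<open>a i\<close> is carried by one coordinate
      \<open>l\<close> of a vector-valued linear map.\<close>
    fix l :: 'n
    obtain g where g: "Vector_Spaces.linear (*s) (*s) g"
      "\<forall>x\<in>a`K. g x = (if x = a i then axis l 1 else 0 :: complex^'n)"
      using vec.linear_independent_extend[OF ind, of "\<lambda>x. if x = a i then axis l 1 else 0 :: complex^'n"]
      by blast
    interpret g: Vector_Spaces.linear "(*s)" "(*s)" g by (rule g(1))
    obtain w where w: "\<And>x. g x $ l = herm \<sigma> x w"
      by (rule herm_rep[OF nz, of "\<lambda>x. g x $ l"]) (auto simp: g.add g.scale)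
    have "herm \<sigma> (a j) w = (if i = j then 1 else 0)" if "j \<in> K" for j
      using w[symmetric] g(2) that \<open>i \<in> K\<close> inj by (auto simp: inj_on_eq_iff)
    then show ?thesis by blast
  qed
  then show ?thesis using that by metis
qed

section \<open>Linear algebra of Hermitian forms\<close>

lemma clinearI:
  fixes g :: "complex^'n::finite \<Rightarrow> complex^'m::finite"
  assumes "\<And>x y. g (x + y) = g x + g y" "\<And>c x. g (c *s x) = c *s g x"
  shows "Vector_Spaces.linear (*s) (*s) g"
  using assms by unfold_locales auto

text \<open>The bound \<open>norm x \<le> 2 * norm (M x)\<close> makes \<open>M\<close> injective,
  hence surjective in finite dimension, and it also controls the distance from \<open>y\<close> to
  its preimage.\<close>

lemma near_identity_bij:
  fixes M :: "complex^'n::finite \<Rightarrow> complex^'n"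
  assumes lin: "Vector_Spaces.linear (*s) (*s) M"
    and near: "\<And>x. norm (M x - x) \<le> e * norm x" and e: "0 \<le> e" "e \<le> 1/2"
  shows "inj M" "\<exists>x. M x = y \<and> norm (x - y) \<le> 2 * e * norm y"
proof -
  have half: "e * norm x \<le> norm x / 2" for x :: "complex^'n"
    using mult_right_mono[OF e(2), of "norm x"] by simp
  have low: "norm x \<le> 2 * norm (M x)" for x
    using near[of x] half[of x] norm_triangle_ineq4[of "M x" "M x - x"] by simp
  show inj: "inj M"
    unfolding vec.linear_inj_iff_eq_0[OF lin] using low by (metis mult_zero_right norm_le_zero_iff norm_zero)
  then have "surj M" using lin vec.linear_inj_imp_surj by blast
  then obtain x where x: "M x = y" by (metis surjD)
  have "norm (x - y) \<le> e * norm x" using near[of x] x by (simp add: norm_minus_commute)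
  also have "\<dots> \<le> e * (2 * norm y)" using low[of x] x e by (intro mult_left_mono) auto
  finally show "\<exists>x. M x = y \<and> norm (x - y) \<le> 2 * e * norm y" using x by (auto simp: algebra_simps)
qed

lemma rank_update_linear:
  fixes c w :: "'k \<Rightarrow> complex^'n::finite"
  shows "Vector_Spaces.linear (*s) (*s) (\<lambda>x. x + (\<Sum>j\<in>K. herm \<sigma> x (c j) *s w j))"
proof (rule clinearI)
  show "x + y + (\<Sum>i\<in>K. herm \<sigma> (x + y) (c i) *s w i) =
    x + (\<Sum>i\<in>K. herm \<sigma> x (c i) *s w i) + (y + (\<Sum>i\<in>K. herm \<sigma> y (c i) *s w i))" for x y
    unfolding herm_add_left vec.scale_left_distrib sum.distrib by (simp only: add_ac)
  show "k *s x + (\<Sum>i\<in>K. herm \<sigma> (k *s x) (c i) *s w i) =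
    k *s (x + (\<Sum>i\<in>K. herm \<sigma> x (c i) *s w i))" for k x
    by (simp only: herm_scale_left vec.scale_right_distrib vec.scale_sum_right vec.scale_scale)
qed

lemma norm_combination_bound:
  fixes w :: "'k \<Rightarrow> complex^'n::finite"
  assumes "\<And>j. j \<in> K \<Longrightarrow> norm (a j) \<le> A j" "\<And>j. j \<in> K \<Longrightarrow> norm (w j) \<le> W j"
  shows "norm (\<Sum>j\<in>K. a j *s w j) \<le> (\<Sum>j\<in>K. A j * W j)"
proof -
  have "norm (\<Sum>j\<in>K. a j *s w j) \<le> (\<Sum>j\<in>K. norm (a j *s w j))" by (rule norm_sum)
  also have "\<dots> \<le> (\<Sum>j\<in>K. A j * W j)"
    unfolding norm_vector_scaleC
    by (intro sum_mono mult_mono) (use assms in \<open>auto intro: order_trans[OF norm_ge_zero]\<close>)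
  finally show ?thesis .
qed

text \<open>With \<open>c\<close> dual to \<open>a\<close>, the map \<open>M\<close> below satisfies
  \<open>herm \<sigma> (a j) (M x) = herm \<sigma> (a' j) x\<close>. So the solution of
  \<open>M b' = b\<close> is orthogonal to \<open>a'\<close> whenever \<open>b\<close> is orthogonal
  to \<open>a\<close>. The radius \<delta> is uniform in \<open>a'\<close> and in all
  \<open>b\<close> of norm at most \<open>R\<close>.\<close>

lemma orthogonal_perturbation:
  fixes a :: "'k \<Rightarrow> complex^'n::finite"
  assumes nz: "\<forall>i. \<sigma> i \<noteq> 0" and K: "finite K" "inj_on a K" "vec.independent (a ` K)"
    and eps: "\<epsilon> > 0"
  obtains \<delta> where "\<delta> > 0"
    "\<And>a' b. (\<And>i. i \<in> K \<Longrightarrow> norm (a' i - a i) < \<delta>) \<Longrightarrow> norm b \<le> R \<Longrightarrow> (\<And>i. i \<in> K \<Longrightarrow> herm \<sigma> (a i) b = 0) \<Longrightarrow>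
       \<exists>b'. norm (b' - b) < \<epsilon> \<and> (\<forall>i\<in>K. herm \<sigma> (a' i) b' = 0)"
proof -
  obtain c where c: "\<And>i j. i \<in> K \<Longrightarrow> j \<in> K \<Longrightarrow> herm \<sigma> (a j) (c i) = (if i = j then 1 else 0)"
    using dual_tuple[OF nz K(2,3)] by blast
  define C where "C = (\<Sum>i\<in>UNIV. \<bar>\<sigma> i\<bar>)"
  define D where "D = C * (\<Sum>i\<in>K. norm (c i)) + 1"
  have C0: "C \<ge> 0" unfolding C_def by (simp add: sum_nonneg)
  have D0: "D > 0" unfolding D_def using C0 by (smt (verit) mult_nonneg_nonneg norm_ge_zero sum_nonneg)
  \<comment> \<open>Chosen so that the displacement \<open>2 * e * norm b\<close> from
    \<open>near_identity_bij\<close> stays below \<epsilon> whenever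
    \<open>norm b \<le> R\<close>.\<close>
  define e where "e = min (1/2) (\<epsilon> / (2 * (\<bar>R\<bar> + 1)))"
  have e: "e > 0" "e \<le> 1/2" "e \<le> \<epsilon> / (2 * (\<bar>R\<bar> + 1))"
  proof -
    have "0 < \<epsilon> / (2 * (\<bar>R\<bar> + 1))" using eps by simp
    then show "e > 0" unfolding e_def by linarith
  qed (simp_all only: e_def min.cobounded1 min.cobounded2)
  show ?thesis
  proof (rule that[of "e / D"])
    show "e / D > 0" using e D0 by simp
    fix a' b assume near: "\<And>i. i \<in> K \<Longrightarrow> norm (a' i - a i) < e / D" and b: "norm b \<le> R"
      and orth: "\<And>i. i \<in> K \<Longrightarrow> herm \<sigma> (a i) b = 0"
    define M where "M x = x + (\<Sum>i\<in>K. herm \<sigma> x (a' i - a i) *s c i)" for x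
    have lin: "Vector_Spaces.linear (*s) (*s) M"
      unfolding M_def by (rule rank_update_linear)
    have nM: "norm (M x - x) \<le> e * norm x" for x
    proof -
      have "norm (M x - x) \<le> (\<Sum>i\<in>K. C * norm x * (e / D) * norm (c i))"
        unfolding M_def add_diff_cancel_left'
      proof (rule norm_combination_bound)
        fix i assume i: "i \<in> K"
        have "norm (herm \<sigma> x (a' i - a i)) \<le> C * norm x * norm (a' i - a i)"
          unfolding C_def by (rule herm_bound)
        also have "\<dots> \<le> C * norm x * (e / D)"
          using near[OF i] C0 by (intro mult_left_mono) auto
        finally show "norm (herm \<sigma> x (a' i - a i)) \<le> C * norm x * (e / D)" .
      qed simp
      also have "\<dots> = C * norm x * (e / D) * (\<Sum>i\<in>K. norm (c i))"
        by (simp only: sum_distrib_left)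
      also have "\<dots> = (e / D) * norm x * (D - 1)"
        by (simp add: D_def)
      also have "\<dots> \<le> (e / D) * norm x * D"
        using e D0 by (intro mult_left_mono) auto
      finally show ?thesis using D0 by simp
    qed
    obtain b' where b': "M b' = b" "norm (b' - b) \<le> 2 * e * norm b"
      using near_identity_bij(2)[OF lin nM less_imp_le[OF e(1)] e(2)] by blast
    have "2 * e * norm b \<le> 2 * (\<epsilon> / (2 * (\<bar>R\<bar> + 1))) * \<bar>R\<bar>"
      using b e eps by (intro mult_mono) auto
    also have "\<dots> < \<epsilon>" using eps by (simp add: field_simps)
    finally have "norm (b' - b) < \<epsilon>" using b' by simp
    moreover have "herm \<sigma> (a' j) b' = 0" if j: "j \<in> K" for j
    proof -
      have "0 = herm \<sigma> (a j) (M b')" using orth[OF j] b' by simp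
      also have "\<dots> = herm \<sigma> (a j) b' + (\<Sum>i\<in>K. cnj (herm \<sigma> b' (a' i - a i)) * (if i = j then 1 else 0))"
        unfolding M_def herm_add_right herm_sum_right herm_scale_right using c j by (simp cong: sum.cong)
      also have "(\<Sum>i\<in>K. cnj (herm \<sigma> b' (a' i - a i)) * (if i = j then 1 else 0)) = herm \<sigma> (a' j - a j) b'"
        using j K(1) by (simp add: herm_cnj if_distrib cong: if_cong)
      finally show ?thesis by (simp add: herm_simps)
    qed
    ultimately show "\<exists>b'. norm (b' - b) < \<epsilon> \<and> (\<forall>i\<in>K. herm \<sigma> (a' i) b' = 0)" by blast
  qed
qed

section \<open>Dimensions of orthogonal complements, null tuples and their duals\<close>

lemma subspace_orth: "vec.subspace W \<Longrightarrow> vec.subspace {x \<in> W. herm \<sigma> x w = 0}"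
  unfolding vec.subspace_def by (auto simp: herm_simps)

lemma subspace_orth_family: "vec.subspace W \<Longrightarrow> vec.subspace {x \<in> W. \<forall>i\<in>K. herm \<sigma> x (u i) = 0}"
  unfolding vec.subspace_def by (auto simp: herm_simps)

lemma dim_orth:
  fixes W :: "(complex^'n::finite) set"
  assumes W: "vec.subspace W"
  shows "vec.dim W \<le> vec.dim {x \<in> W. herm \<sigma> x w = 0} + 1"
proof (cases "\<exists>q\<in>W. herm \<sigma> q w \<noteq> 0")
  case False
  then have "{x \<in> W. herm \<sigma> x w = 0} = W" by auto
  then show ?thesis by simp
next
  case True
  then obtain q where q: "q \<in> W" "herm \<sigma> q w \<noteq> 0" by blast
  let ?W = "{x \<in> W. herm \<sigma> x w = 0}"
  have "W \<subseteq> vec.span (insert q ?W)"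
  proof
    fix y assume y: "y \<in> W"
    let ?k = "herm \<sigma> y w / herm \<sigma> q w"
    have "y - ?k *s q \<in> ?W"
      using y q W by (auto simp: herm_simps vec.subspace_diff vec.subspace_scale)
    then have "y - ?k *s q \<in> vec.span ?W" by (rule vec.span_base)
    then show "y \<in> vec.span (insert q ?W)" unfolding vec.span_breakdown_eq by blast
  qed
  then have "vec.dim W \<le> vec.dim (insert q ?W)" by (rule vec.dim_mono)
  also have "\<dots> \<le> vec.dim ?W + 1" by (simp add: vec.dim_insert)
  finally show ?thesis .
qed

lemma dim_orth_family:
  fixes W :: "(complex^'n::finite) set"
  assumes W: "vec.subspace W"
  shows "vec.dim W \<le> vec.dim {x \<in> W. \<forall>i<k. herm \<sigma> x (u i) = 0} + k"
proof (induction k)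
  case (Suc k)
  have s: "vec.subspace {x \<in> W. \<forall>i<k. herm \<sigma> x (u i) = 0}"
    using subspace_orth_family[OF W, of "{..<k}" \<sigma> u] by (simp add: Ball_def)
  have "{x \<in> W. \<forall>i<Suc k. herm \<sigma> x (u i) = 0} =
      {x \<in> {x \<in> W. \<forall>i<k. herm \<sigma> x (u i) = 0}. herm \<sigma> x (u k) = 0}"
    by (auto simp: less_Suc_eq)
  then show ?case using Suc dim_orth[OF s, of \<sigma> "u k"] by simp
qed simp

lemma dim_supported: "vec.dim {x :: complex^'n::finite. \<forall>i. i \<notin> P \<longrightarrow> x$i = 0} = card P"
  by (simp add: dim_substandard_cart)

lemma herm_self: "herm \<sigma> x x = of_real (\<Sum>i\<in>UNIV. \<sigma> i * (norm (x$i))\<^sup>2)"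
  unfolding herm_def of_real_sum
  by (intro sum.cong) (simp_all only: mult.assoc complex_norm_square of_real_mult)

text \<open>The vectors supported on \<open>P\<close> form a space of dimension
  \<open>card P\<close>, so \<open>k < card P\<close> linear conditions leave a nonzero one, on
  which the form is definite. The factor \<open>s\<close> lets one argument serve both the positive
  and the negative coordinates.\<close>

lemma definite_vector:
  fixes P :: "'n::finite set"
  assumes k: "k < card P" and pos: "\<And>i. i \<in> P \<Longrightarrow> s * \<sigma> i > 0"
  obtains x where "\<And>i. i \<notin> P \<Longrightarrow> x$i = 0" "\<And>i. i < (k::nat) \<Longrightarrow> herm \<sigma> x (u i) = 0"
    "s * Re (herm \<sigma> x x) > 0"
proof -
  let ?W = "{x :: complex^'n. \<forall>i. i \<notin> P \<longrightarrow> x$i = 0}"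
  have W: "vec.subspace ?W" unfolding vec.subspace_def by auto
  have "card P \<le> vec.dim {x \<in> ?W. \<forall>i<k. herm \<sigma> x (u i) = 0} + k"
    using dim_orth_family[OF W, of k \<sigma> u] dim_supported[of P] by simp
  then have "vec.dim {x \<in> ?W. \<forall>i<k. herm \<sigma> x (u i) = 0} \<noteq> 0" using k by linarith
  then obtain x where x: "x \<in> ?W" "\<forall>i<k. herm \<sigma> x (u i) = 0" "x \<noteq> 0"
    unfolding vec.dim_eq_0 by blast
  obtain i where i: "x$i \<noteq> 0" using x(3) by (auto simp: vec_eq_iff)
  have "s * Re (herm \<sigma> x x) = (\<Sum>i\<in>UNIV. s * \<sigma> i * (norm (x$i))\<^sup>2)"
    unfolding herm_self by (simp add: sum_distrib_left mult.assoc)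
  also have "\<dots> > 0"
  proof (rule sum_pos2[of _ i])
    show "0 < s * \<sigma> i * (cmod (x $ i))\<^sup>2" using i x(1) pos by (metis (mono_tags, lifting) mem_Collect_eq mult_pos_pos zero_less_norm_iff zero_less_power)
    show "0 \<le> s * \<sigma> j * (cmod (x $ j))\<^sup>2" for j
      using x(1) pos[of j] by (cases "j \<in> P") auto
  qed auto
  finally show ?thesis using that[of x] x by auto
qed

text \<open>A tuple of length less than \<open>m\<close> is prolonged by combining a positive vector
  \<open>x\<close> and a negative vector \<open>y\<close>, both orthogonal to the tuple; disjoint
  supports make them orthogonal to each other. Pairing with \<open>x\<close> kills the span of the
  old tuple but not the new vector, hence independence.\<close>

lemma null_tuple:
  fixes p :: "complex^'n::finite"
  assumes p: "p \<noteq> 0" "herm \<sigma> p p = 0"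
    and m: "m \<le> card {i. \<sigma> i > 0}" "m \<le> card {i. \<sigma> i < 0}"
    and k: "1 \<le> k" "k \<le> m"
  shows "\<exists>u. u 0 = p \<and> inj_on u {..<k} \<and> vec.independent (u ` {..<k}) \<and>
    (\<forall>i<k. \<forall>j<k. herm \<sigma> (u i) (u j) = 0)"
  using k
proof (induction k rule: dec_induct)
  case base
  have "vec.independent ((\<lambda>_. p) ` {..<1::nat})" using p by (simp add: lessThan_Suc)
  then show ?case using p by (intro exI[of _ "\<lambda>_. p"]) (auto simp: inj_on_def)
next
  case (step k)
  then obtain u where u: "u 0 = p" "inj_on u {..<k}" "vec.independent (u ` {..<k})"
    "\<forall>i<k. \<forall>j<k. herm \<sigma> (u i) (u j) = 0" by auto
  obtain x where x: "\<And>i. i \<notin> {i. \<sigma> i > 0} \<Longrightarrow> x$i = 0" "\<And>i. i < k \<Longrightarrow> herm \<sigma> x (u i) = 0"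
    "1 * Re (herm \<sigma> x x) > 0"
    by (rule definite_vector[of k "{i. \<sigma> i > 0}" 1 \<sigma> u]) (use step m in auto)
  obtain y where y: "\<And>i. i \<notin> {i. \<sigma> i < 0} \<Longrightarrow> y$i = 0" "\<And>i. i < k \<Longrightarrow> herm \<sigma> y (u i) = 0"
    "(-1) * Re (herm \<sigma> y y) > 0"
    by (rule definite_vector[of k "{i. \<sigma> i < 0}" "-1" \<sigma> u]) (use step m in auto)
  have xy: "herm \<sigma> x y = 0" unfolding herm_def
    by (rule sum.neutral) (metis complex_cnj_zero mem_Collect_eq mult_zero_left mult_zero_right not_less_iff_gr_or_eq x(1) y(1))
  then have yx: "herm \<sigma> y x = 0" using herm_commute_zero by blast
  define a b where "a = Re (herm \<sigma> x x)" and "b = - Re (herm \<sigma> y y)"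
  have ab: "a > 0" "b > 0" using x y by (auto simp: a_def b_def)
  have hx: "herm \<sigma> x x = of_real a" and hy: "herm \<sigma> y y = - of_real b"
    unfolding a_def b_def herm_self by simp_all
  \<comment> \<open>The weights make \<open>herm \<sigma> z z\<close> equal to
    \<open>b * a - a * b\<close>.\<close>
  define z where "z = of_real (sqrt b) *s x + of_real (sqrt a) *s y"
  have sq: "complex_of_real (sqrt a) * (of_real (sqrt a) * w) = of_real a * w"
    "complex_of_real (sqrt b) * (of_real (sqrt b) * w) = of_real b * w" for w
    using ab by (simp_all flip: mult.assoc of_real_mult)
  have zz: "herm \<sigma> z z = 0"
    unfolding z_def by (simp add: herm_simps xy yx hx hy sq)
  have zu: "herm \<sigma> z (u i) = 0" "herm \<sigma> (u i) z = 0" if "i < k" for i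
    using that x(2) y(2) herm_commute_zero[of \<sigma> z "u i"] by (auto simp: z_def herm_simps)
  have "z \<notin> vec.span (u ` {..<k})"
  proof
    assume "z \<in> vec.span (u ` {..<k})"
    then have "herm \<sigma> z x = 0"
    proof (induction rule: vec.span_induct_alt)
      case (step c w v)
      from step(1) obtain i where i: "i < k" "w = u i" by auto
      have "herm \<sigma> w x = 0" using x(2)[OF i(1)] i(2) herm_commute_zero by blast
      then show ?case using step(2) by (simp add: herm_simps)
    qed (simp add: herm_simps)
    moreover have "herm \<sigma> z x = of_real (sqrt b * a)" by (simp add: z_def herm_simps yx hx)
    ultimately show False using ab by simp
  qed
  moreover from this have "z \<notin> u ` {..<k}" using vec.span_base[of z "u ` {..<k}"] by blast
  ultimately have iz: "vec.independent (insert z (u ` {..<k}))" and zn: "z \<notin> u ` {..<k}"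
    using u(3) vec.independent_insertI by blast+
  have im: "(u(k := z)) ` {..<k} = u ` {..<k}" by (rule image_cong) auto
  have "inj_on (u(k := z)) {..<k}" using u(2) inj_on_cong[of "{..<k}" "u(k := z)" u] by auto
  then have "inj_on (u(k := z)) {..<Suc k}"
    using zn im unfolding lessThan_Suc inj_on_insert by (simp add: Diff_insert0)
  moreover have "vec.independent ((u(k := z)) ` {..<Suc k})"
    using iz im unfolding lessThan_Suc image_insert by simp
  moreover have "herm \<sigma> ((u(k := z)) i) ((u(k := z)) j) = 0" if "i < Suc k" "j < Suc k" for i j
    using that u(4) zz zu by (auto simp: less_Suc_eq)
  moreover have "(u(k := z)) 0 = p" using u(1) step(1) by simp
  ultimately show ?case by blast
qed

text \<open>From any dual tuple \<open>c\<close>, half of its Gram matrix applied to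
  \<open>q\<close> is subtracted. This does not disturb the pairing with \<open>q\<close>, because
  \<open>q\<close> is null, and it cancels the pairings of \<open>c\<close> with itself:
  \<open>q\<close> and \<open>q'\<close> become a hyperbolic pair.\<close>

lemma null_dual_tuple:
  fixes q :: "nat \<Rightarrow> complex^'n::finite"
  assumes nz: "\<forall>i. \<sigma> i \<noteq> 0" and q: "inj_on q {..<m}" "vec.independent (q ` {..<m})"
    and null: "\<And>i j. i < m \<Longrightarrow> j < m \<Longrightarrow> herm \<sigma> (q i) (q j) = 0"
  obtains q' where "\<And>i j. i < m \<Longrightarrow> j < m \<Longrightarrow> herm \<sigma> (q i) (q' j) = (if i = j then 1 else 0)"
    "\<And>i j. i < m \<Longrightarrow> j < m \<Longrightarrow> herm \<sigma> (q' i) (q' j) = 0"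
proof -
  obtain c where c: "\<And>i j. i < m \<Longrightarrow> j < m \<Longrightarrow> herm \<sigma> (q j) (c i) = (if i = j then 1 else 0)"
    using dual_tuple[OF nz q] by (metis (no_types, lifting) lessThan_iff)
  have c': "herm \<sigma> (c i) (q j) = (if i = j then 1 else 0)" if "i < m" "j < m" for i j
    using c[OF that] herm_cnj[of \<sigma> "q j" "c i"] by (auto split: if_splits)
  define q' where "q' j = c j - (\<Sum>k<m. (herm \<sigma> (c j) (c k) / 2) *s q k)" for j
  show ?thesis
  proof (rule that[of q'])
    fix i j assume ij: "i < m" "j < m"
    show "herm \<sigma> (q i) (q' j) = (if i = j then 1 else 0)"
      using ij c null by (simp add: q'_def herm_simps)
    have q1: "herm \<sigma> (q' i) (q l) = (if i = l then 1 else 0)" if "l < m" for l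
      using ij that c' null by (simp add: q'_def herm_simps)
    have "herm \<sigma> (q' i) (c j) = herm \<sigma> (c i) (c j) - (\<Sum>k<m. herm \<sigma> (c i) (c k) / 2 * herm \<sigma> (q k) (c j))"
      by (simp add: q'_def herm_simps)
    also have "(\<Sum>k<m. herm \<sigma> (c i) (c k) / 2 * herm \<sigma> (q k) (c j)) = (\<Sum>k<m. if k = j then herm \<sigma> (c i) (c k) / 2 else 0)"
      by (rule sum.cong) (use c ij in auto)
    finally have q2: "herm \<sigma> (q' i) (c j) = herm \<sigma> (c i) (c j) / 2" using ij by simp
    have "herm \<sigma> (q' i) (q' j) = herm \<sigma> (q' i) (c j) - (\<Sum>k<m. cnj (herm \<sigma> (c j) (c k) / 2) * herm \<sigma> (q' i) (q k))"
      unfolding q'_def[of j] by (simp add: herm_simps)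
    also have "(\<Sum>k<m. cnj (herm \<sigma> (c j) (c k) / 2) * herm \<sigma> (q' i) (q k)) = (\<Sum>k<m. if k = i then cnj (herm \<sigma> (c j) (c k)) / 2 else 0)"
      by (rule sum.cong) (use q1 in auto)
    finally show "herm \<sigma> (q' i) (q' j) = 0" using ij q2 by (simp add: herm_cnj)
  qed
qed

section \<open>Independent tuples close to a given vector, and graph charts of planes\<close>

lemma independent_of_dim:
  fixes v :: "'k \<Rightarrow> complex^'n::finite"
  assumes K: "finite K" and d: "card K \<le> vec.dim (v ` K)"
  shows "inj_on v K" "vec.independent (v ` K)"
proof -
  have c: "card (v ` K) \<le> card K" using K by (rule card_image_le)
  show ind: "vec.independent (v ` K)"
    by (rule vec.card_le_dim_spanning[of _ "v ` K"]) (use K d c in \<open>auto intro: vec.span_base\<close>)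
  then have "card (v ` K) = card K" using c d by (simp add: vec.dim_eq_card_independent)
  then show "inj_on v K" using K by (simp add: eq_card_imp_inj_on)
qed

lemma independent_tuple_by_span:
  fixes u v :: "'k \<Rightarrow> complex^'n::finite"
  assumes K: "finite K" and u: "inj_on u K" "vec.independent (u ` K)"
    and sub: "u ` K \<subseteq> vec.span (v ` K)"
  shows "inj_on v K" "vec.independent (v ` K)"
proof -
  have "card K = vec.dim (u ` K)" using u by (simp add: vec.dim_eq_card_independent card_image)
  also have "\<dots> \<le> vec.dim (v ` K)" by (rule vec.dim_mono[OF sub])
  finally show "inj_on v K" "vec.independent (v ` K)" using independent_of_dim[OF K] by blast+
qed

text \<open>In a basis of \<open>S\<close> that starts with \<open>p\<close>, every other vector is
  replaced by \<open>p\<close> plus a small multiple of it; the span of the first \<open>k\<close>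
  vectors stays the same.\<close>

lemma independent_tuple_near:
  fixes p :: "complex^'n::finite"
  assumes S: "vec.subspace S" "p \<in> S" "p \<noteq> 0" and k: "k \<le> vec.dim S" and eps: "\<epsilon> > 0"
  obtains v :: "nat \<Rightarrow> complex^'n" where "\<And>i. v i \<in> S" "\<And>i. norm (v i - p) < \<epsilon>" "v 0 = p"
    "inj_on v {..<k}" "vec.independent (v ` {..<k})"
proof -
  have "vec.independent {p}" using S by simp
  then obtain B where B: "{p} \<subseteq> B" "B \<subseteq> S" "vec.independent B" "S \<subseteq> vec.span B"
    using vec.maximal_independent_subset_extend[of "{p}" S] S by auto
  have fB: "finite B" using B by (simp add: vec.finiteI_independent)
  have "card B = vec.dim S" using B vec.basis_card_eq_dim by blast
  then have "k \<le> card B" using k by simp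
  obtain h where h: "bij_betw h {..<card B} B" 
    using ex_bij_betw_nat_finite[OF fB] by (auto simp: atLeast0LessThan)
  have B0: "0 < card B" using B fB by (metis card_gt_0_iff empty_iff insert_subset)
  define j where "j = inv_into {..<card B} h p"
  have j: "j < card B" "h j = p"
    using B h unfolding j_def bij_betw_def by (auto simp: f_inv_into_f) (metis inv_into_into insert_subset lessThan_iff)
  define u where "u = h \<circ> Transposition.transpose 0 j"
  have bt: "bij_betw (Transposition.transpose 0 j) {..<card B} {..<card B}"
    by (rule bij_betw_transpose_iff) (use j B0 in auto)
  then have bu: "bij_betw u {..<card B} B" unfolding u_def using h bij_betw_trans by blast
  have u0: "u 0 = p" by (simp add: u_def j)
  have uk: "inj_on u {..<k}" "u ` {..<k} \<subseteq> B"
    using bu \<open>k \<le> card B\<close> unfolding bij_betw_def by (auto intro: inj_on_subset)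
  then have ui: "vec.independent (u ` {..<k})" using B vec.independent_mono by blast
  define \<eta> where "\<eta> i = \<epsilon> / (norm (u i) + 1)" for i
  have eta: "\<eta> i > 0" "\<eta> i * norm (u i) < \<epsilon>" for i
  proof -
    have n: "0 < norm (u i) + 1" by (rule add_nonneg_pos) auto
    have n': "norm (u i) < norm (u i) + 1" by simp
    show "\<eta> i > 0" unfolding \<eta>_def using n eps by simp
    have "\<epsilon> * norm (u i) < \<epsilon> * (norm (u i) + 1)"
      using n' eps by (intro mult_strict_left_mono)
    then show "\<eta> i * norm (u i) < \<epsilon>" unfolding \<eta>_def using n by (simp add: divide_less_eq)
  qed
  \<comment> \<open>Indices from \<open>k\<close> on get the default \<open>p\<close>, so that
    membership in \<open>S\<close> and closeness to \<open>p\<close> hold for every index.\<close>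
  define v where "v i = (if i = 0 \<or> k \<le> i then p else p + of_real (\<eta> i) *s u i)" for i
  have sub: "u ` {..<k} \<subseteq> vec.span (v ` {..<k})"
  proof
    fix x assume "x \<in> u ` {..<k}"
    then obtain i where i: "i < k" "x = u i" by auto
    have v: "v i \<in> vec.span (v ` {..<k})" "v 0 \<in> vec.span (v ` {..<k})"
      using i by (auto intro!: vec.span_base)
    show "x \<in> vec.span (v ` {..<k})"
    proof (cases "i = 0")
      case True
      then show ?thesis using v i u0 by (simp add: v_def)
    next
      case False
      then have "x = (1 / of_real (\<eta> i)) *s (v i - v 0)"
        using i eta(1)[of i] by (auto simp: v_def)
      then show ?thesis using vec.span_scale[OF vec.span_diff[OF v]] by simp
    qed
  qed
  show ?thesis
  proof (rule that[of v])
    show "v i \<in> S" for i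
    proof (cases "i = 0 \<or> k \<le> i")
      case False
      then have "i \<in> {..<k}" by auto
      then have "u i \<in> S" using uk(2) B(2) by (meson image_subset_iff subsetD)
      then show ?thesis using False S by (simp add: v_def vec.subspace_add vec.subspace_scale)
    qed (use S in \<open>auto simp: v_def\<close>)
    show "norm (v i - p) < \<epsilon>" for i
      using eta[of i] eps by (auto simp: v_def norm_vector_scaleC)
    show "inj_on v {..<k}" "vec.independent (v ` {..<k})"
      using independent_tuple_by_span[OF _ uk(1) ui sub] by auto
  qed (simp add: v_def)
qed

text \<open>A plane near the span of \<open>q\<close> is the graph of a small map over it.
  \<open>N\<close> sends \<open>q i\<close> to \<open>v i\<close>, and \<open>R\<close> has the same
  pairings with \<open>q'\<close> but preserves the span of \<open>q\<close>, where it is the matrix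
  of the pairings of \<open>v\<close> with \<open>q'\<close>. Applying \<open>N\<close> to the
  preimages of \<open>q i\<close> under \<open>R\<close> therefore gives \<open>q i\<close> plus a
  vector orthogonal to \<open>q'\<close>, and these vectors span all \<open>v i\<close>.\<close>

lemma graph_basis:
  fixes q q' :: "nat \<Rightarrow> complex^'n::finite"
  assumes dual: "\<And>i j. i < m \<Longrightarrow> j < m \<Longrightarrow> herm \<sigma> (q i) (q' j) = (if i = j then 1 else 0)"
    and eps: "\<epsilon> > 0"
  shows "\<exists>\<delta>>0. \<forall>v. (\<forall>i<m. norm (v i - q i) < \<delta>) \<longrightarrow>
     (\<exists>\<phi>. (\<forall>i<m. \<forall>j<m. herm \<sigma> (\<phi> i) (q' j) = 0) \<and> (\<forall>i<m. norm (\<phi> i) < \<epsilon>) \<and>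
         v ` {..<m} \<subseteq> vec.span ((\<lambda>i. q i + \<phi> i) ` {..<m}))"
proof -
  define C where "C = (\<Sum>i\<in>UNIV. \<bar>\<sigma> i\<bar>)"
  define Q where "Q = (\<Sum>j<m. norm (q j) + norm (q' j))"
  have C0: "C \<ge> 0" and Q0: "Q \<ge> 0" unfolding C_def Q_def by (auto intro: sum_nonneg)
  have bd: "norm (q j) \<le> Q" "norm (q' j) \<le> Q" if "j < m" for j
  proof -
    have "norm (q j) + norm (q' j) \<le> Q"
      unfolding Q_def by (rule member_le_sum) (use that in auto)
    then show "norm (q j) \<le> Q" "norm (q' j) \<le> Q"
      using norm_ge_zero[of "q j"] norm_ge_zero[of "q' j"] by linarith+
  qed
  define L where "L = real m * (C * Q) + real m * (C * Q * (real m * (C * Q * Q))) + 1"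
  have L0: "L > 0" unfolding L_def using C0 Q0 by (intro add_nonneg_pos add_nonneg_nonneg mult_nonneg_nonneg) auto
  \<comment> \<open>The estimates below give
    \<open>norm (\<phi> i) \<le> 4 * (e * norm (q i))\<close>, so a fifth of \<epsilon>
    suffices.\<close>
  define e where "e = min (1/2) (\<epsilon> / (5 * (Q + 1)))"
  have "0 < \<epsilon> / (5 * (Q + 1))" using eps Q0 by simp
  then have e: "e > 0" "e \<le> 1/2" "e \<le> \<epsilon> / (5 * (Q + 1))" unfolding e_def by (simp, simp only: min.cobounded1, simp only: min.cobounded2)
  define \<delta> where "\<delta> = e / L"
  have d0: "\<delta> > 0" and dL: "\<delta> * L = e" using e L0 by (auto simp: \<delta>_def)
  show ?thesis
  proof (intro exI[of _ \<delta>] conjI allI impI)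
    show "\<delta> > 0" by (rule d0)
    fix v :: "nat \<Rightarrow> complex^'n" assume "\<forall>i<m. norm (v i - q i) < \<delta>"
    then have near: "\<And>i. i < m \<Longrightarrow> norm (v i - q i) < \<delta>" by simp
    define N where "N x = x + (\<Sum>j<m. herm \<sigma> x (q' j) *s (v j - q j))" for x
    define w where "w j = (\<Sum>k<m. herm \<sigma> (v j - q j) (q' k) *s q k)" for j
    define R where "R x = x + (\<Sum>j<m. herm \<sigma> x (q' j) *s w j)" for x
    have linN: "Vector_Spaces.linear (*s) (*s) N" and linR: "Vector_Spaces.linear (*s) (*s) R"
      unfolding N_def R_def by (rule rank_update_linear)+
    have h: "norm (herm \<sigma> x (q' j)) \<le> C * norm x * Q" if "j < m" for x j
    proof -
      have "norm (herm \<sigma> x (q' j)) \<le> C * norm x * norm (q' j)" unfolding C_def by (rule herm_bound)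
      also have "\<dots> \<le> C * norm x * Q" using bd(2)[OF that] C0 by (intro mult_left_mono) auto
      finally show ?thesis .
    qed
    have nw: "norm (w j) \<le> real m * (C * Q * Q) * \<delta>" if j: "j < m" for j
    proof -
      have "norm (w j) \<le> (\<Sum>k<m. (C * \<delta> * Q) * Q)"
        unfolding w_def
      proof (rule norm_combination_bound)
        fix k assume "k \<in> {..<m}"
        then have k: "k < m" by simp
        have "C * norm (v j - q j) * Q \<le> C * \<delta> * Q"
          using near[OF j] C0 Q0 by (intro mult_right_mono mult_left_mono) auto
        then show "norm (herm \<sigma> (v j - q j) (q' k)) \<le> C * \<delta> * Q" using h[OF k, of "v j - q j"] by linarith
        show "norm (q k) \<le> Q" by (rule bd(1)[OF k])
      qed
      then show ?thesis by (simp add: algebra_simps)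
    qed
    have nN: "norm (N x - x) \<le> e * norm x" for x
    proof -
      have "norm (N x - x) \<le> (\<Sum>j<m. C * norm x * Q * \<delta>)"
        unfolding N_def add_diff_cancel_left'
        by (rule norm_combination_bound) (use h near in \<open>auto intro: less_imp_le\<close>)
      also have "\<dots> = (real m * (C * Q)) * (\<delta> * norm x)" by (simp add: algebra_simps)
      also have "\<dots> \<le> L * (\<delta> * norm x)"
        unfolding L_def using C0 Q0 d0 by (intro mult_right_mono) auto
      finally show ?thesis unfolding dL[symmetric] by (simp add: mult_ac)
    qed
    have nR: "norm (R x - x) \<le> e * norm x" for x
    proof -
      have "norm (R x - x) \<le> (\<Sum>j<m. C * norm x * Q * (real m * (C * Q * Q) * \<delta>))"
        unfolding R_def add_diff_cancel_left'
        by (rule norm_combination_bound) (use h nw in auto)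
      also have "\<dots> = (real m * (C * Q * (real m * (C * Q * Q)))) * (\<delta> * norm x)" by (simp add: algebra_simps)
      also have "\<dots> \<le> L * (\<delta> * norm x)"
        unfolding L_def using C0 Q0 d0 by (intro mult_right_mono) auto
      finally show ?thesis unfolding dL[symmetric] by (simp add: mult_ac)
    qed
    have "\<forall>i. \<exists>x. R x = q i \<and> norm (x - q i) \<le> 2 * e * norm (q i)"
      using near_identity_bij(2)[OF linR nR less_imp_le[OF e(1)] e(2)] by blast
    then obtain x where x: "\<And>i. R (x i) = q i" "\<And>i. norm (x i - q i) \<le> 2 * e * norm (q i)"
      by metis
    define \<phi> where "\<phi> i = N (x i) - q i" for i
    have orth: "herm \<sigma> (\<phi> i) (q' l) = 0" if "i < m" "l < m" for i l
    proof -
      have w: "herm \<sigma> (w j) (q' l) = herm \<sigma> (v j - q j) (q' l)" for j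
      proof -
        have "herm \<sigma> (w j) (q' l) = (\<Sum>k<m. if k = l then herm \<sigma> (v j - q j) (q' k) else 0)"
          unfolding w_def herm_sum_left herm_scale_left
          by (rule sum.cong) (use dual that in auto)
        then show ?thesis using that by simp
      qed
      have "herm \<sigma> (N (x i)) (q' l) = herm \<sigma> (R (x i)) (q' l)"
        unfolding N_def R_def herm_add_left herm_sum_left herm_scale_left w by simp
      then show ?thesis using x(1) by (simp add: \<phi>_def herm_diff_left)
    qed
    moreover have "norm (\<phi> i) < \<epsilon>" if i: "i < m" for i
    proof -
      have "2 * e * norm (q i) \<le> 1 * norm (q i)" using e by (intro mult_right_mono) auto
      then have "norm (x i) \<le> 2 * norm (q i)"
        using x(2)[of i] norm_triangle_ineq[of "x i - q i" "q i"] by simp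
      then have "norm (N (x i) - x i) \<le> e * (2 * norm (q i))"
        using nN[of "x i"] e mult_left_mono[of "norm (x i)" "2 * norm (q i)" e] by linarith
      moreover have "norm (\<phi> i) \<le> norm (N (x i) - x i) + norm (x i - q i)"
        unfolding \<phi>_def using norm_triangle_ineq[of "N (x i) - x i" "x i - q i"] by simp
      ultimately have "norm (\<phi> i) \<le> 4 * (e * norm (q i))" using x(2)[of i] by (simp add: algebra_simps)
      also have "e * norm (q i) \<le> \<epsilon> / (5 * (Q + 1)) * (Q + 1)"
        using e bd(1)[OF i] Q0 eps by (intro mult_mono) auto
      also have "\<dots> = \<epsilon> / 5"
      proof -
        have "Q + 1 \<noteq> 0" using Q0 by linarith
        then have "\<epsilon> / 5 / (Q + 1) * (Q + 1) = \<epsilon> / 5" by (rule nonzero_eq_divide_eq[THEN iffD1, OF _ refl])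
        then show ?thesis by (simp only: divide_divide_eq_left)
      qed
      finally show ?thesis using eps by simp
    qed
    moreover have "v ` {..<m} \<subseteq> vec.span ((\<lambda>i. q i + \<phi> i) ` {..<m})"
    proof
      fix y assume "y \<in> v ` {..<m}"
      then obtain i where i: "i < m" "y = v i" by auto
      interpret R: Vector_Spaces.linear "(*s)" "(*s)" R by (rule linR)
      interpret N: Vector_Spaces.linear "(*s)" "(*s)" N by (rule linN)
      define a where "a k = herm \<sigma> (v i) (q' k)" for k
      have dsum: "(\<Sum>j<m. herm \<sigma> (q i) (q' j) *s g j) = g i" for g :: "nat \<Rightarrow> complex^'n"
      proof -
        have "(\<Sum>j<m. herm \<sigma> (q i) (q' j) *s g j) = (\<Sum>j<m. if j = i then g j else 0)"
          by (rule sum.cong) (use dual i in auto)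
        then show ?thesis using i by simp
      qed
      have "R (q i) = q i + w i" unfolding R_def dsum by simp
      also have "w i = (\<Sum>k<m. a k *s q k) - q i"
        unfolding w_def a_def herm_diff_left vec.scale_left_diff_distrib sum_subtractf dsum by simp
      also have "q i + ((\<Sum>k<m. a k *s q k) - q i) = R (\<Sum>k<m. a k *s x k)"
        by (simp add: R.sum R.scale x(1))
      finally have "q i = (\<Sum>k<m. a k *s x k)"
        using near_identity_bij(1)[OF linR nR less_imp_le[OF e(1)] e(2)] by (meson injD)
      then have "N (q i) = (\<Sum>k<m. a k *s N (x k))" by (simp add: N.sum N.scale)
      moreover have "N (q i) = v i" unfolding N_def dsum by simp
      ultimately have "y = (\<Sum>k<m. a k *s (q k + \<phi> k))" using i by (simp add: \<phi>_def)
      moreover have "(\<Sum>k<m. a k *s (q k + \<phi> k)) \<in> vec.span ((\<lambda>i. q i + \<phi> i) ` {..<m})"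
        by (rule vec.span_sum, rule vec.span_scale, rule vec.span_base, rule imageI)
      ultimately show "y \<in> vec.span ((\<lambda>i. q i + \<phi> i) ` {..<m})" by (simp only:)
    qed
    ultimately show "\<exists>\<phi>. (\<forall>i<m. \<forall>j<m. herm \<sigma> (\<phi> i) (q' j) = 0) \<and> (\<forall>i<m. norm (\<phi> i) < \<epsilon>) \<and>
         v ` {..<m} \<subseteq> vec.span ((\<lambda>i. q i + \<phi> i) ` {..<m})" by blast
  qed
qed

text \<open>Null planes are a totally real uniqueness set: every tuple close to \<open>q\<close> in graph form is the value at
  \<open>t = \<i>\<close> of a quadratic path that consists of null tuples for real \<open>t\<close>.\<close>

lemma null_path:
  fixes q q' :: "nat \<Rightarrow> complex^'n::finite"
  assumes dual: "\<And>i j. i < m \<Longrightarrow> j < m \<Longrightarrow> herm \<sigma> (q i) (q' j) = (if i = j then 1 else 0)"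
    and nq: "\<And>i j. i < m \<Longrightarrow> j < m \<Longrightarrow> herm \<sigma> (q i) (q j) = 0"
    and nq': "\<And>i j. i < m \<Longrightarrow> j < m \<Longrightarrow> herm \<sigma> (q' i) (q' j) = 0"
    and eps: "\<epsilon> > 0"
  shows "\<exists>\<delta>>0. \<forall>\<phi>. (\<forall>i<m. \<forall>j<m. herm \<sigma> (\<phi> i) (q' j) = 0) \<longrightarrow> (\<forall>i<m. norm (\<phi> i) < \<delta>) \<longrightarrow>
     (\<exists>a b c. (\<forall>i<m. a i + \<i> *s b i + \<i>\<^sup>2 *s c i = q i + \<phi> i) \<and>
       (\<forall>i<m. \<forall>j<m. \<forall>t. t \<in> \<real> \<longrightarrow> herm \<sigma> (a i + t *s b i + t\<^sup>2 *s c i) (a j + t *s b j + t\<^sup>2 *s c j) = 0) \<and>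
       (\<forall>i<m. \<forall>t. norm t < 2 \<longrightarrow> norm (a i + t *s b i + t\<^sup>2 *s c i - q i) < \<epsilon>))"
proof -
  define C where "C = (\<Sum>i\<in>UNIV. \<bar>\<sigma> i\<bar>)"
  define Q where "Q = (\<Sum>j<m. norm (q j) + norm (q' j))"
  have C0: "C \<ge> 0" and Q0: "Q \<ge> 0" unfolding C_def Q_def by (auto intro: sum_nonneg)
  have bd: "norm (q j) \<le> Q" "norm (q' j) \<le> Q" if "j < m" for j
  proof -
    have "norm (q j) + norm (q' j) \<le> Q"
      unfolding Q_def by (rule member_le_sum) (use that in auto)
    then show "norm (q j) \<le> Q" "norm (q' j) \<le> Q"
      using norm_ge_zero[of "q j"] norm_ge_zero[of "q' j"] by linarith+
  qed
  define A where "A = real m * (C * Q * Q)"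
  define B where "B = real m * (C * Q)"
  have AB: "A \<ge> 0" "B \<ge> 0" unfolding A_def B_def using C0 Q0 by auto
  \<comment> \<open>This is \<open>A + 2 * (1 + A + B) + 4 * B\<close>, the displacement of the path
    in units of \<delta> for \<open>norm t < 2\<close>; that disc contains \<open>\<i>\<close>,
    where the path has to arrive.\<close>
  define L where "L = 2 + 3 * A + 6 * B"
  have L0: "L > 0" unfolding L_def using AB by linarith
  define \<delta> where "\<delta> = min 1 (\<epsilon> / (2 * L))"
  have "0 < \<epsilon> / (2 * L)" using eps L0 by simp
  then have d: "\<delta> > 0" "\<delta> \<le> 1" "\<delta> \<le> \<epsilon> / (2 * L)" unfolding \<delta>_def by (simp, simp only: min.cobounded1, simp only: min.cobounded2)
  have dL: "\<delta> * L < \<epsilon>" 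
  proof -
    have "\<delta> * L \<le> \<epsilon> / (2 * L) * L" using d L0 by (intro mult_right_mono) auto
    also have "\<dots> < \<epsilon>" using L0 eps by simp
    finally show ?thesis .
  qed
  show ?thesis
  proof (rule exI[of _ \<delta>], intro conjI allI impI)
    show "\<delta> > 0" by (rule d(1))
    fix \<phi> :: "nat \<Rightarrow> complex^'n"
    assume "\<forall>i<m. \<forall>j<m. herm \<sigma> (\<phi> i) (q' j) = 0" and "\<forall>i<m. norm (\<phi> i) < \<delta>"
    then have orth: "\<And>i j. i < m \<Longrightarrow> j < m \<Longrightarrow> herm \<sigma> (\<phi> i) (q' j) = 0"
      and small: "\<And>i. i < m \<Longrightarrow> norm (\<phi> i) < \<delta>" by auto
    \<comment> \<open>Nullity of \<open>q + \<phi>\<close> would force the Hermitian part of the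
      pairings of \<open>\<phi>\<close> with \<open>q\<close> to be minus half of the Gram matrix of
      \<open>\<phi>\<close>, and it leaves the skew-Hermitian part \<open>S\<close> free. Hence
      \<open>q + sg\<close> is a null tuple for every \<open>\<phi>\<close>.\<close>
    define S where "S i j = (herm \<sigma> (\<phi> i) (q j) - cnj (herm \<sigma> (\<phi> j) (q i))) / 2" for i j
    define sg where "sg i = (\<Sum>j<m. S i j *s q' j)" for i
    \<comment> \<open>For real \<open>t\<close>, the pairings of \<open>psi\<close> with
      \<open>q\<close> are \<open>- \<i>\<close> times a Hermitian matrix, so the linear terms
      cancel, and \<open>chi\<close> compensates the Gram matrix of \<open>psi\<close>, which equals
      that of \<open>\<phi>\<close>. The factor \<open>- \<i>\<close> in \<open>psi\<close> makes
      the path arrive at \<open>q + \<phi>\<close> for \<open>t = \<i>\<close>.\<close>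
    define chi where "chi i = (\<Sum>k<m. (- (herm \<sigma> (\<phi> i) (\<phi> k) / 2)) *s q' k)" for i
    define psi where "psi i = (- \<i>) *s (\<phi> i - sg i + chi i)" for i
    have q'q: "herm \<sigma> (q' i) (q j) = (if i = j then 1 else 0)" if "i < m" "j < m" for i j
      using dual[OF that(2,1)] herm_cnj[of \<sigma> "q j" "q' i"] by (auto split: if_splits)
    have q'phi: "herm \<sigma> (q' i) (\<phi> j) = 0" if "i < m" "j < m" for i j
      using orth that herm_commute_zero by blast
    have q'sum: "herm \<sigma> (q' i) (\<Sum>j<m. s j *s q' j) = 0" "herm \<sigma> (\<Sum>j<m. s j *s q' j) (q' i) = 0" if "i < m" for i s
      using that nq' unfolding herm_sum_right herm_sum_left herm_scale_left herm_scale_right by (auto intro: sum.neutral)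
    have sumq: "herm \<sigma> (\<Sum>j<m. s j *s q' j) (q i) = s i" if "i < m" for i s
    proof -
      have "herm \<sigma> (\<Sum>j<m. s j *s q' j) (q i) = (\<Sum>j<m. if j = i then s j else 0)"
        unfolding herm_sum_left herm_scale_left by (rule sum.cong) (use q'q that in auto)
      then show ?thesis using that by simp
    qed
    have qsum: "herm \<sigma> (q i) (\<Sum>j<m. s j *s q' j) = cnj (s i)" if "i < m" for i s
      using sumq[OF that, of s] herm_cnj[of \<sigma> "\<Sum>j<m. s j *s q' j" "q i"] by simp
    have sumphi: "herm \<sigma> (\<Sum>j<m. s j *s q' j) (\<phi> i) = 0" "herm \<sigma> (\<phi> i) (\<Sum>j<m. s j *s q' j) = 0" if "i < m" for i s
      using that orth q'phi unfolding herm_sum_right herm_sum_left herm_scale_left herm_scale_right by (auto intro: sum.neutral)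
    have sumsum: "herm \<sigma> (\<Sum>j<m. s j *s q' j) (\<Sum>j<m. s' j *s q' j) = 0" for s s'
    proof -
      have "herm \<sigma> (\<Sum>j<m. s j *s q' j) (\<Sum>j<m. s' j *s q' j) = (\<Sum>j<m. s j * herm \<sigma> (q' j) (\<Sum>j<m. s' j *s q' j))"
        unfolding herm_sum_left herm_scale_left ..
      also have "\<dots> = 0" by (rule sum.neutral) (use q'sum in auto)
      finally show ?thesis .
    qed
    have rules: "herm \<sigma> (sg i) (q j) = S i j" "herm \<sigma> (q j) (sg i) = cnj (S i j)"
        "herm \<sigma> (chi i) (q j) = - (herm \<sigma> (\<phi> i) (\<phi> j) / 2)" "herm \<sigma> (q j) (chi i) = cnj (- (herm \<sigma> (\<phi> i) (\<phi> j) / 2))"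
        "herm \<sigma> (sg i) (sg j) = 0" "herm \<sigma> (sg i) (chi j) = 0" "herm \<sigma> (chi i) (sg j) = 0" "herm \<sigma> (chi i) (chi j) = 0"
        "herm \<sigma> (sg i) (\<phi> j) = 0" "herm \<sigma> (\<phi> j) (sg i) = 0" "herm \<sigma> (chi i) (\<phi> j) = 0" "herm \<sigma> (\<phi> j) (chi i) = 0"
      if "i < m" "j < m" for i j
      unfolding sg_def chi_def using that by (simp_all only: sumq qsum sumsum sumphi)
    have Gsym: "cnj (herm \<sigma> (\<phi> i) (\<phi> j)) = herm \<sigma> (\<phi> j) (\<phi> i)" for i j by (rule herm_cnj)
    have qphi: "herm \<sigma> (q i) (\<phi> j) = cnj (herm \<sigma> (\<phi> j) (q i))" for i j by (simp add: herm_cnj)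
    have Scnj: "cnj (S j i) = - S i j" for i j unfolding S_def by (simp add: field_simps)
    have pq: "herm \<sigma> (psi i) (q j) + herm \<sigma> (q i) (psi j) = 0" if "i < m" "j < m" for i j
    proof -
      have 1: "herm \<sigma> (psi i) (q j) = - \<i> * (herm \<sigma> (\<phi> i) (q j) - S i j - herm \<sigma> (\<phi> i) (\<phi> j) / 2)"
        unfolding psi_def herm_simps rules(1)[OF that] rules(3)[OF that] by simp
      have 2: "herm \<sigma> (q i) (psi j) = \<i> * (cnj (herm \<sigma> (\<phi> j) (q i)) + S i j - herm \<sigma> (\<phi> i) (\<phi> j) / 2)"
        unfolding psi_def herm_simps rules(2)[OF that(2,1)] rules(4)[OF that(2,1)] qphi Scnj by (simp add: Gsym)
      show ?thesis unfolding 1 2 S_def by (simp add: field_simps)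
    qed
    have pp: "herm \<sigma> (psi i) (psi j) = herm \<sigma> (\<phi> i) (\<phi> j)" if "i < m" "j < m" for i j
      unfolding psi_def herm_simps using that rules[of i j] rules[of j i] by simp
    have sp: "herm \<sigma> (sg i) (psi j) = 0" "herm \<sigma> (psi j) (sg i) = 0" "herm \<sigma> (chi i) (psi j) = 0" "herm \<sigma> (psi j) (chi i) = 0"
      if "i < m" "j < m" for i j
      unfolding psi_def herm_simps using that rules[of i j] rules[of j i] by simp_all
    have null: "herm \<sigma> (q i + sg i + t *s psi i + t\<^sup>2 *s chi i) (q j + sg j + t *s psi j + t\<^sup>2 *s chi j) = 0"
      if ij: "i < m" "j < m" and t: "t \<in> \<real>" for i j t
    proof -
      have ct: "cnj t = t" using t by (simp add: Reals_cnj_iff)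
      have "herm \<sigma> (q i + sg i + t *s psi i + t\<^sup>2 *s chi i) (q j + sg j + t *s psi j + t\<^sup>2 *s chi j) =
        (S i j + cnj (S j i)) + t * (herm \<sigma> (psi i) (q j) + herm \<sigma> (q i) (psi j)) +
        t * t * (herm \<sigma> (psi i) (psi j) - herm \<sigma> (\<phi> i) (\<phi> j) / 2 - cnj (herm \<sigma> (\<phi> j) (\<phi> i)) / 2)"
        unfolding herm_simps using ij rules[of i j] rules[of j i] sp[of i j] sp[of j i] nq[of i j]
        by (simp add: ct power2_eq_square algebra_simps)
      also have "\<dots> = 0" using pq pp ij by (simp add: Scnj Gsym)
      finally show ?thesis .
    qed
    have nsg: "norm (sg i) \<le> A * \<delta>" if i: "i < m" for i
    proof -
      have h: "norm (herm \<sigma> (\<phi> i) (q j)) \<le> C * Q * \<delta>" if "i < m" "j < m" for i j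
      proof -
        have "norm (herm \<sigma> (\<phi> i) (q j)) \<le> C * norm (\<phi> i) * norm (q j)" unfolding C_def by (rule herm_bound)
        also have "\<dots> \<le> C * \<delta> * Q" using bd(1)[OF that(2)] small[OF that(1)] C0 d by (intro mult_mono) auto
        finally show ?thesis by (simp add: mult_ac)
      qed
      have "norm (sg i) \<le> (\<Sum>j<m. (C * Q * \<delta>) * Q)"
        unfolding sg_def
      proof (rule norm_combination_bound)
        fix j assume "j \<in> {..<m}"
        then have j: "j < m" by simp
        have "norm (herm \<sigma> (\<phi> i) (q j) - cnj (herm \<sigma> (\<phi> j) (q i))) \<le> C * Q * \<delta> + C * Q * \<delta>"
          using h[OF i j] h[OF j i] norm_triangle_ineq4[of "herm \<sigma> (\<phi> i) (q j)" "cnj (herm \<sigma> (\<phi> j) (q i))"]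
          by simp
        then show "norm (S i j) \<le> C * Q * \<delta>" unfolding S_def norm_divide by simp
        show "norm (q' j) \<le> Q" by (rule bd(2)[OF j])
      qed
      then show ?thesis unfolding A_def by (simp add: mult_ac)
    qed
    have nchi: "norm (chi i) \<le> B * \<delta>" if i: "i < m" for i
    proof -
      have "norm (chi i) \<le> (\<Sum>k<m. (C * \<delta>) * Q)"
        unfolding chi_def
      proof (rule norm_combination_bound)
        fix k assume "k \<in> {..<m}"
        then have k: "k < m" by simp
        have "norm (herm \<sigma> (\<phi> i) (\<phi> k)) \<le> C * norm (\<phi> i) * norm (\<phi> k)" unfolding C_def by (rule herm_bound)
        also have "\<dots> \<le> C * \<delta> * 1" using small[OF i] small[OF k] C0 d by (intro mult_mono) auto
        finally show "norm (- (herm \<sigma> (\<phi> i) (\<phi> k) / 2)) \<le> C * \<delta>"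
          using mult_nonneg_nonneg[OF C0 less_imp_le[OF d(1)]] by (simp add: norm_divide)
        show "norm (q' k) \<le> Q" by (rule bd(2)[OF k])
      qed
      then show ?thesis unfolding B_def by (simp add: mult_ac)
    qed
    have npsi: "norm (psi i) \<le> \<delta> + A * \<delta> + B * \<delta>" if i: "i < m" for i
    proof -
      have "norm (psi i) = norm (\<phi> i - sg i + chi i)" unfolding psi_def norm_vector_scaleC by simp
      also have "\<dots> \<le> norm (\<phi> i) + norm (sg i) + norm (chi i)"
        using norm_triangle_ineq[of "\<phi> i - sg i" "chi i"] norm_triangle_ineq4[of "\<phi> i" "sg i"] by linarith
      finally show ?thesis using small[OF i] nsg[OF i] nchi[OF i] by linarith
    qed
    have near: "norm (q i + sg i + t *s psi i + t\<^sup>2 *s chi i - q i) < \<epsilon>" if i: "i < m" and t: "norm t < 2" for i t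
    proof -
      have "norm (q i + sg i + t *s psi i + t\<^sup>2 *s chi i - q i) = norm (sg i + t *s psi i + t\<^sup>2 *s chi i)"
        by (simp add: algebra_simps)
      also have "\<dots> \<le> norm (sg i) + norm t * norm (psi i) + (norm t)\<^sup>2 * norm (chi i)"
        using norm_triangle_ineq[of "sg i + t *s psi i" "t\<^sup>2 *s chi i"] norm_triangle_ineq[of "sg i" "t *s psi i"]
        by (simp add: norm_vector_scaleC norm_power)
      also have "\<dots> \<le> A * \<delta> + 2 * (\<delta> + A * \<delta> + B * \<delta>) + 2\<^sup>2 * (B * \<delta>)"
        using nsg[OF i] npsi[OF i] nchi[OF i] t AB d by (intro add_mono mult_mono power_mono) auto
      also have "\<dots> = \<delta> * L" unfolding L_def by (simp add: algebra_simps)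
      finally show ?thesis using dL by linarith
    qed
    have fin: "q i + sg i + \<i> *s psi i + \<i>\<^sup>2 *s chi i = q i + \<phi> i" for i
    proof -
      have "\<i> *s psi i = \<phi> i - sg i + chi i" unfolding psi_def vec.scale_scale by simp
      moreover have "\<i>\<^sup>2 *s chi i = - chi i" by (simp add: vec_eq_iff)
      ultimately show ?thesis by simp
    qed
    show "\<exists>a b c. (\<forall>i<m. a i + \<i> *s b i + \<i>\<^sup>2 *s c i = q i + \<phi> i) \<and>
       (\<forall>i<m. \<forall>j<m. \<forall>t. t \<in> \<real> \<longrightarrow> herm \<sigma> (a i + t *s b i + t\<^sup>2 *s c i) (a j + t *s b j + t\<^sup>2 *s c j) = 0) \<and>
       (\<forall>i<m. \<forall>t. norm t < 2 \<longrightarrow> norm (a i + t *s b i + t\<^sup>2 *s c i - q i) < \<epsilon>)"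
      by (rule exI[of _ "\<lambda>i. q i + sg i"], rule exI[of _ psi], rule exI[of _ chi])
        (intro conjI allI impI; rule fin null near; assumption)
  qed
qed

section \<open>Generic rank of a holomorphic germ on subspaces\<close>

lemma span_tuple:
  fixes v :: "nat \<Rightarrow> complex^'n::finite"
  assumes "x \<in> vec.span (v ` {..<k})"
  shows "\<exists>c. x = (\<Sum>j<k. c j *s v j)"
  using assms
proof (induction rule: vec.span_induct_alt)
  case base
  show ?case by (rule exI[of _ "\<lambda>_. 0"]) simp
next
  case (step a x y)
  then obtain c i where c: "y = (\<Sum>j<k. c j *s v j)" and i: "i < k" "x = v i" by auto
  have "(\<Sum>j<k. (if j = i then a else 0) *s v j) = (\<Sum>j<k. if j = i then a *s v j else 0)"
    by (rule sum.cong) auto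
  also have "\<dots> = a *s x" using i by simp
  finally have "a *s x + y = (\<Sum>j<k. (if j = i then a else 0) *s v j) + (\<Sum>j<k. c j *s v j)"
    using c by simp
  also have "\<dots> = (\<Sum>j<k. ((if j = i then a else 0) + c j) *s v j)"
    unfolding sum.distrib[symmetric] vec.scale_left_distrib[symmetric] ..
  finally show ?case by (intro exI[of _ "\<lambda>j. (if j = i then a else 0) + c j"])
qed

lemma tuple_span: "(\<Sum>j<k. c j *s v j) \<in> vec.span (v ` {..<k::nat})"
  by (rule vec.span_sum, rule vec.span_scale, rule vec.span_base, rule imageI)

section \<open>Quadratic paths in one complex variable\<close>

lemma scale_left_bounded_linear: "bounded_linear (\<lambda>t. t *s (b :: complex^'n::finite))"
proof (rule bounded_linear_intro[where K = "norm b"])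
  show "(x + y) *s b = x *s b + y *s b" for x y by (rule vec.scale_left_distrib)
  show "(r *\<^sub>R x) *s b = r *\<^sub>R (x *s b)" for r x by (simp add: vec_eq_iff)
  show "norm (x *s b) \<le> norm x * norm b" for x by (simp add: norm_vector_scaleC)
qed

lemma quadratic_path_derivative:
  "((\<lambda>t. a + t *s b + t\<^sup>2 *s c) has_derivative (\<lambda>h. h *s (b + (2 * t) *s (c :: complex^'n::finite)))) (at t)"
proof -
  have 1: "((\<lambda>t. t *s b) has_derivative (\<lambda>h. h *s b)) (at t)"
    by (rule bounded_linear_imp_has_derivative[OF scale_left_bounded_linear])
  have 2: "((\<lambda>t. t\<^sup>2) has_derivative (\<lambda>h. 2 * t * h)) (at t)"
    by (auto intro!: derivative_eq_intros simp: algebra_simps)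
  have 3: "((\<lambda>t. t\<^sup>2 *s c) has_derivative (\<lambda>h. (2 * t * h) *s c)) (at t)"
    by (rule bounded_linear.has_derivative[OF scale_left_bounded_linear 2])
  have "((\<lambda>t. a + t *s b + t\<^sup>2 *s c) has_derivative (\<lambda>h. 0 + h *s b + (2 * t * h) *s c)) (at t)"
    by (intro has_derivative_add has_derivative_const 1 3)
  moreover have "(\<lambda>h. 0 + h *s b + (2 * t * h) *s c) = (\<lambda>h. h *s (b + (2 * t) *s c))"
    by (auto simp: vec_eq_iff algebra_simps)
  ultimately show ?thesis by simp
qed

lemma quadratic_path_open:
  assumes "open (S :: (complex^'n::finite) set)"
  shows "open {t. a + t *s b + t\<^sup>2 *s c \<in> S}"
proof -
  have "isCont (\<lambda>t. a + t *s b + t\<^sup>2 *s c) t" for t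
    using quadratic_path_derivative has_derivative_continuous by blast
  then have "continuous_on UNIV (\<lambda>t. a + t *s b + t\<^sup>2 *s c)"
    by (simp add: continuous_at_imp_continuous_on)
  from open_vimage[OF assms this] show ?thesis by (simp add: vimage_def)
qed

text \<open>Paths of degree two cover both later uses: complex lines with \<open>c = 0\<close>, and
  the paths of \<open>null_path\<close>.\<close>

lemma component_holomorphic:
  fixes f :: "complex^'n::finite \<Rightarrow> complex^'m::finite"
  assumes der: "\<And>z. z \<in> V \<Longrightarrow> \<exists>L. Vector_Spaces.linear (*s) (*s) L \<and> (f has_derivative L) (at z)"
    and V: "\<And>t. t \<in> J \<Longrightarrow> a + t *s b + t\<^sup>2 *s c \<in> V"
  shows "(\<lambda>t. f (a + t *s b + t\<^sup>2 *s c) $ i) holomorphic_on J"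
proof (rule holomorphic_onI)
  fix t assume "t \<in> J"
  then obtain L where L: "Vector_Spaces.linear (*s) (*s) L" "(f has_derivative L) (at (a + t *s b + t\<^sup>2 *s c))"
    using der V by blast
  interpret L: Vector_Spaces.linear "(*s)" "(*s)" L by (rule L(1))
  have "((\<lambda>t. f (a + t *s b + t\<^sup>2 *s c)) has_derivative (\<lambda>h. L (h *s (b + (2 * t) *s c)))) (at t)"
    by (rule has_derivative_compose[OF quadratic_path_derivative L(2)])
  then have "((\<lambda>t. f (a + t *s b + t\<^sup>2 *s c) $ i) has_derivative (\<lambda>h. L (h *s (b + (2 * t) *s c)) $ i)) (at t)"
    by (rule bounded_linear.has_derivative[OF bounded_linear_vec_nth])
  moreover have "(\<lambda>h. L (h *s (b + (2 * t) *s c)) $ i) = (*) (L (b + (2 * t) *s c) $ i)"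
    unfolding L.scale by (rule ext) (simp only: vector_smult_component mult.commute)
  ultimately have "((\<lambda>t. f (a + t *s b + t\<^sup>2 *s c) $ i) has_field_derivative L (b + (2 * t) *s c) $ i) (at t)"
    unfolding has_field_derivative_def by simp
  then show "(\<lambda>t. f (a + t *s b + t\<^sup>2 *s c) $ i) field_differentiable at t within J"
    using field_differentiable_at_within field_differentiable_def by blast
qed

lemma ball_add: "x + d \<in> ball x e \<longleftrightarrow> norm (d :: 'a::real_normed_vector) < e"
  by (simp add: dist_norm)

text \<open>Combinations with weights close to \<open>1 / k\<close> stay close to the barycentre.
  What matters is uniformity: one \<epsilon> serves every tuple in the closed ball of radius
  \<open>r\<close> around \<open>p\<close>, so the same set of weights can be used along a whole
  path of tuples.\<close>

lemma barycentric_margin: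
  fixes p :: "complex^'n::finite"
  assumes r: "r < \<rho>" and k: "0 < (k::nat)"
  obtains \<epsilon> where "\<epsilon> > 0" "\<And>v (c :: nat \<Rightarrow> complex). (\<And>j. j < k \<Longrightarrow> norm (v j - p) \<le> r) \<Longrightarrow>
     (\<And>j. j < k \<Longrightarrow> norm (c j - 1 / of_nat k) < \<epsilon>) \<Longrightarrow> (\<Sum>j<k. c j *s v j) \<in> ball p \<rho>"
proof -
  define W where "W = \<bar>r\<bar> + norm p + 1"
  have W: "W > 0" unfolding W_def by (smt (verit) norm_ge_zero)
  \<comment> \<open>\<open>W\<close> bounds every \<open>norm (v j)\<close>, so changing
    \<open>k\<close> weights by less than this amount moves the combination by less than
    \<open>\<rho> - r\<close>.\<close>
  define \<epsilon> where "\<epsilon> = (\<rho> - r) / (real k * W)"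
  have e: "\<epsilon> > 0" unfolding \<epsilon>_def using r k W by simp
  show ?thesis
  proof (rule that[OF e])
    fix v :: "nat \<Rightarrow> complex^'n" and c :: "nat \<Rightarrow> complex"
    assume v: "\<And>j. j < k \<Longrightarrow> norm (v j - p) \<le> r" and c: "\<And>j. j < k \<Longrightarrow> norm (c j - 1 / of_nat k) < \<epsilon>"
    have nv: "norm (v j) \<le> W" if "j < k" for j
      using v[OF that] norm_triangle_ineq2[of "v j" p] unfolding W_def by linarith
    have "p = (\<Sum>j<k. (1 / of_nat k) *s p)"
      unfolding vec.scale_sum_left[symmetric] using k by simp
    then have "(\<Sum>j<k. c j *s v j) - p = (\<Sum>j<k. c j *s v j) - (\<Sum>j<k. (1 / of_nat k) *s p)" by simp
    also have "\<dots> = (\<Sum>j<k. (c j - 1 / of_nat k) *s v j) + (\<Sum>j<k. (1 / of_nat k) *s (v j - p))"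
      by (simp add: vec_eq_iff algebra_simps sum_subtractf sum.distrib)
    finally have eq: "(\<Sum>j<k. c j *s v j) - p = \<dots>" .
    have "norm (\<Sum>j<k. (1 / of_nat k :: complex) *s (v j - p)) \<le> (\<Sum>j<k. (1 / real k) * r)"
      by (rule norm_combination_bound) (use v in \<open>auto simp: norm_divide\<close>)
    also have "\<dots> = r" using k by simp
    finally have 1: "norm (\<Sum>j<k. (1 / of_nat k :: complex) *s (v j - p)) \<le> r" .
    have "norm (\<Sum>j<k. (c j - 1 / of_nat k) *s v j) \<le> (\<Sum>j<k. norm ((c j - 1 / of_nat k) *s v j))"
      by (rule norm_sum)
    also have "\<dots> < (\<Sum>j<k. \<epsilon> * W)"
    proof (rule sum_strict_mono)
      fix j assume "j \<in> {..<k}"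
      then have j: "j < k" by simp
      have "norm ((c j - 1 / of_nat k) *s v j) \<le> norm (c j - 1 / of_nat k) * W"
        unfolding norm_vector_scaleC using nv[OF j] by (rule mult_left_mono) simp
      also have "\<dots> < \<epsilon> * W" using c[OF j] W by (rule mult_strict_right_mono)
      finally show "norm ((c j - 1 / of_nat k) *s v j) < \<epsilon> * W" .
    qed (use k in auto)
    also have "\<dots> = \<rho> - r" unfolding \<epsilon>_def using k W by simp
    finally have "norm ((\<Sum>j<k. c j *s v j) - p) < \<rho>"
      unfolding eq using 1 norm_triangle_ineq[of "\<Sum>j<k. (c j - 1 / of_nat k) *s v j" "\<Sum>j<k. (1 / of_nat k) *s (v j - p)"]
      by linarith
    then show "(\<Sum>j<k. c j *s v j) \<in> ball p \<rho>" by (simp add: dist_norm norm_minus_commute)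
  qed
qed

section \<open>Rank of the image of a subspace under a holomorphic germ\<close>

text \<open>The domain is a ball because its preimage under a complex line is open and convex, see
  \<open>line_preimage\<close>, so that continuation in one variable applies along every
  line.\<close>

locale holomorphic_germ =
  fixes f :: "complex^'n::finite \<Rightarrow> complex^'m::finite" and p :: "complex^'n" and \<rho> :: real
  assumes rho: "\<rho> > 0"
    and derivative: "\<And>z. z \<in> ball p \<rho> \<Longrightarrow> \<exists>L. Vector_Spaces.linear (*s) (*s) L \<and> (f has_derivative L) (at z)"
begin

abbreviation V where "V \<equiv> ball p \<rho>"

definition image_dim :: "(complex^'n) set \<Rightarrow> nat" where
  "image_dim S = vec.dim (f ` (S \<inter> V))"

lemma isCont: "z \<in> V \<Longrightarrow> isCont f z"
  using derivative has_derivative_continuous by blast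

lemma line_preimage:
  "open {t. x + t *s d \<in> ball q r}" "convex {t. x + t *s d \<in> ball (q :: complex^'n) r}"
proof -
  show "open {t. x + t *s d \<in> ball q r}"
    using quadratic_path_open[OF open_ball, of x d 0 q r] by simp
  have "x + (u *\<^sub>R s + v *\<^sub>R t) *s d = u *\<^sub>R (x + s *s d) + v *\<^sub>R (x + t *s d)" if "u + v = 1" for u v s t
  proof -
    have "u *\<^sub>R x + v *\<^sub>R x = x" using that by (simp flip: scaleR_left_distrib)
    then have "u *\<^sub>R (x + s *s d) + v *\<^sub>R (x + t *s d) = x + (u *\<^sub>R (s *s d) + v *\<^sub>R (t *s d))"
      by (simp add: scaleR_right_distrib add_ac)
    also have "u *\<^sub>R (s *s d) + v *\<^sub>R (t *s d) = (u *\<^sub>R s + v *\<^sub>R t) *s d"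
      by (simp add: vec_eq_iff algebra_simps)
    finally show ?thesis by simp
  qed
  then show "convex {t. x + t *s d \<in> ball q r}"
    unfolding convex_def using convex_ball[of q r] by (auto simp: convex_def simp del: mem_ball)
qed

lemma line_holomorphic: "(\<And>t. t \<in> J \<Longrightarrow> x + t *s d \<in> V) \<Longrightarrow> (\<lambda>t. f (x + t *s d) $ i) holomorphic_on J"
  using component_holomorphic[of V f J x d 0 i, OF derivative] by simp

text \<open>Continuation in the contraction factor from 1 towards 0: at factor 1 the values are
  those on \<open>C\<close>, and 0 is a limit point of the admissible factors of norm below \<eta>,
  so the rank survives for one of them. Finiteness of \<open>C\<close> keeps the set of admissible
  factors open.\<close>

lemma contraction_rank:
  assumes C: "finite C" "C \<subseteq> V" and x0: "x0 \<in> V" and eta: "\<eta> > 0"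
  obtains s where "norm s < \<eta>" "\<And>x. x \<in> C \<Longrightarrow> x0 + s *s (x - x0) \<in> V"
    "vec.dim (f ` C) \<le> vec.dim ((\<lambda>x. f (x0 + s *s (x - x0))) ` C)"
proof -
  define J where "J = (\<Inter>x\<in>C. {t. x0 + t *s (x - x0) \<in> V})"
  have oJ: "open J" unfolding J_def by (rule open_INT[OF C(1)], rule ballI, rule line_preimage(1))
  have cJ: "connected J" unfolding J_def by (rule convex_connected, rule convex_INT, rule line_preimage(2))
  have 01: "0 \<in> J" "1 \<in> J" unfolding J_def using C x0 by auto
  have lim: "0 islimpt (J \<inter> ball 0 \<eta>)"
    using oJ 01 eta by (intro interior_limit_point) (simp add: interior_open open_Int)
  have hol: "(\<lambda>t. f (x0 + t *s (x - x0)) $ i) holomorphic_on J" if "x \<in> C" for x i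
    by (rule line_holomorphic) (use that in \<open>unfold J_def, blast\<close>)
  have "\<exists>t\<in>J \<inter> ball 0 \<eta>. vec.dim (f ` C) \<le> vec.dim ((\<lambda>x. f (x0 + t *s (x - x0))) ` C)"
    by (rule rank_continuation[where g = "\<lambda>x t. f (x0 + t *s (x - x0))", OF oJ cJ hol 01(2) _ 01(1) lim]) auto
  then obtain s where s: "s \<in> J" "norm s < \<eta>" "vec.dim (f ` C) \<le> vec.dim ((\<lambda>x. f (x0 + s *s (x - x0))) ` C)"
    by auto
  then show ?thesis using that[of s] by (auto simp: J_def simp del: mem_ball)
qed

lemma finite_witness:
  obtains C where "finite C" "C \<subseteq> S \<inter> V" "vec.dim (f ` C) = image_dim S"
proof -
  obtain B where B: "B \<subseteq> f ` (S \<inter> V)" "vec.independent B" "card B = vec.dim (f ` (S \<inter> V))"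
    by (rule vec.basis_exists[of "f ` (S \<inter> V)"], rule that)
  have "finite B" using B(2) by (simp add: vec.finiteI_independent)
  then obtain C where C: "C \<subseteq> S \<inter> V" "finite C" "B = f ` C"
    using finite_subset_image[OF _ B(1)] by blast
  have "vec.dim B = card B" using B(2) by (rule vec.dim_eq_card_independent)
  then show ?thesis using that[of C] C B(3) by (simp add: image_dim_def)
qed

text \<open>A finite set that realises the rank is contracted towards \<open>x0\<close> inside
  \<open>S\<close>, so the full rank already shows in every neighbourhood of
  \<open>x0\<close>.\<close>

lemma image_dim_local:
  assumes S: "vec.subspace S" and x0: "x0 \<in> S" "x0 \<in> V" and eps: "\<epsilon> > 0"
  shows "image_dim S \<le> vec.dim (f ` (S \<inter> V \<inter> ball x0 \<epsilon>))"
proof -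
  obtain C where C: "finite C" "C \<subseteq> S \<inter> V" "vec.dim (f ` C) = image_dim S"
    by (rule finite_witness)
  define M where "M = (\<Sum>x\<in>C. norm (x - x0)) + 1"
  have M: "M > 0" unfolding M_def by (simp add: add_nonneg_pos sum_nonneg)
  have Mx: "norm (x - x0) \<le> M" if "x \<in> C" for x
    using member_le_sum[OF that, of "\<lambda>x. norm (x - x0)"] C(1) unfolding M_def by auto
  obtain s where s: "norm s < \<epsilon> / M" "\<And>x. x \<in> C \<Longrightarrow> x0 + s *s (x - x0) \<in> V"
    "vec.dim (f ` C) \<le> vec.dim ((\<lambda>x. f (x0 + s *s (x - x0))) ` C)"
    by (rule contraction_rank[OF C(1) _ x0(2), of "\<epsilon> / M"]) (use C M eps in auto)
  have "x0 + s *s (x - x0) \<in> S \<inter> V \<inter> ball x0 \<epsilon>" if x: "x \<in> C" for x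
  proof -
    have "x0 + s *s (x - x0) \<in> S"
      using x C x0 S by (intro vec.subspace_add vec.subspace_scale vec.subspace_diff) auto
    moreover have "norm (s *s (x - x0)) < \<epsilon>"
    proof -
      have "norm (s *s (x - x0)) \<le> norm s * M" unfolding norm_vector_scaleC
        using Mx[OF x] by (rule mult_left_mono) simp
      also have "\<dots> < \<epsilon> / M * M" using s(1) M by (rule mult_strict_right_mono)
      finally show ?thesis using M by simp
    qed
    ultimately show ?thesis using s(2)[OF x] by (simp only: ball_add Int_iff)
  qed
  then have "vec.dim ((\<lambda>x. f (x0 + s *s (x - x0))) ` C) \<le> vec.dim (f ` (S \<inter> V \<inter> ball x0 \<epsilon>))"
    by (intro vec.dim_subset) auto
  then show ?thesis using s(3) C(3) by simp
qed

text \<open>The rank witnesses are contracted towards the barycentre of the tuple, which drives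
  their coefficients to \<open>1 / k\<close>. Thus the rank on the span is detected by a set of
  coefficients that does not depend on the tuple.\<close>

lemma barycentric_rank:
  fixes k :: nat
  assumes k: "0 < k" and v: "\<And>j. j < k \<Longrightarrow> v j \<in> V" and eps: "\<epsilon> > 0"
  shows "image_dim (vec.span (v ` {..<k})) \<le>
    vec.dim ((\<lambda>c. f (\<Sum>j<k. c j *s v j)) ` {c. \<forall>j<k. norm (c j - 1 / of_nat k) < \<epsilon>})"
proof -
  obtain C where C: "finite C" "C \<subseteq> vec.span (v ` {..<k}) \<inter> V"
    "vec.dim (f ` C) = image_dim (vec.span (v ` {..<k}))"
    by (rule finite_witness)
  have "\<forall>x\<in>C. \<exists>c. x = (\<Sum>j<k. c j *s v j)" using C(2) span_tuple by blast
  then obtain c where c: "\<And>x. x \<in> C \<Longrightarrow> x = (\<Sum>j<k. c x j *s v j)" by metis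
  define b where "b = (\<Sum>j<k. (1 / of_nat k :: complex) *s v j)"
  have "b = (\<Sum>j<k. (1 / real k) *\<^sub>R v j)"
    unfolding b_def
  proof (rule sum.cong)
    show "(1 / of_nat k :: complex) *s v j = (1 / real k) *\<^sub>R v j" for j
      unfolding vec_eq_iff by simp (simp add: scaleR_conv_of_real)
  qed simp
  also have "\<dots> \<in> V" by (rule convex_sum) (use k v in \<open>auto simp: simp del: mem_ball\<close>)
  finally have bV: "b \<in> V" .
  define M where "M = (\<Sum>x\<in>C. \<Sum>j<k. norm (c x j - 1 / of_nat k)) + 1"
  have M: "M > 0" unfolding M_def by (simp add: add_nonneg_pos sum_nonneg)
  have Mx: "norm (c x j - 1 / of_nat k) \<le> M" if "x \<in> C" "j < k" for x j
  proof -
    have "norm (c x j - 1 / of_nat k) \<le> (\<Sum>j<k. norm (c x j - 1 / of_nat k))"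
      by (rule member_le_sum) (use that in auto)
    also have "\<dots> \<le> (\<Sum>x\<in>C. \<Sum>j<k. norm (c x j - 1 / of_nat k))"
      by (rule member_le_sum) (use that C(1) in \<open>auto intro: sum_nonneg\<close>)
    finally show ?thesis unfolding M_def by simp
  qed
  obtain s where s: "norm s < \<epsilon> / M"
    "vec.dim (f ` C) \<le> vec.dim ((\<lambda>x. f (b + s *s (x - b))) ` C)"
    by (rule contraction_rank[OF C(1) _ bV, of "\<epsilon> / M"]) (use C M eps in auto)
  define e where "e x j = 1 / of_nat k + s * (c x j - 1 / of_nat k)" for x j
  have eq: "b + s *s (x - b) = (\<Sum>j<k. e x j *s v j)" if "x \<in> C" for x
  proof -
    have "x - b = (\<Sum>j<k. (c x j - 1 / of_nat k) *s v j)"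
      unfolding b_def vec.scale_left_diff_distrib sum_subtractf using c[OF that] by simp
    then show ?thesis
      unfolding e_def b_def vec.scale_left_distrib sum.distrib vec.scale_scale[symmetric] vec.scale_sum_right[symmetric]
      by simp
  qed
  have ne: "norm (e x j - 1 / of_nat k) < \<epsilon>" if "x \<in> C" "j < k" for x j
  proof -
    have "norm (e x j - 1 / of_nat k) = norm s * norm (c x j - 1 / of_nat k)"
      unfolding e_def by (simp add: norm_mult)
    also have "\<dots> \<le> norm s * M" using Mx[OF that] by (rule mult_left_mono) simp
    also have "\<dots> < \<epsilon> / M * M" using s(1) M by (rule mult_strict_right_mono)
    finally show ?thesis using M by simp
  qed
  have "(\<lambda>x. f (b + s *s (x - b))) ` C \<subseteq>
      (\<lambda>c. f (\<Sum>j<k. c j *s v j)) ` {c. \<forall>j<k. norm (c j - 1 / of_nat k) < \<epsilon>}"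
  proof
    fix y assume "y \<in> (\<lambda>x. f (b + s *s (x - b))) ` C"
    then obtain x where x: "x \<in> C" "y = f (b + s *s (x - b))" by blast
    then have "y = f (\<Sum>j<k. e x j *s v j)" using eq by simp
    then show "y \<in> (\<lambda>c. f (\<Sum>j<k. c j *s v j)) ` {c. \<forall>j<k. norm (c j - 1 / of_nat k) < \<epsilon>}"
      using ne x(1) by blast
  qed
  then have "vec.dim ((\<lambda>x. f (b + s *s (x - b))) ` C) \<le>
      vec.dim ((\<lambda>c. f (\<Sum>j<k. c j *s v j)) ` {c. \<forall>j<k. norm (c j - 1 / of_nat k) < \<epsilon>})"
    by (rule vec.dim_subset)
  then show ?thesis using s(2) C(3) by simp
qed

lemma compact_radius:
  assumes "\<And>j. j < (k::nat) \<Longrightarrow> v j \<in> V"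
  obtains r where "r < \<rho>" "\<And>j. j < k \<Longrightarrow> norm (v j - p) \<le> r"
proof (cases "k = 0")
  case True
  then show ?thesis using that[of 0] rho by simp
next
  case False
  define r where "r = Max ((\<lambda>j. norm (v j - p)) ` {..<k})"
  have "r \<in> (\<lambda>j. norm (v j - p)) ` {..<k}" unfolding r_def using False by (intro Max_in) auto
  then have "r < \<rho>" using assms by (auto simp: dist_norm norm_minus_commute)
  then show ?thesis using that[of r] by (auto simp: r_def)
qed

text \<open>With the weights in \<open>A\<close> fixed once for all, each of them gives a
  holomorphic function of \<open>t\<close> along the path of tuples, so
  \<open>rank_continuation\<close> carries a lower rank bound from \<open>t1\<close> into
  \<open>X\<close>. The bound \<open>r < \<rho>\<close> keeps these combinations in the ball for
  every \<open>t\<close> in \<open>J\<close>.\<close>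

lemma barycentric_rank_continuation:
  fixes k :: nat and a b c w :: "nat \<Rightarrow> complex^'n"
  assumes k: "0 < k" and J: "open J" "connected J"
    and inV: "\<And>j t. j < k \<Longrightarrow> t \<in> J \<Longrightarrow> norm (a j + t *s b j + t\<^sup>2 *s c j - p) \<le> r" and r: "r < \<rho>"
    and t1: "t1 \<in> J" and w: "\<And>j. j < k \<Longrightarrow> w j = a j + t1 *s b j + t1\<^sup>2 *s c j"
    and xi: "\<xi> \<in> J" "\<xi> islimpt X" "X \<subseteq> J"
  shows "\<exists>t\<in>X. image_dim (vec.span (w ` {..<k})) \<le>
    image_dim (vec.span ((\<lambda>j. a j + t *s b j + t\<^sup>2 *s c j) ` {..<k}))"
proof -
  obtain \<epsilon> where eps: "\<epsilon> > 0" and mar: "\<And>v (c :: nat \<Rightarrow> complex). (\<And>j. j < k \<Longrightarrow> norm (v j - p) \<le> r) \<Longrightarrow>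
     (\<And>j. j < k \<Longrightarrow> norm (c j - 1 / of_nat k) < \<epsilon>) \<Longrightarrow> (\<Sum>j<k. c j *s v j) \<in> V"
    using barycentric_margin[OF r k] by blast
  define A :: "(nat \<Rightarrow> complex) set" where "A = {e. \<forall>j<k. norm (e j - 1 / of_nat k) < \<epsilon>}"
  define g where "g e t = f (\<Sum>j<k. e j *s (a j + t *s b j + t\<^sup>2 *s c j))" for e t
  have comb: "(\<Sum>j<k. e j *s (a j + t *s b j + t\<^sup>2 *s c j)) =
      (\<Sum>j<k. e j *s a j) + t *s (\<Sum>j<k. e j *s b j) + t\<^sup>2 *s (\<Sum>j<k. e j *s c j)" for e t
    unfolding vec.scale_right_distrib sum.distrib vec.scale_sum_right vec.scale_scale by (simp add: mult.commute)
  have inA: "(\<Sum>j<k. e j *s (a j + t *s b j + t\<^sup>2 *s c j)) \<in> V" if "e \<in> A" "t \<in> J" for e t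
    by (rule mar) (use inV that in \<open>auto simp: A_def\<close>)
  have hol: "(\<lambda>t. g e t $ i) holomorphic_on J" if "e \<in> A" for e i
    unfolding g_def comb
    by (rule component_holomorphic[OF derivative]) (use inA[OF that, unfolded comb] in blast)+
  have wV: "w j \<in> V" if "j < k" for j
    using inV[OF that t1] r w[OF that] by (simp add: dist_norm norm_minus_commute)
  have st: "image_dim (vec.span (w ` {..<k})) \<le> vec.dim ((\<lambda>e. g e t1) ` A)"
  proof -
    have "(\<lambda>e. g e t1) ` A = (\<lambda>e. f (\<Sum>j<k. e j *s w j)) ` A"
      unfolding g_def using w by (intro image_cong refl arg_cong[of _ _ f] sum.cong) auto
    then show ?thesis using barycentric_rank[of k w \<epsilon>, OF k wV eps] by (simp add: A_def)
  qed
  obtain t where t: "t \<in> X" "image_dim (vec.span (w ` {..<k})) \<le> vec.dim ((\<lambda>e. g e t) ` A)"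
    using rank_continuation[OF J hol t1 st xi] by blast
  have "(\<lambda>e. g e t) ` A \<subseteq> f ` (vec.span ((\<lambda>j. a j + t *s b j + t\<^sup>2 *s c j) ` {..<k}) \<inter> V)"
    unfolding g_def using inA t(1) xi(3) tuple_span by blast
  then have "vec.dim ((\<lambda>e. g e t) ` A) \<le> image_dim (vec.span ((\<lambda>j. a j + t *s b j + t\<^sup>2 *s c j) ` {..<k}))"
    unfolding image_dim_def by (rule vec.dim_subset)
  then show ?thesis using t by (meson order_trans)
qed

text \<open>A rank attained by some tuple \<open>w\<close> is attained arbitrarily close to any
  \<open>v\<close>: continue along the complex line joining \<open>v\<close> to \<open>w\<close> and
  let the parameter approach 0.\<close>

lemma image_dim_dense:
  fixes k :: nat
  assumes k: "0 < k" and v: "\<And>j. j < k \<Longrightarrow> v j \<in> V" and w: "\<And>j. j < k \<Longrightarrow> w j \<in> V" and eta: "\<eta> > 0"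
  obtains v' where "\<And>j. j < k \<Longrightarrow> v' j \<in> V" "\<And>j. j < k \<Longrightarrow> norm (v' j - v j) < \<eta>"
    "image_dim (vec.span (w ` {..<k})) \<le> image_dim (vec.span (v' ` {..<k}))"
proof -
  obtain r1 where r1: "r1 < \<rho>" "\<And>j. j < k \<Longrightarrow> norm (v j - p) \<le> r1" using compact_radius[of k v, OF v] by blast
  obtain r2 where r2: "r2 < \<rho>" "\<And>j. j < k \<Longrightarrow> norm (w j - p) \<le> r2" using compact_radius[of k w, OF w] by blast
  \<comment> \<open>Strictly between the radius of both tuples and \<rho>: the parameters with all
    points in the open ball of radius \<open>r\<close> form an open set, while a margin below \<rho>
    is kept.\<close>
  define r where "r = (max r1 r2 + \<rho>) / 2"
  have r: "r < \<rho>" "r1 < r" "r2 < r" unfolding r_def using r1(1) r2(1) by auto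
  define J where "J = (\<Inter>j\<in>{..<k}. {t. v j + t *s (w j - v j) \<in> ball p r})"
  have oJ: "open J" unfolding J_def by (rule open_INT[OF finite_lessThan], rule ballI, rule line_preimage(1))
  have cJ: "connected J" unfolding J_def by (rule convex_connected, rule convex_INT, rule line_preimage(2))
  have 01: "0 \<in> J" "1 \<in> J" unfolding J_def using r r1(2) r2(2)
    by (auto simp: dist_norm norm_minus_commute intro: le_less_trans)
  define M where "M = (\<Sum>j<k. norm (w j - v j)) + 1"
  have M: "M > 0" unfolding M_def by (simp add: add_nonneg_pos sum_nonneg)
  have Mx: "norm (w j - v j) \<le> M" if "j < k" for j
    using member_le_sum[of j "{..<k}" "\<lambda>j. norm (w j - v j)"] that unfolding M_def by auto
  have lim: "0 islimpt (J \<inter> ball 0 (\<eta> / M))"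
    using oJ 01 eta M by (intro interior_limit_point) (simp add: interior_open open_Int)
  have bd: "norm (v j + t *s (w j - v j) + t\<^sup>2 *s 0 - p) \<le> r" if "j < k" "t \<in> J" for j t
    using that unfolding J_def by (auto simp: dist_norm norm_minus_commute intro: less_imp_le)
  obtain t where t: "t \<in> J" "norm t < \<eta> / M" "image_dim (vec.span (w ` {..<k})) \<le>
    image_dim (vec.span ((\<lambda>j. v j + t *s (w j - v j) + t\<^sup>2 *s 0) ` {..<k}))"
    using barycentric_rank_continuation[where a = v and b = "\<lambda>j. w j - v j" and c = "\<lambda>_. 0" and w = w,
        OF k oJ cJ bd r(1) 01(2) _ 01(1) lim] by auto
  show ?thesis
  proof (rule that[of "\<lambda>j. v j + t *s (w j - v j)"])
    fix j assume j: "j < k"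
    show "v j + t *s (w j - v j) \<in> V" using bd[OF j t(1)] r by (simp add: dist_norm norm_minus_commute)
    have "norm (t *s (w j - v j)) \<le> norm t * M" unfolding norm_vector_scaleC
      using Mx[OF j] by (rule mult_left_mono) simp
    also have "\<dots> < \<eta> / M * M" using t(2) M by (rule mult_strict_right_mono)
    finally show "norm (v j + t *s (w j - v j) - v j) < \<eta>" using M by simp
  qed (use t(3) in simp)
qed

text \<open>Rank witnesses in the image are values of \<open>f\<close> at fixed combinations of the
  \<open>v j\<close>. The same combinations of a nearby tuple have nearby values by continuity, and
  \<open>rank_open\<close> concludes.\<close>

lemma image_dim_semicontinuous:
  fixes k :: nat
  assumes v: "\<And>j. j < k \<Longrightarrow> v j \<in> V"
  obtains \<eta> where "\<eta> > 0" "\<And>v'. (\<And>j. j < k \<Longrightarrow> norm (v' j - v j) < \<eta>) \<Longrightarrow>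
    image_dim (vec.span (v ` {..<k})) \<le> image_dim (vec.span (v' ` {..<k}))"
proof -
  obtain I :: "'m set" and y \<eta>0 where I: "\<eta>0 > 0" "\<forall>i\<in>I. y i \<in> f ` (vec.span (v ` {..<k}) \<inter> V)"
    "\<forall>y' Y'. (\<forall>i\<in>I. norm (y' i - y i) < \<eta>0) \<longrightarrow> y' ` I \<subseteq> Y' \<longrightarrow>
       vec.dim (f ` (vec.span (v ` {..<k}) \<inter> V)) \<le> vec.dim (Y' :: (complex^'m) set)"
    using rank_open[of "f ` (vec.span (v ` {..<k}) \<inter> V)"] by (elim exE conjE)
  have "\<forall>i. \<exists>c. i \<in> I \<longrightarrow> y i = f (\<Sum>j<k. c j *s v j) \<and> (\<Sum>j<k. c j *s v j) \<in> V"
  proof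
    fix i
    show "\<exists>c. i \<in> I \<longrightarrow> y i = f (\<Sum>j<k. c j *s v j) \<and> (\<Sum>j<k. c j *s v j) \<in> V"
    proof (cases "i \<in> I")
      case True
      then obtain x where x: "x \<in> vec.span (v ` {..<k})" "x \<in> V" "y i = f x" using I(2) by blast
      from span_tuple[OF x(1)] show ?thesis using x by blast
    qed simp
  qed
  then obtain c where c: "\<And>i. i \<in> I \<Longrightarrow> y i = f (\<Sum>j<k. c i j *s v j)"
    "\<And>i. i \<in> I \<Longrightarrow> (\<Sum>j<k. c i j *s v j) \<in> V" by metis
  have "\<exists>\<kappa>>0. \<forall>x. norm (x - (\<Sum>j<k. c i j *s v j)) < \<kappa> \<longrightarrow> x \<in> V \<and> norm (f x - y i) < \<eta>0" if i: "i \<in> I" for i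
  proof -
    let ?x = "\<Sum>j<k. c i j *s v j"
    obtain d1 where d1: "d1 > 0" "ball ?x d1 \<subseteq> V" using c(2)[OF i] open_ball open_contains_ball by blast
    obtain d2 where d2: "d2 > 0" "\<And>x. dist x ?x < d2 \<Longrightarrow> dist (f x) (f ?x) < \<eta>0"
      using isCont[OF c(2)[OF i]] I(1) unfolding continuous_at_eps_delta by blast
    show ?thesis
      using d1 d2 c(1)[OF i] by (intro exI[of _ "min d1 d2"]) (auto simp: dist_norm norm_minus_commute subset_eq)
  qed
  then obtain \<kappa> where kap: "\<And>i. i \<in> I \<Longrightarrow> \<kappa> i > 0"
    "\<And>i x. i \<in> I \<Longrightarrow> norm (x - (\<Sum>j<k. c i j *s v j)) < \<kappa> i \<Longrightarrow> x \<in> V \<and> norm (f x - y i) < \<eta>0"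
    by metis
  define \<kappa>0 where "\<kappa>0 = Min (insert 1 (\<kappa> ` I))"
  have k0: "\<kappa>0 > 0" "\<And>i. i \<in> I \<Longrightarrow> \<kappa>0 \<le> \<kappa> i" unfolding \<kappa>0_def using kap(1) by auto
  define M where "M = (\<Sum>i\<in>I. \<Sum>j<k. norm (c i j)) + 1"
  have M: "M > 0" unfolding M_def by (simp add: add_nonneg_pos sum_nonneg)
  have Mi: "(\<Sum>j<k. norm (c i j)) < M" if "i \<in> I" for i
    using member_le_sum[OF that, of "\<lambda>i. \<Sum>j<k. norm (c i j)"] unfolding M_def by (auto simp: sum_nonneg)
  show ?thesis
  proof (rule that[of "\<kappa>0 / M"])
    show "\<kappa>0 / M > 0" using k0 M by simp
    fix v' assume near: "\<And>j. j < k \<Longrightarrow> norm (v' j - v j) < \<kappa>0 / M"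
    have close: "norm ((\<Sum>j<k. c i j *s v' j) - (\<Sum>j<k. c i j *s v j)) < \<kappa> i" if i: "i \<in> I" for i
    proof -
      have "norm ((\<Sum>j<k. c i j *s v' j) - (\<Sum>j<k. c i j *s v j)) = norm (\<Sum>j<k. c i j *s (v' j - v j))"
        unfolding vec.scale_right_diff_distrib sum_subtractf ..
      also have "\<dots> \<le> (\<Sum>j<k. norm (c i j) * (\<kappa>0 / M))"
        by (rule norm_combination_bound) (use near in \<open>auto intro: less_imp_le\<close>)
      also have "\<dots> = (\<Sum>j<k. norm (c i j)) * (\<kappa>0 / M)" by (simp only: sum_distrib_right)
      also have "\<dots> < M * (\<kappa>0 / M)" using Mi[OF i] k0 M by (intro mult_strict_right_mono) auto
      also have "\<dots> = \<kappa>0" using M by simp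
      finally show ?thesis using k0(2)[OF i] by linarith
    qed
    show "image_dim (vec.span (v ` {..<k})) \<le> image_dim (vec.span (v' ` {..<k}))"
      unfolding image_dim_def
    proof (rule I(3)[rule_format, of "\<lambda>i. f (\<Sum>j<k. c i j *s v' j)"])
      show "norm (f (\<Sum>j<k. c i j *s v' j) - y i) < \<eta>0" if "i \<in> I" for i
        using kap(2)[OF that close[OF that]] by blast
      show "(\<lambda>i. f (\<Sum>j<k. c i j *s v' j)) ` I \<subseteq> f ` (vec.span (v' ` {..<k}) \<inter> V)"
        using kap(2)[OF _ close] tuple_span by blast
    qed
  qed
qed

section \<open>Generic rank on tuples\<close>

text \<open>The maximum runs over tuples, possibly dependent, which avoids a topology on the set of
  subspaces. For positive \<open>k\<close> it is attained on a dense open set of tuples, by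
  \<open>generic_dense\<close> and \<open>generic_open\<close>.\<close>

definition generic_dim :: "nat \<Rightarrow> nat" where
  "generic_dim k = Max {image_dim (vec.span (v ` {..<k})) |v. \<forall>j<k. v j \<in> V}"

lemma image_dim_bound: "image_dim S \<le> CARD('m)"
  unfolding image_dim_def using vec.dim_subset_UNIV[of "f ` (S \<inter> V)"]
  by (simp add: vec.dimension_def card_cart_basis)

lemma generic_dim_finite: "finite {image_dim (vec.span (v ` {..<k})) |v. \<forall>j<k. v j \<in> V}"
  by (rule finite_subset[of _ "{..CARD('m)}"]) (use image_dim_bound in auto)

lemma generic_dim_ge:
  fixes k :: nat
  assumes "\<And>j. j < k \<Longrightarrow> v j \<in> V"
  shows "image_dim (vec.span (v ` {..<k})) \<le> generic_dim k"
  unfolding generic_dim_def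
  by (rule Max_ge[OF generic_dim_finite], rule CollectI, rule exI[of _ v]) (use assms in \<open>simp del: mem_ball\<close>)

lemma generic_dim_attained:
  fixes k :: nat
  obtains v where "\<And>j. j < k \<Longrightarrow> v j \<in> V" "image_dim (vec.span (v ` {..<k})) = generic_dim k"
proof -
  let ?A = "{image_dim (vec.span (v ` {..<k})) |v. \<forall>j<k. v j \<in> V}"
  have "p \<in> V" using rho by simp
  then have "image_dim (vec.span ((\<lambda>_. p) ` {..<k})) \<in> ?A"
    by (intro CollectI exI[of _ "\<lambda>_. p"]) (simp del: mem_ball)
  then have "?A \<noteq> {}" by (metis empty_iff)
  then have "generic_dim k \<in> ?A"
    unfolding generic_dim_def by (rule Max_in[OF generic_dim_finite])
  then obtain v where "generic_dim k = image_dim (vec.span (v ` {..<k}))" "\<forall>j<k. v j \<in> V"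
    by (elim CollectE exE conjE)
  then show ?thesis using that[of v] by simp
qed

lemma generic_dense:
  fixes k :: nat
  assumes k: "0 < k" and v: "\<And>j. j < k \<Longrightarrow> v j \<in> V" and eta: "\<eta> > 0"
  obtains v' where "\<And>j. j < k \<Longrightarrow> v' j \<in> V" "\<And>j. j < k \<Longrightarrow> norm (v' j - v j) < \<eta>"
    "image_dim (vec.span (v' ` {..<k})) = generic_dim k"
proof -
  obtain w where w: "\<And>j. j < k \<Longrightarrow> w j \<in> V" "image_dim (vec.span (w ` {..<k})) = generic_dim k"
    using generic_dim_attained[of k] by blast
  obtain v' where v': "\<And>j. j < k \<Longrightarrow> v' j \<in> V" "\<And>j. j < k \<Longrightarrow> norm (v' j - v j) < \<eta>"
    "image_dim (vec.span (w ` {..<k})) \<le> image_dim (vec.span (v' ` {..<k}))"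
    using image_dim_dense[of k v w \<eta>, OF k v w(1) eta] by blast
  have "image_dim (vec.span (v' ` {..<k})) = generic_dim k"
    using v'(3) w(2) generic_dim_ge[of k v', OF v'(1)] by linarith
  then show ?thesis using that[of v'] v'(1,2) by blast
qed

lemma generic_open:
  fixes k :: nat
  assumes v: "\<And>j. j < k \<Longrightarrow> v j \<in> V" and g: "image_dim (vec.span (v ` {..<k})) = generic_dim k"
  obtains \<eta> where "\<eta> > 0" "\<And>v' j. (\<And>j. j < k \<Longrightarrow> norm (v' j - v j) < \<eta>) \<Longrightarrow> j < k \<Longrightarrow> v' j \<in> V"
    "\<And>v'. (\<And>j. j < k \<Longrightarrow> norm (v' j - v j) < \<eta>) \<Longrightarrow> image_dim (vec.span (v' ` {..<k})) = generic_dim k"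
proof -
  obtain \<eta> where eta: "\<eta> > 0" "\<And>v'. (\<And>j. j < k \<Longrightarrow> norm (v' j - v j) < \<eta>) \<Longrightarrow>
    image_dim (vec.span (v ` {..<k})) \<le> image_dim (vec.span (v' ` {..<k}))"
    using image_dim_semicontinuous[of k v, OF v] by blast
  obtain r where r: "r < \<rho>" "\<And>j. j < k \<Longrightarrow> norm (v j - p) \<le> r" using compact_radius[of k v, OF v] by blast
  define \<eta>' where "\<eta>' = min \<eta> (\<rho> - r)"
  have inV: "v' j \<in> V" if "\<And>j. j < k \<Longrightarrow> norm (v' j - v j) < \<eta>'" "j < k" for v' j
  proof -
    have "norm (v' j - p) \<le> norm (v' j - v j) + norm (v j - p)"
      using norm_triangle_ineq[of "v' j - v j" "v j - p"] by simp
    also have "\<dots> < (\<rho> - r) + r" using that(1)[OF that(2)] r(2)[OF that(2)] unfolding \<eta>'_def by linarith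
    finally show ?thesis by (simp add: dist_norm norm_minus_commute)
  qed
  show ?thesis
  proof (rule that[of \<eta>'])
    show "\<eta>' > 0" unfolding \<eta>'_def using eta r by simp
    fix v' assume n: "\<And>j. j < k \<Longrightarrow> norm (v' j - v j) < \<eta>'"
    have "image_dim (vec.span (v ` {..<k})) \<le> image_dim (vec.span (v' ` {..<k}))"
      by (rule eta(2)) (use n in \<open>auto simp: \<eta>'_def\<close>)
    then show "image_dim (vec.span (v' ` {..<k})) = generic_dim k"
      using g generic_dim_ge[of k v', OF inV[OF n]] by linarith
  qed (rule inV)
qed

end

section \<open>Orthogonal germs map lines to lines\<close>

lemma herm_span_zero:
  assumes "\<And>x y. x \<in> X \<Longrightarrow> y \<in> Y \<Longrightarrow> herm \<sigma> x y = 0" and x: "x \<in> vec.span X" and y: "y \<in> vec.span Y"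
  shows "herm \<sigma> x y = 0"
proof -
  have 1: "herm \<sigma> x' y = 0" if x': "x' \<in> X" for x'
    using y
  proof (induction rule: vec.span_induct_alt)
    case (step c v w)
    then show ?case using assms(1)[OF x' step(1)] by (simp add: herm_simps)
  qed (simp add: herm_simps)
  show ?thesis using x
  proof (induction rule: vec.span_induct_alt)
    case (step c v w)
    then show ?case using 1[OF step(1)] by (simp add: herm_simps)
  qed (simp add: herm_simps)
qed

lemma dim_orth_finite:
  fixes W :: "(complex^'n::finite) set"
  assumes W: "vec.subspace W" and B: "finite B"
  shows "vec.dim W \<le> vec.dim {x \<in> W. \<forall>b\<in>B. herm \<sigma> x b = 0} + card B"
proof -
  obtain h where h: "bij_betw h {..<card B} B"
    using ex_bij_betw_nat_finite[OF B] by (auto simp: atLeast0LessThan)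
  have "{x \<in> W. \<forall>i<card B. herm \<sigma> x (h i) = 0} = {x \<in> W. \<forall>b\<in>B. herm \<sigma> x b = 0}"
  proof -
    have "B = h ` {..<card B}" using h by (simp add: bij_betw_def)
    moreover have "(\<forall>b\<in>h ` {..<card B}. herm \<sigma> x b = 0) = (\<forall>i<card B. herm \<sigma> x (h i) = 0)" for x
      by auto
    ultimately show ?thesis by simp
  qed
  then show ?thesis using dim_orth_family[OF W, of "card B" \<sigma> h] by simp
qed

text \<open>A basis of \<open>X\<close> is extended to a basis \<open>C\<close> of \<open>T\<close>.
  A vector of \<open>Y\<close> orthogonal to the added vectors is orthogonal to all of
  \<open>T\<close>, hence zero, so the dimension of \<open>Y\<close> is at most the number of added
  vectors.\<close>

lemma dim_orthogonal_sum:
  fixes T :: "(complex^'n::finite) set"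
  assumes T: "vec.subspace T" and nondeg: "\<And>x. x \<in> T \<Longrightarrow> (\<And>y. y \<in> T \<Longrightarrow> herm \<sigma> x y = 0) \<Longrightarrow> x = 0"
    and X: "vec.subspace X" "X \<subseteq> T" and Y: "vec.subspace Y" "Y \<subseteq> T"
    and orth: "\<And>x y. x \<in> X \<Longrightarrow> y \<in> Y \<Longrightarrow> herm \<sigma> x y = 0"
  shows "vec.dim X + vec.dim Y \<le> vec.dim T"
proof -
  obtain B where B: "B \<subseteq> X" "vec.independent B" "X \<subseteq> vec.span B" "card B = vec.dim X"
    by (rule vec.basis_exists[of X], rule that)
  have BT: "B \<subseteq> T" using B(1) X(2) by simp
  obtain C where C: "B \<subseteq> C" "C \<subseteq> T" "vec.independent C" "T \<subseteq> vec.span C"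
    by (rule vec.maximal_independent_subset_extend[OF BT B(2)], rule that)
  have fC: "finite C" using C(3) by (simp add: vec.finiteI_independent)
  have cC: "card C = vec.dim T" using C(2,4,3) by (rule vec.basis_card_eq_dim)
  have cCB: "card (C - B) = vec.dim T - vec.dim X"
    using card_Diff_subset[OF finite_subset[OF C(1) fC] C(1)] cC B(4) by simp
  have "{y \<in> Y. \<forall>b\<in>C - B. herm \<sigma> y b = 0} \<subseteq> {0}"
  proof
    fix y assume "y \<in> {y \<in> Y. \<forall>b\<in>C - B. herm \<sigma> y b = 0}"
    then have y: "y \<in> Y" "\<And>b. b \<in> C - B \<Longrightarrow> herm \<sigma> y b = 0" by auto
    have yb: "herm \<sigma> y' b = 0" if "y' \<in> {y}" "b \<in> C" for y' b
    proof (cases "b \<in> B")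
      case True
      then have "herm \<sigma> b y = 0" using orth y(1) B(1) by blast
      then show ?thesis using that herm_commute_zero by blast
    qed (use y that in auto)
    have "y = 0"
    proof (rule nondeg)
      show "y \<in> T" using y Y by auto
      fix t assume "t \<in> T"
      then have "t \<in> vec.span C" using C(4) by auto
      moreover have "y \<in> vec.span {y}" by (rule vec.span_base) simp
      ultimately show "herm \<sigma> y t = 0" using herm_span_zero[of "{y}" C \<sigma> y t] yb by simp
    qed
    then show "y \<in> {0}" by simp
  qed
  then have "vec.dim {y \<in> Y. \<forall>b\<in>C - B. herm \<sigma> y b = 0} = 0" by (simp only: vec.dim_eq_0)
  moreover have "finite (C - B)" using fC by simp
  ultimately have "vec.dim Y \<le> vec.dim T - vec.dim X"
    using dim_orth_finite[OF Y(1), of "C - B" \<sigma>] unfolding cCB by linarith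
  moreover have "vec.dim X \<le> vec.dim T" using X(2) by (rule vec.dim_subset)
  ultimately show ?thesis by linarith
qed

lemma independent_open:
  fixes a :: "'k \<Rightarrow> complex^'n::finite"
  assumes K: "finite K" "inj_on a K" "vec.independent (a ` K)"
  shows "\<exists>\<eta>>0. \<forall>a'. (\<forall>i\<in>K. norm (a' i - a i) < \<eta>) \<longrightarrow> inj_on a' K \<and> vec.independent (a' ` K)"
proof -
  obtain I :: "'n set" and y \<eta> where I: "\<eta> > 0" "\<forall>i\<in>I. y i \<in> a ` K"
    "\<forall>y' Y'. (\<forall>i\<in>I. norm (y' i - y i) < \<eta>) \<longrightarrow> y' ` I \<subseteq> Y' \<longrightarrow> vec.dim (a ` K) \<le> vec.dim (Y' :: (complex^'n) set)"
    using rank_open[of "a ` K"] by (elim exE conjE)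
  have "\<forall>i. \<exists>k. i \<in> I \<longrightarrow> k \<in> K \<and> y i = a k" using I(2) by blast
  then obtain h where h: "\<And>i. i \<in> I \<Longrightarrow> h i \<in> K \<and> y i = a (h i)" by metis
  have "inj_on a' K \<and> vec.independent (a' ` K)" if n: "\<forall>i\<in>K. norm (a' i - a i) < \<eta>" for a'
  proof -
    have "vec.dim (a ` K) \<le> vec.dim (a' ` K)"
      by (rule I(3)[rule_format, of "\<lambda>i. a' (h i)"]) (use h n in auto)
    then have "card K \<le> vec.dim (a' ` K)"
      using K(2,3) by (simp add: vec.dim_eq_card_independent card_image)
    then show ?thesis using independent_of_dim[OF K(1)] by blast
  qed
  then show ?thesis using I(1) by blast
qed

lemma span_tuple_Suc: "vec.span ((v(k := x)) ` {..<Suc k}) = vec.span (insert x (v ` {..<k}))"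
proof -
  have "(v(k := x)) ` {..<k} = v ` {..<k}" by (rule image_cong) auto
  then show ?thesis unfolding lessThan_Suc image_insert by (simp only: fun_upd_same)
qed

context holomorphic_germ
begin

lemma image_dim_mono: "S \<subseteq> S' \<Longrightarrow> image_dim S \<le> image_dim S'"
  unfolding image_dim_def by (rule vec.dim_subset) auto

lemma image_span_mono: "S \<subseteq> S' \<Longrightarrow> vec.span (f ` (S \<inter> V)) \<subseteq> vec.span (f ` (S' \<inter> V))"
  by (rule vec.span_mono) auto

end

section \<open>Germs that preserve orthogonality\<close>

text \<open>The situation after the radical has been divided out: \<open>nondeg\<close> says that no
  radical is left on the span of the values, and \<open>isotropic\<close> carries the bound imposed
  by the target signature. Dividing out may create zeros of \<open>f\<close>, so only
  \<open>nonzero\<close> is assumed, and \<open>homog\<close> keeps the projective meaning of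
  \<open>f\<close>.\<close>

locale orthogonal_germ = holomorphic_germ f p \<rho>
  for f :: "complex^'n::finite \<Rightarrow> complex^'m::finite" and p \<rho> +
  fixes \<sigma> :: "'n \<Rightarrow> real" and \<tau> :: "'m \<Rightarrow> real" and m :: nat
  assumes nz: "\<forall>i. \<sigma> i \<noteq> 0"
    and p_null: "herm \<sigma> p p = 0" and zero_notin: "0 \<notin> ball p \<rho>"
    and orth: "\<And>z w. z \<in> ball p \<rho> \<Longrightarrow> w \<in> ball p \<rho> \<Longrightarrow> herm \<sigma> z w = 0 \<Longrightarrow> herm \<tau> (f z) (f w) = 0"
    and homog: "\<And>z c. z \<in> ball p \<rho> \<Longrightarrow> c *s z \<in> ball p \<rho> \<Longrightarrow> \<exists>k. k \<noteq> 0 \<and> f (c *s z) = k *s f z"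
    and nondeg: "\<And>x. x \<in> vec.span (f ` ball p \<rho>) \<Longrightarrow>
      (\<And>y. y \<in> vec.span (f ` ball p \<rho>) \<Longrightarrow> herm \<tau> x y = 0) \<Longrightarrow> x = 0"
    and nonzero: "\<exists>z\<in>ball p \<rho>. f z \<noteq> 0"
    and m: "m \<le> card {i. \<sigma> i > 0}" "m \<le> card {i. \<sigma> i < 0}"
    and isotropic: "\<And>W. vec.subspace W \<Longrightarrow> W \<subseteq> vec.span (f ` ball p \<rho>) \<Longrightarrow>
      (\<And>x y. x \<in> W \<Longrightarrow> y \<in> W \<Longrightarrow> herm \<tau> x y = 0) \<Longrightarrow> vec.dim W + 2 \<le> 2 * m"
begin

abbreviation T where "T \<equiv> vec.span (f ` V)"

lemma pV: "p \<in> V" using rho by simp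

lemma p_nonzero: "p \<noteq> 0" using pV zero_notin by auto

text \<open>The bound \<open>isotropic\<close> for the zero subspace reads
  \<open>2 \<le> 2 * m\<close>.\<close>

lemma m_pos: "1 \<le> m"
  using isotropic[of "{0}"] by (auto simp: herm_simps vec.span_zero)

lemma two_m: "2 * m \<le> CARD('n)"
proof -
  have "card {i. \<sigma> i > 0} + card {i. \<sigma> i < 0} = card ({i. \<sigma> i > 0} \<union> {i. \<sigma> i < 0})"
    by (rule card_Un_disjoint[symmetric]) auto
  also have "\<dots> \<le> CARD('n)" by (rule card_mono) auto
  finally show ?thesis using m by linarith
qed

lemma image_span_orth:
  assumes "\<And>z w. z \<in> A \<Longrightarrow> w \<in> B \<Longrightarrow> herm \<sigma> z w = 0"
    and "x \<in> vec.span (f ` (A \<inter> V))" "y \<in> vec.span (f ` (B \<inter> V))"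
  shows "herm \<tau> x y = 0"
  by (rule herm_span_zero[OF _ assms(2,3)]) (use assms(1) orth in \<open>auto simp del: mem_ball\<close>)

lemma image_span_T: "vec.span (f ` (A \<inter> V)) \<subseteq> T"
  by (rule vec.span_mono) auto

lemma image_dim_orth:
  assumes "\<And>z w. z \<in> A \<Longrightarrow> w \<in> B \<Longrightarrow> herm \<sigma> z w = 0"
  shows "image_dim A + image_dim B \<le> image_dim UNIV"
proof -
  have "vec.dim (vec.span (f ` (A \<inter> V))) + vec.dim (vec.span (f ` (B \<inter> V))) \<le> vec.dim T"
    by (rule dim_orthogonal_sum[where \<sigma> = \<tau>])
      (use nondeg image_span_T image_span_orth[OF assms] in \<open>auto simp del: mem_ball\<close>)
  then show ?thesis by (simp add: image_dim_def)
qed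

lemma image_dim_point:
  assumes z: "z \<in> V"
  shows "image_dim (vec.span {z}) = (if f z = 0 then 0 else 1)"
proof -
  have sub: "f ` (vec.span {z} \<inter> V) \<subseteq> vec.span {f z}"
  proof
    fix y assume "y \<in> f ` (vec.span {z} \<inter> V)"
    then obtain x where x: "x \<in> vec.span {z}" "x \<in> V" "y = f x" by blast
    then obtain c where "x = c *s z" by (auto simp: vec.span_singleton)
    then obtain k where "y = k *s f z" using homog[OF z, of c] x by blast
    then show "y \<in> vec.span {f z}" by (simp add: vec.span_scale vec.span_base)
  qed
  have mem: "f z \<in> f ` (vec.span {z} \<inter> V)" using z vec.span_base[of z "{z}"] by blast
  have "vec.span (f ` (vec.span {z} \<inter> V)) = vec.span {f z}"
  proof
    show "vec.span (f ` (vec.span {z} \<inter> V)) \<subseteq> vec.span {f z}"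
      by (rule vec.span_minimal[OF sub vec.subspace_span])
    show "vec.span {f z} \<subseteq> vec.span (f ` (vec.span {z} \<inter> V))"
      by (rule vec.span_mono) (use mem in simp)
  qed
  then have "image_dim (vec.span {z}) = vec.dim {f z}"
    unfolding image_dim_def by (rule vec.span_eq_dim)
  also have "\<dots> = (if f z = 0 then 0 else 1)" by (simp add: vec.dim_insert)
  finally show ?thesis .
qed

lemma generic_dim_1: "generic_dim 1 = 1"
proof -
  obtain z where z: "z \<in> V" "f z \<noteq> 0" using nonzero by blast
  have "1 \<le> generic_dim 1"
    using generic_dim_ge[of 1 "\<lambda>_. z"] z image_dim_point[OF z(1)] by (simp add: lessThan_Suc)
  obtain v where v: "\<And>j. j < 1 \<Longrightarrow> v j \<in> V" "image_dim (vec.span (v ` {..<1::nat})) = generic_dim 1"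
    using generic_dim_attained[of 1] by blast
  have "v 0 \<in> V" using v(1)[of 0] by simp
  then have "generic_dim 1 \<le> 1"
    using v(2) image_dim_point[of "v 0"] by (simp add: lessThan_Suc split: if_splits)
  then show ?thesis using \<open>1 \<le> generic_dim 1\<close> by simp
qed

lemma nonzero_dense:
  assumes "z \<in> V" "\<eta> > 0"
  obtains q where "q \<in> V" "norm (q - z) < \<eta>" "f q \<noteq> 0"
proof -
  obtain v' where v': "\<And>j. j < 1 \<Longrightarrow> v' j \<in> V" "\<And>j. j < 1 \<Longrightarrow> norm (v' j - z) < \<eta>"
    "image_dim (vec.span (v' ` {..<1::nat})) = generic_dim 1"
    by (rule generic_dense[of 1 "\<lambda>_. z" \<eta>]) (use assms in \<open>auto simp del: mem_ball\<close>)
  have "v' 0 \<in> V" using v'(1)[of 0] by simp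
  then have "f (v' 0) \<noteq> 0"
    using v'(3) image_dim_point[of "v' 0"] generic_dim_1 by (auto simp: lessThan_Suc)
  then show ?thesis using that[of "v' 0"] v'(1,2)[of 0] by simp
qed

lemma orth_dim: "CARD('n) \<le> vec.dim {x. herm \<sigma> x w = 0} + 1"
  using dim_orth[OF vec.subspace_UNIV, of \<sigma> w] by (simp add: vec.dimension_def card_cart_basis)

lemma orth2_dim: "CARD('n) \<le> vec.dim {x. herm \<sigma> x w = 0 \<and> herm \<sigma> x u = 0} + 2"
proof -
  have "vec.subspace {x. herm \<sigma> x w = 0}" using subspace_orth[OF vec.subspace_UNIV, of \<sigma> w] by simp
  from dim_orth[OF this, of \<sigma> u] orth_dim[of w] show ?thesis by simp
qed

text \<open>Since \<open>p\<close> is null, independent vectors orthogonal to \<open>p\<close> exist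
  arbitrarily close to \<open>p\<close>. They are made generic, and \<open>p\<close> is moved to a
  point \<open>q0\<close> orthogonal to the new tuple; then \<open>q0\<close> is moved to a point
  \<open>q\<close> where \<open>f\<close> is nonzero, and the tuple is moved back into
  orthogonality, staying generic by openness.\<close>

lemma generic_orthogonal_point:
  assumes k: "0 < k" "k < CARD('n)"
  obtains v q where "\<And>j. j < k \<Longrightarrow> v j \<in> V" "image_dim (vec.span (v ` {..<k})) = generic_dim k"
    "q \<in> V" "f q \<noteq> 0" "\<And>j. j < k \<Longrightarrow> herm \<sigma> (v j) q = 0"
proof -
  let ?S = "{x. herm \<sigma> x p = 0}"
  have S: "vec.subspace ?S" using subspace_orth[OF vec.subspace_UNIV, of \<sigma> p] by simp
  have pS: "p \<in> ?S" using p_null by simp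
  have kS: "k \<le> vec.dim ?S" using orth_dim[of p] k by simp
  obtain v0 :: "nat \<Rightarrow> complex^'n" where v0: "\<And>i. v0 i \<in> ?S" "\<And>i. norm (v0 i - p) < \<rho>"
    "inj_on v0 {..<k}" "vec.independent (v0 ` {..<k})"
    by (rule independent_tuple_near[OF S pS p_nonzero kS rho], rule that)
  have v0V: "v0 j \<in> V" for j using v0(2)[of j] by (simp add: dist_norm norm_minus_commute)
  obtain \<delta> where d: "\<delta> > 0" "\<And>a' b. (\<And>i. i \<in> {..<k} \<Longrightarrow> norm (a' i - v0 i) < \<delta>) \<Longrightarrow> norm b \<le> norm p \<Longrightarrow>
      (\<And>i. i \<in> {..<k} \<Longrightarrow> herm \<sigma> (v0 i) b = 0) \<Longrightarrow> \<exists>b'. norm (b' - b) < \<rho> \<and> (\<forall>i\<in>{..<k}. herm \<sigma> (a' i) b' = 0)"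
    using orthogonal_perturbation[OF nz finite_lessThan v0(3,4) rho, of "norm p"] by blast
  obtain v where v: "\<And>j. j < k \<Longrightarrow> v j \<in> V" "\<And>j. j < k \<Longrightarrow> norm (v j - v0 j) < \<delta>"
    "image_dim (vec.span (v ` {..<k})) = generic_dim k"
    using generic_dense[of k v0 \<delta>, OF k(1) v0V d(1)] by blast
  obtain q0 where q0: "norm (q0 - p) < \<rho>" "\<forall>i\<in>{..<k}. herm \<sigma> (v i) q0 = 0"
    using d(2)[of v p] v(2) v0(1) by auto
  have q0V: "q0 \<in> V" using q0(1) by (simp add: dist_norm norm_minus_commute)
  then have q0n: "q0 \<noteq> 0" using zero_notin by metis
  obtain \<eta> where eta: "\<eta> > 0" "\<And>v' j. (\<And>j. j < k \<Longrightarrow> norm (v' j - v j) < \<eta>) \<Longrightarrow> j < k \<Longrightarrow> v' j \<in> V"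
    "\<And>v'. (\<And>j. j < k \<Longrightarrow> norm (v' j - v j) < \<eta>) \<Longrightarrow> image_dim (vec.span (v' ` {..<k})) = generic_dim k"
    using generic_open[of k v, OF v(1,3)] by blast
  define R where "R = (\<Sum>j<k. norm (v j))"
  have R: "norm (v j) \<le> R" if "j < k" for j
    unfolding R_def by (rule member_le_sum) (use that in auto)
  have ind: "inj_on (\<lambda>_::nat. q0) {0}" "vec.independent ((\<lambda>_::nat. q0) ` {0})" using q0n by auto
  obtain \<delta>' where d': "\<delta>' > 0" "\<And>a' b. (\<And>i. i \<in> {0::nat} \<Longrightarrow> norm (a' i - q0) < \<delta>') \<Longrightarrow> norm b \<le> R \<Longrightarrow>
      (\<And>i. i \<in> {0::nat} \<Longrightarrow> herm \<sigma> q0 b = 0) \<Longrightarrow> \<exists>b'. norm (b' - b) < \<eta> \<and> (\<forall>i\<in>{0}. herm \<sigma> (a' i) b' = 0)"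
    using orthogonal_perturbation[OF nz _ ind eta(1), of R] by blast
  obtain q where q: "q \<in> V" "norm (q - q0) < \<delta>'" "f q \<noteq> 0"
    using nonzero_dense[OF q0V d'(1)] by blast
  have "\<exists>b'. norm (b' - v j) < \<eta> \<and> herm \<sigma> q b' = 0" if "j < k" for j
    using d'(2)[of "\<lambda>_. q" "v j"] q(2) R[OF that] q0(2) that herm_commute_zero[of \<sigma> "v j" q0] by auto
  then obtain v' where v': "\<And>j. j < k \<Longrightarrow> norm (v' j - v j) < \<eta>" "\<And>j. j < k \<Longrightarrow> herm \<sigma> q (v' j) = 0"
    by metis
  show ?thesis
  proof (rule that[of v' q])
    show "v' j \<in> V" if "j < k" for j by (rule eta(2)[of v', OF v'(1) that])
    show "image_dim (vec.span (v' ` {..<k})) = generic_dim k" by (rule eta(3)[OF v'(1)])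
    show "herm \<sigma> (v' j) q = 0" if "j < k" for j using v'(2)[OF that] herm_commute_zero by blast
  qed (use q in auto)
qed

text \<open>Adding \<open>q\<close> to a generic tuple raises the rank by at least one because of
  \<open>fq\<close>, and \<open>step\<close> allows no more; so the image of the enlarged span adds
  nothing beyond \<open>f q\<close>.\<close>

lemma span_of_generic:
  assumes v: "\<And>j. j < k \<Longrightarrow> v j \<in> V" and g: "image_dim (vec.span (v ` {..<k})) = generic_dim k"
    and x: "x \<in> V" and q: "q \<in> V" and fq: "f q \<notin> vec.span (f ` (vec.span (v ` {..<k}) \<inter> V))"
    and step: "generic_dim (Suc k) \<le> generic_dim k + 1" and mem: "x \<in> vec.span (insert q (v ` {..<k}))"
  shows "f x \<in> vec.span (insert (f q) (f ` (vec.span (v ` {..<k}) \<inter> V)))"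
proof -
  let ?P = "vec.span (v ` {..<k})" and ?P' = "vec.span (insert q (v ` {..<k}))"
  have "image_dim (vec.span ((v(k := q)) ` {..<Suc k})) \<le> generic_dim (Suc k)"
    by (rule generic_dim_ge) (use v q in \<open>auto simp: less_Suc_eq simp del: mem_ball\<close>)
  then have le: "vec.dim (f ` (?P' \<inter> V)) \<le> generic_dim k + 1"
    using step unfolding span_tuple_Suc image_dim_def by linarith
  have "insert (f q) (f ` (?P \<inter> V)) \<subseteq> f ` (?P' \<inter> V)"
  proof -
    have "?P \<subseteq> ?P'" by (rule vec.span_mono) auto
    moreover have "q \<in> ?P'" by (rule vec.span_base) simp
    ultimately show ?thesis using q by blast
  qed
  moreover have "vec.dim (insert (f q) (f ` (?P \<inter> V))) = generic_dim k + 1"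
    using fq g unfolding image_dim_def by (simp add: vec.dim_insert)
  ultimately have "vec.span (insert (f q) (f ` (?P \<inter> V))) = vec.span (f ` (?P' \<inter> V))"
    using le by (intro vec.dim_eq_span) auto
  moreover have "f x \<in> vec.span (f ` (?P' \<inter> V))" using x mem by (intro vec.span_base) blast
  ultimately show ?thesis by simp
qed

text \<open>If the rank stagnated, the image of the span of one generic \<open>k\<close>-tuple would
  already span \<open>T\<close>. A point \<open>q\<close> orthogonal to that span with
  \<open>f q \<noteq> 0\<close> would then be sent into the radical of \<open>T\<close>, which is
  zero.\<close>

lemma generic_dim_growth:
  assumes k: "0 < k" "k < CARD('n)"
  shows "generic_dim k < generic_dim (Suc k)"
proof (rule ccontr)
  assume "\<not> ?thesis"
  then have le: "generic_dim (Suc k) \<le> generic_dim k" by simp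
  obtain v q where v: "\<And>j. j < k \<Longrightarrow> v j \<in> V" "image_dim (vec.span (v ` {..<k})) = generic_dim k"
    and q: "q \<in> V" "f q \<noteq> 0" "\<And>j. j < k \<Longrightarrow> herm \<sigma> (v j) q = 0"
    using generic_orthogonal_point[OF k] by blast
  let ?P = "vec.span (v ` {..<k})"
  have all: "f x \<in> vec.span (f ` (?P \<inter> V))" if x: "x \<in> V" for x
  proof -
    let ?P' = "vec.span (insert x (v ` {..<k}))"
    have "image_dim (vec.span ((v(k := x)) ` {..<Suc k})) \<le> generic_dim (Suc k)"
      by (rule generic_dim_ge) (use v x in \<open>auto simp: less_Suc_eq simp del: mem_ball\<close>)
    then have "vec.dim (f ` (?P' \<inter> V)) \<le> vec.dim (f ` (?P \<inter> V))"
      using le v(2) unfolding span_tuple_Suc image_dim_def by linarith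
    moreover have "f ` (?P \<inter> V) \<subseteq> f ` (?P' \<inter> V)"
      using vec.span_mono[of "v ` {..<k}" "insert x (v ` {..<k})"] by blast
    ultimately have "vec.span (f ` (?P \<inter> V)) = vec.span (f ` (?P' \<inter> V))"
      by (intro vec.dim_eq_span)
    moreover have "x \<in> ?P'" by (rule vec.span_base) simp
    then have "f x \<in> vec.span (f ` (?P' \<inter> V))" using x by (intro vec.span_base) blast
    ultimately show ?thesis by simp
  qed
  have Pq: "herm \<sigma> z w = 0" if "z \<in> ?P" "w \<in> {q}" for z w
    by (rule herm_span_zero[OF _ that(1) vec.span_base[OF that(2)]]) (use q(3) in auto)
  have orthq: "herm \<tau> y (f q) = 0" if "y \<in> T" for y
  proof -
    have "T \<subseteq> vec.span (f ` (?P \<inter> V))"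
      by (rule vec.span_minimal[OF _ vec.subspace_span]) (use all in blast)
    then have "y \<in> vec.span (f ` (?P \<inter> V))" using that by blast
    moreover have "f q \<in> vec.span (f ` ({q} \<inter> V))" using q(1) by (intro vec.span_base) blast
    ultimately show ?thesis using image_span_orth[of ?P "{q}", OF Pq] by blast
  qed
  have "f q = 0"
  proof (rule nondeg)
    show "f q \<in> T" using q(1) by (intro vec.span_base) blast
    show "herm \<tau> (f q) y = 0" if "y \<in> T" for y using orthq[OF that] herm_commute_zero by blast
  qed
  then show False using q(2) by simp
qed

lemma generic_dim_lower: "1 \<le> k \<Longrightarrow> k \<le> CARD('n) \<Longrightarrow> k \<le> generic_dim k"
proof (induction k rule: dec_induct)
  case base
  then show ?case using generic_dim_1 by simp
next
  case (step k)
  then show ?case using generic_dim_growth[of k] by simp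
qed

text \<open>Since a linear map has rank at most the dimension of its source, this bound later forces
  every linear \<open>L\<close> with \<open>T \<subseteq> range L\<close> to be injective with range
  exactly \<open>T\<close>.\<close>

lemma T_dim: "CARD('n) \<le> vec.dim T"
proof -
  obtain v where v: "\<And>j. j < CARD('n) \<Longrightarrow> v j \<in> V" "image_dim (vec.span (v ` {..<CARD('n)})) = generic_dim CARD('n)"
    using generic_dim_attained[of "CARD('n)"] by blast
  have "CARD('n) \<le> generic_dim CARD('n)" by (rule generic_dim_lower) (simp_all add: Suc_leI)
  also have "\<dots> \<le> image_dim UNIV" using v(2) image_dim_mono[OF subset_UNIV] by metis
  finally show ?thesis by (simp add: image_dim_def)
qed

text \<open>A generic tuple near a null tuple \<open>q\<close> lies in the span of a tuple in graph
  form, which a path joins to null tuples at real parameters. Continuation from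
  \<open>t = \<i>\<close> to the reals yields a null plane whose image has at least the generic
  dimension, and this image is isotropic.\<close>

lemma generic_dim_m: "generic_dim m + 2 \<le> 2 * m"
proof -
  obtain u where u: "u 0 = p" "inj_on u {..<m}" "vec.independent (u ` {..<m})"
    "\<forall>i<m. \<forall>j<m. herm \<sigma> (u i) (u j) = 0"
    using null_tuple[OF p_nonzero p_null m m_pos order_refl] by (elim exE conjE)
  define S where "S = vec.span (u ` {..<m})"
  have S0: "herm \<sigma> x y = 0" if "x \<in> S" "y \<in> S" for x y
    by (rule herm_span_zero[OF _ that[unfolded S_def]]) (use u(4) in auto)
  have S: "vec.subspace S" "p \<in> S"
    using u(1) m_pos unfolding S_def by (auto intro!: vec.span_base)
  have mS: "m \<le> vec.dim S" unfolding S_def using u(2,3) by (simp add: vec.dim_eq_card_independent card_image)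
  \<comment> \<open>The tuple \<open>q\<close> stays within a quarter of \<rho> of \<open>p\<close>
    and the path within another quarter of \<open>q\<close>, so all tuples of the path lie in the
    ball of half the radius.\<close>
  have r4: "\<rho> / 4 > 0" using rho by simp
  obtain q :: "nat \<Rightarrow> complex^'n" where q: "\<And>i. q i \<in> S" "\<And>i. norm (q i - p) < \<rho> / 4"
    "inj_on q {..<m}" "vec.independent (q ` {..<m})"
    by (rule independent_tuple_near[OF S p_nonzero mS r4], rule that)
  have qq: "herm \<sigma> (q i) (q j) = 0" for i j by (rule S0[OF q(1) q(1)])
  obtain q' where q': "\<And>i j. i < m \<Longrightarrow> j < m \<Longrightarrow> herm \<sigma> (q i) (q' j) = (if i = j then 1 else 0)"
    "\<And>i j. i < m \<Longrightarrow> j < m \<Longrightarrow> herm \<sigma> (q' i) (q' j) = 0"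
    by (rule null_dual_tuple[OF nz q(3,4) qq], rule that)
  have "\<exists>\<delta>>0. \<forall>\<phi>. (\<forall>i<m. \<forall>j<m. herm \<sigma> (\<phi> i) (q' j) = 0) \<longrightarrow> (\<forall>i<m. norm (\<phi> i) < \<delta>) \<longrightarrow>
     (\<exists>a b c. (\<forall>i<m. a i + \<i> *s b i + \<i>\<^sup>2 *s c i = q i + \<phi> i) \<and>
       (\<forall>i<m. \<forall>j<m. \<forall>t. t \<in> \<real> \<longrightarrow> herm \<sigma> (a i + t *s b i + t\<^sup>2 *s c i) (a j + t *s b j + t\<^sup>2 *s c j) = 0) \<and>
       (\<forall>i<m. \<forall>t. norm t < 2 \<longrightarrow> norm (a i + t *s b i + t\<^sup>2 *s c i - q i) < \<rho> / 4))"
    by (rule null_path) (use q' qq r4 in auto)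
  then obtain \<delta>1 where d1: "\<delta>1 > 0" "\<forall>\<phi>. (\<forall>i<m. \<forall>j<m. herm \<sigma> (\<phi> i) (q' j) = 0) \<longrightarrow> (\<forall>i<m. norm (\<phi> i) < \<delta>1) \<longrightarrow>
     (\<exists>a b c. (\<forall>i<m. a i + \<i> *s b i + \<i>\<^sup>2 *s c i = q i + \<phi> i) \<and>
       (\<forall>i<m. \<forall>j<m. \<forall>t. t \<in> \<real> \<longrightarrow> herm \<sigma> (a i + t *s b i + t\<^sup>2 *s c i) (a j + t *s b j + t\<^sup>2 *s c j) = 0) \<and>
       (\<forall>i<m. \<forall>t. norm t < 2 \<longrightarrow> norm (a i + t *s b i + t\<^sup>2 *s c i - q i) < \<rho> / 4))"
    by (elim exE conjE)
  have "\<exists>\<delta>>0. \<forall>v. (\<forall>i<m. norm (v i - q i) < \<delta>) \<longrightarrow>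
     (\<exists>\<phi>. (\<forall>i<m. \<forall>j<m. herm \<sigma> (\<phi> i) (q' j) = 0) \<and> (\<forall>i<m. norm (\<phi> i) < \<delta>1) \<and>
         v ` {..<m} \<subseteq> vec.span ((\<lambda>i. q i + \<phi> i) ` {..<m}))"
    by (rule graph_basis) (use q' d1(1) in auto)
  then obtain \<delta>2 where d2: "\<delta>2 > 0" "\<forall>v. (\<forall>i<m. norm (v i - q i) < \<delta>2) \<longrightarrow>
     (\<exists>\<phi>. (\<forall>i<m. \<forall>j<m. herm \<sigma> (\<phi> i) (q' j) = 0) \<and> (\<forall>i<m. norm (\<phi> i) < \<delta>1) \<and>
         v ` {..<m} \<subseteq> vec.span ((\<lambda>i. q i + \<phi> i) ` {..<m}))"
    by (elim exE conjE)
  have qV: "q j \<in> V" for j using q(2)[of j] rho by (simp add: dist_norm norm_minus_commute)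
  have m0: "0 < m" using m_pos by simp
  obtain v where v: "\<And>j. j < m \<Longrightarrow> v j \<in> V" "\<And>j. j < m \<Longrightarrow> norm (v j - q j) < \<delta>2"
    "image_dim (vec.span (v ` {..<m})) = generic_dim m"
    using generic_dense[of m q \<delta>2, OF m0 qV d2(1)] by blast
  obtain \<phi> where phi: "\<forall>i<m. \<forall>j<m. herm \<sigma> (\<phi> i) (q' j) = 0" "\<forall>i<m. norm (\<phi> i) < \<delta>1"
         "v ` {..<m} \<subseteq> vec.span ((\<lambda>i. q i + \<phi> i) ` {..<m})"
  proof -
    have "\<forall>i<m. norm (v i - q i) < \<delta>2" using v(2) by simp
    from d2(2)[THEN spec, THEN mp, OF this] show ?thesis using that by (elim exE conjE)
  qed
  have "\<exists>a b c. (\<forall>i<m. a i + \<i> *s b i + \<i>\<^sup>2 *s c i = q i + \<phi> i) \<and>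
       (\<forall>i<m. \<forall>j<m. \<forall>t. t \<in> \<real> \<longrightarrow> herm \<sigma> (a i + t *s b i + t\<^sup>2 *s c i) (a j + t *s b j + t\<^sup>2 *s c j) = 0) \<and>
       (\<forall>i<m. \<forall>t. norm t < 2 \<longrightarrow> norm (a i + t *s b i + t\<^sup>2 *s c i - q i) < \<rho> / 4)"
    by (rule d1(2)[THEN spec, THEN mp, THEN mp, OF phi(1,2)])
  then obtain a b c where abc: "\<forall>i<m. a i + \<i> *s b i + \<i>\<^sup>2 *s c i = q i + \<phi> i"
    "\<forall>i<m. \<forall>j<m. \<forall>t. t \<in> \<real> \<longrightarrow> herm \<sigma> (a i + t *s b i + t\<^sup>2 *s c i) (a j + t *s b j + t\<^sup>2 *s c j) = 0"
    "\<forall>i<m. \<forall>t. norm t < 2 \<longrightarrow> norm (a i + t *s b i + t\<^sup>2 *s c i - q i) < \<rho> / 4"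
    by (elim exE conjE)
  let ?J = "ball (0::complex) 2"
  have bd: "norm (a j + t *s b j + t\<^sup>2 *s c j - p) \<le> \<rho> / 2" if "j < m" "t \<in> ?J" for j t
  proof -
    have t2: "norm t < 2" using that(2) by (simp add: dist_norm)
    have "norm (a j + t *s b j + t\<^sup>2 *s c j - q j) < \<rho> / 4" using abc(3) that(1) t2 by blast
    then show ?thesis
      using q(2)[of j] dist_triangle[of "a j + t *s b j + t\<^sup>2 *s c j" p "q j"] unfolding dist_norm by linarith
  qed
  have r2: "\<rho> / 2 < \<rho>" using rho by simp
  \<comment> \<open>The disc of radius 2 contains both the starting parameter \<open>\<i>\<close>
    and real parameters accumulating at 0.\<close>
  have lim: "0 islimpt (?J \<inter> \<real>)"
    unfolding islimpt_approachable
  proof (intro allI impI)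
    fix e :: real assume "e > 0"
    then show "\<exists>x'\<in>?J \<inter> \<real>. x' \<noteq> 0 \<and> dist x' 0 < e"
      by (intro bexI[of _ "of_real (min e 1 / 2)"]) auto
  qed
  have wj: "q j + \<phi> j = a j + \<i> *s b j + \<i>\<^sup>2 *s c j" if "j < m" for j using abc(1) that by simp
  have "\<exists>t\<in>?J \<inter> \<real>. image_dim (vec.span ((\<lambda>i. q i + \<phi> i) ` {..<m})) \<le>
    image_dim (vec.span ((\<lambda>j. a j + t *s b j + t\<^sup>2 *s c j) ` {..<m}))"
    by (rule barycentric_rank_continuation[where a = a and b = b and c = c and r = "\<rho> / 2" and J = ?J and \<xi> = 0 and k = m and ?t1.0 = \<i>])
      (use m0 bd r2 lim wj in auto)
  then obtain t where t: "t \<in> \<real>" "image_dim (vec.span ((\<lambda>i. q i + \<phi> i) ` {..<m})) \<le>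
    image_dim (vec.span ((\<lambda>j. a j + t *s b j + t\<^sup>2 *s c j) ` {..<m}))" by blast
  let ?E = "vec.span ((\<lambda>j. a j + t *s b j + t\<^sup>2 *s c j) ` {..<m})"
  have E0: "herm \<sigma> z w = 0" if "z \<in> ?E" "w \<in> ?E" for z w
    by (rule herm_span_zero[OF _ that]) (use abc(2) t(1) in auto)
  have "vec.dim (vec.span (f ` (?E \<inter> V))) + 2 \<le> 2 * m"
    by (rule isotropic[OF vec.subspace_span image_span_T]) (rule image_span_orth[OF E0])
  moreover have "generic_dim m \<le> image_dim ?E"
  proof -
    have "vec.span (v ` {..<m}) \<subseteq> vec.span ((\<lambda>i. q i + \<phi> i) ` {..<m})"
      by (rule vec.span_minimal[OF phi(3) vec.subspace_span])
    then have "generic_dim m \<le> image_dim (vec.span ((\<lambda>i. q i + \<phi> i) ` {..<m}))"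
      using image_dim_mono[of "vec.span (v ` {..<m})" "vec.span ((\<lambda>i. q i + \<phi> i) ` {..<m})"] v(3) by simp
    then show ?thesis using t(2) by (rule order_trans)
  qed
  ultimately show ?thesis by (simp add: image_dim_def)
qed

text \<open>From \<open>generic_dim 1 = 1\<close>, increments of at least 2 would give
  \<open>2 * m - 1 \<le> generic_dim m\<close>, one more than \<open>generic_dim_m\<close> permits.
  This is the origin of the constant in the dimension hypothesis.\<close>

lemma small_growth:
  obtains k where "0 < k" "k < m" "generic_dim (Suc k) \<le> generic_dim k + 1"
proof -
  have "\<exists>k. 0 < k \<and> k < m \<and> generic_dim (Suc k) \<le> generic_dim k + 1"
  proof (rule ccontr)
    assume "\<not> ?thesis"
    then have big: "generic_dim k + 2 \<le> generic_dim (Suc k)" if "0 < k" "k < m" for k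
      using that by (metis Suc_eq_plus1 Suc_leI add_2_eq_Suc' not_less not_less_eq_eq)
    have "1 \<le> k \<Longrightarrow> k \<le> m \<Longrightarrow> 2 * k \<le> generic_dim k + 1" for k
    proof (induction k rule: dec_induct)
      case base
      then show ?case using generic_dim_1 by simp
    next
      case (step k)
      then show ?case using big[of k] by simp
    qed
    from this[of m] show False using m_pos generic_dim_m by simp
  qed
  then show ?thesis using that by blast
qed

text \<open>A point \<open>x\<close> near \<open>v 0\<close> lies in the span of \<open>q\<close> and of the tuple obtained from \<open>v\<close> by replacing
  \<open>v 0\<close> with the projection of \<open>x\<close> along \<open>q\<close>, and this tuple is still generic.\<close>

lemma image_dim_hyperplane:
  assumes k: "0 < k" and step: "generic_dim (Suc k) \<le> generic_dim k + 1"
    and v: "\<And>j. j < k \<Longrightarrow> v j \<in> V" "image_dim (vec.span (v ` {..<k})) = generic_dim k"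
    and H: "vec.subspace H" and vH: "\<And>j. j < k \<Longrightarrow> v j \<in> H" "\<And>j. j < k \<Longrightarrow> herm \<sigma> (v j) w = 0"
  shows "image_dim H \<le> image_dim {x \<in> H. herm \<sigma> x w = 0} + 1"
proof -
  let ?H = "{x \<in> H. herm \<sigma> x w = 0}"
  let ?Y = "vec.span (f ` (?H \<inter> V))"
  have H': "vec.subspace ?H" by (rule subspace_orth[OF H])
  show ?thesis
  proof (cases "f ` (H \<inter> V) \<subseteq> ?Y")
    case True
    then have "vec.dim (f ` (H \<inter> V)) \<le> vec.dim (f ` (?H \<inter> V))" by (rule vec.dim_mono)
    then show ?thesis by (simp add: image_dim_def)
  next
    case False
    then obtain q where q: "q \<in> H" "q \<in> V" "f q \<notin> ?Y" by blast
    have hq: "herm \<sigma> q w \<noteq> 0"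
    proof
      assume "herm \<sigma> q w = 0"
      then have "f q \<in> ?Y" using q by (intro vec.span_base) blast
      then show False using q by simp
    qed
    obtain \<eta> where eta: "\<eta> > 0" "\<And>v' j. (\<And>j. j < k \<Longrightarrow> norm (v' j - v j) < \<eta>) \<Longrightarrow> j < k \<Longrightarrow> v' j \<in> V"
      "\<And>v'. (\<And>j. j < k \<Longrightarrow> norm (v' j - v j) < \<eta>) \<Longrightarrow> image_dim (vec.span (v' ` {..<k})) = generic_dim k"
      using generic_open[of k v, OF v] by blast
    \<comment> \<open>The correction \<open>\<beta> *s q\<close> has norm at most
      \<open>C * norm (x - v 0)\<close>, so points of \<open>H\<close> within \<epsilon> of
      \<open>v 0\<close> are projected along \<open>q\<close> to within \<eta> of it.\<close>
    define C where "C = (\<Sum>i\<in>UNIV. \<bar>\<sigma> i\<bar>) * norm w / norm (herm \<sigma> q w) * norm q"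
    have C0: "C \<ge> 0" unfolding C_def by (intro mult_nonneg_nonneg divide_nonneg_nonneg sum_nonneg) auto
    define \<epsilon> where "\<epsilon> = \<eta> / (1 + C)"
    have eps: "\<epsilon> > 0" unfolding \<epsilon>_def using eta C0 by (simp add: add_pos_nonneg)
    have local: "f ` (H \<inter> V \<inter> ball (v 0) \<epsilon>) \<subseteq> vec.span (insert (f q) (f ` (?H \<inter> V)))"
    proof
      fix y assume "y \<in> f ` (H \<inter> V \<inter> ball (v 0) \<epsilon>)"
      then obtain x where x: "x \<in> H" "x \<in> V" "x \<in> ball (v 0) \<epsilon>" "y = f x" by blast
      define \<beta> where "\<beta> = herm \<sigma> x w / herm \<sigma> q w"
      define x' where "x' = x - \<beta> *s q"
      have x'H: "x' \<in> ?H"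
        using x(1) q(1) H hq by (simp add: x'_def \<beta>_def herm_simps vec.subspace_diff vec.subspace_scale)
      have nx: "norm (x - v 0) < \<epsilon>" using x(3) by (simp add: dist_norm norm_minus_commute)
      have "norm (\<beta> *s q) \<le> C * norm (x - v 0)"
      proof -
        have "herm \<sigma> x w = herm \<sigma> (x - v 0) w" using vH(2)[OF k] by (simp add: herm_simps)
        then have "norm (herm \<sigma> x w) \<le> (\<Sum>i\<in>UNIV. \<bar>\<sigma> i\<bar>) * norm (x - v 0) * norm w"
          using herm_bound[of \<sigma> "x - v 0" w] by simp
        then have "norm (herm \<sigma> x w) / norm (herm \<sigma> q w) * norm q \<le>
            (\<Sum>i\<in>UNIV. \<bar>\<sigma> i\<bar>) * norm (x - v 0) * norm w / norm (herm \<sigma> q w) * norm q"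
          by (intro mult_right_mono divide_right_mono) auto
        then show ?thesis unfolding norm_vector_scaleC \<beta>_def norm_divide C_def by (simp add: mult_ac)
      qed
      then have "norm (x' - v 0) \<le> norm (x - v 0) + C * norm (x - v 0)"
        unfolding x'_def using norm_triangle_ineq4[of "x - v 0" "\<beta> *s q"] by (simp add: algebra_simps)
      also have "\<dots> = (1 + C) * norm (x - v 0)" by (simp add: algebra_simps)
      also have "\<dots> < (1 + C) * \<epsilon>" using nx C0 by (intro mult_strict_left_mono) auto
      also have "\<dots> = \<eta>" unfolding \<epsilon>_def using C0 by simp
      finally have x'v: "norm (x' - v 0) < \<eta>" .
      define v' where "v' = v(0 := x')"
      have v'n: "norm (v' j - v j) < \<eta>" if "j < k" for j using x'v eta(1) by (simp add: v'_def)
      have v'V: "v' j \<in> V" if "j < k" for j by (rule eta(2)[of v', OF v'n that])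
      have v'g: "image_dim (vec.span (v' ` {..<k})) = generic_dim k" by (rule eta(3)[OF v'n])
      have "v' ` {..<k} \<subseteq> ?H" using x'H vH by (auto simp: v'_def)
      then have sub: "vec.span (v' ` {..<k}) \<subseteq> ?H" by (rule vec.span_minimal[OF _ H'])
      then have subY: "vec.span (f ` (vec.span (v' ` {..<k}) \<inter> V)) \<subseteq> ?Y" by (rule image_span_mono)
      have fq: "f q \<notin> vec.span (f ` (vec.span (v' ` {..<k}) \<inter> V))" using subY q(3) by blast
      have x'v': "x' \<in> v' ` {..<k}" using k by (auto simp: v'_def intro!: image_eqI[of _ _ 0])
      have memx: "x \<in> vec.span (insert q (v' ` {..<k}))"
      proof -
        have "x = \<beta> *s q + x'" unfolding x'_def by simp
        moreover have "\<beta> *s q + x' \<in> vec.span (insert q (v' ` {..<k}))"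
          by (intro vec.span_add vec.span_scale vec.span_base) (use x'v' in auto)
        ultimately show ?thesis by simp
      qed
      have "f x \<in> vec.span (insert (f q) (f ` (vec.span (v' ` {..<k}) \<inter> V)))"
        by (rule span_of_generic[where k = k and v = v' and x = x and q = q, OF _ v'g x(2) q(2) fq step memx], rule v'V)
      moreover have "vec.span (insert (f q) (f ` (vec.span (v' ` {..<k}) \<inter> V))) \<subseteq> vec.span (insert (f q) (f ` (?H \<inter> V)))"
        by (rule vec.span_mono) (use sub in blast)
      ultimately show "y \<in> vec.span (insert (f q) (f ` (?H \<inter> V)))" using x(4) by blast
    qed
    \<comment> \<open>Control on a small ball around \<open>v 0\<close> suffices, since the rank on
      \<open>H\<close> is already attained there.\<close>
    have "image_dim H \<le> vec.dim (f ` (H \<inter> V \<inter> ball (v 0) \<epsilon>))"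
      by (rule image_dim_local[OF H vH(1)[OF k] v(1)[OF k] eps])
    also have "\<dots> \<le> vec.dim (insert (f q) (f ` (?H \<inter> V)))" by (rule vec.dim_mono[OF local])
    also have "\<dots> \<le> image_dim ?H + 1" by (simp add: vec.dim_insert image_dim_def)
    finally show ?thesis .
  qed
qed

text \<open>A generic pair \<open>w\<close> orthogonal to a generic \<open>k\<close>-tuple
  \<open>v'\<close> is found by alternating corrections as in
  \<open>generic_orthogonal_point\<close>. Each of the two conditions defining \<open>?H2\<close>
  lowers the image dimension by at most one, and the image of the span of \<open>w\<close> is
  orthogonal to that of \<open>?H2\<close>; the dimension count in \<open>T\<close> then leaves room
  for at most 2.\<close>

lemma generic_dim_2: "generic_dim 2 \<le> 2"
proof -
  obtain k where k: "0 < k" "k < m" "generic_dim (Suc k) \<le> generic_dim k + 1" by (rule small_growth)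
  have k2: "k + 2 \<le> CARD('n)" using k two_m by simp
  let ?S = "{x. herm \<sigma> x p = 0}"
  have S: "vec.subspace ?S" using subspace_orth[OF vec.subspace_UNIV, of \<sigma> p] by simp
  have pS: "p \<in> ?S" using p_null by simp
  have 2: "2 \<le> vec.dim ?S" using orth_dim[of p] k2 k(1) by simp
  obtain q0 :: "nat \<Rightarrow> complex^'n" where q0: "\<And>i. q0 i \<in> ?S" "\<And>i. norm (q0 i - p) < \<rho>" "q0 0 = p"
    "inj_on q0 {..<2}" "vec.independent (q0 ` {..<2})"
    by (rule independent_tuple_near[OF S pS p_nonzero 2 rho], rule that)
  \<comment> \<open>The initial tuple \<open>v0\<close> must be orthogonal to both members
    \<open>p\<close> and \<open>q0 1\<close> of the initial pair;
    \<open>k + 2 \<le> CARD('n)\<close> leaves room for \<open>k\<close> independent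
    vectors.\<close>
  let ?S' = "{x. herm \<sigma> x p = 0 \<and> herm \<sigma> x (q0 1) = 0}"
  have S': "vec.subspace ?S'" using subspace_orth[OF S, of \<sigma> "q0 1"] by simp
  have pS': "p \<in> ?S'" using p_null q0(1)[of 1] herm_commute_zero by auto
  have kS': "k \<le> vec.dim ?S'" using orth2_dim[of p "q0 1"] k2 by simp
  obtain v0 :: "nat \<Rightarrow> complex^'n" where v0: "\<And>i. v0 i \<in> ?S'" "\<And>i. norm (v0 i - p) < \<rho>"
    "inj_on v0 {..<k}" "vec.independent (v0 ` {..<k})"
    by (rule independent_tuple_near[OF S' pS' p_nonzero kS' rho], rule that)
  have v0V: "v0 j \<in> V" for j using v0(2)[of j] by (simp add: dist_norm norm_minus_commute)
  have q0V: "q0 j \<in> V" for j using q0(2)[of j] by (simp add: dist_norm norm_minus_commute)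
  have orth0: "herm \<sigma> (v0 i) (q0 j) = 0" if "j < 2" for i j
    using v0(1)[of i] q0(3) that by (cases "j = 0") (auto simp: less_2_cases_iff)
  obtain \<eta>0 where eta0: "\<eta>0 > 0" "\<forall>a'. (\<forall>i\<in>{..<2}. norm (a' i - q0 i) < \<eta>0) \<longrightarrow> inj_on a' {..<2} \<and> vec.independent (a' ` {..<2})"
    using independent_open[OF finite_lessThan q0(4,5)] by (elim exE conjE)
  obtain r where r: "r < \<rho>" "\<And>j. j < 2 \<Longrightarrow> norm (q0 j - p) \<le> r" using compact_radius[of 2 q0, OF q0V] by blast
  \<comment> \<open>Small enough to preserve the independence of the pair, which the second
    correction requires, as well as its membership in the ball.\<close>
  define \<eta>1 where "\<eta>1 = min \<eta>0 (\<rho> - r)"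
  have eta1: "\<eta>1 > 0" unfolding \<eta>1_def using eta0 r by simp
  define R where "R = (\<Sum>j<2. norm (q0 j))"
  have R: "norm (q0 j) \<le> R" if "j < 2" for j
    unfolding R_def by (rule member_le_sum) (use that in auto)
  obtain \<delta> where d: "\<delta> > 0" "\<And>a' b. (\<And>i. i \<in> {..<k} \<Longrightarrow> norm (a' i - v0 i) < \<delta>) \<Longrightarrow> norm b \<le> R \<Longrightarrow>
      (\<And>i. i \<in> {..<k} \<Longrightarrow> herm \<sigma> (v0 i) b = 0) \<Longrightarrow> \<exists>b'. norm (b' - b) < \<eta>1 \<and> (\<forall>i\<in>{..<k}. herm \<sigma> (a' i) b' = 0)"
    using orthogonal_perturbation[OF nz finite_lessThan v0(3,4) eta1, of R] by blast
  obtain v where v: "\<And>j. j < k \<Longrightarrow> v j \<in> V" "\<And>j. j < k \<Longrightarrow> norm (v j - v0 j) < \<delta>"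
    "image_dim (vec.span (v ` {..<k})) = generic_dim k"
    using generic_dense[of k v0 \<delta>, OF k(1) v0V d(1)] by blast
  have "\<exists>b'. norm (b' - q0 j) < \<eta>1 \<and> (\<forall>i\<in>{..<k}. herm \<sigma> (v i) b' = 0)" if "j < 2" for j
    by (rule d(2)) (use v(2) R[OF that] orth0[OF that] in auto)
  then obtain q where q: "\<And>j. j < 2 \<Longrightarrow> norm (q j - q0 j) < \<eta>1" "\<And>j i. j < 2 \<Longrightarrow> i < k \<Longrightarrow> herm \<sigma> (v i) (q j) = 0"
    by (metis lessThan_iff)
  have qi: "inj_on q {..<2}" "vec.independent (q ` {..<2})"
    using eta0(2)[rule_format, of q] q(1) unfolding \<eta>1_def by auto
  have qV: "q j \<in> V" if "j < 2" for j
  proof -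
    have "norm (q j - p) \<le> norm (q j - q0 j) + norm (q0 j - p)"
      using norm_triangle_ineq[of "q j - q0 j" "q0 j - p"] by simp
    also have "\<dots> < (\<rho> - r) + r" using q(1)[OF that] r(2)[OF that] unfolding \<eta>1_def by linarith
    finally show ?thesis by (simp add: dist_norm norm_minus_commute)
  qed
  obtain \<eta> where eta: "\<eta> > 0" "\<And>v' j. (\<And>j. j < k \<Longrightarrow> norm (v' j - v j) < \<eta>) \<Longrightarrow> j < k \<Longrightarrow> v' j \<in> V"
    "\<And>v'. (\<And>j. j < k \<Longrightarrow> norm (v' j - v j) < \<eta>) \<Longrightarrow> image_dim (vec.span (v' ` {..<k})) = generic_dim k"
    using generic_open[of k v, OF v(1,3)] by blast
  define R' where "R' = (\<Sum>j<k. norm (v j))"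
  have R': "norm (v j) \<le> R'" if "j < k" for j
    unfolding R'_def by (rule member_le_sum) (use that in auto)
  obtain \<delta>' where d': "\<delta>' > 0" "\<And>a' b. (\<And>i. i \<in> {..<2} \<Longrightarrow> norm (a' i - q i) < \<delta>') \<Longrightarrow> norm b \<le> R' \<Longrightarrow>
      (\<And>i. i \<in> {..<2} \<Longrightarrow> herm \<sigma> (q i) b = 0) \<Longrightarrow> \<exists>b'. norm (b' - b) < \<eta> \<and> (\<forall>i\<in>{..<2}. herm \<sigma> (a' i) b' = 0)"
    using orthogonal_perturbation[OF nz finite_lessThan qi eta(1), of R'] by blast
  obtain w where w: "\<And>j. j < 2 \<Longrightarrow> w j \<in> V" "\<And>j. j < 2 \<Longrightarrow> norm (w j - q j) < \<delta>'"
    "image_dim (vec.span (w ` {..<2})) = generic_dim 2"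
    using generic_dense[of 2 q \<delta>', OF _ qV d'(1)] by auto
  have "\<exists>b'. norm (b' - v j) < \<eta> \<and> (\<forall>i\<in>{..<2}. herm \<sigma> (w i) b' = 0)" if "j < k" for j
  proof (rule d'(2))
    show "herm \<sigma> (q i) (v j) = 0" if "i \<in> {..<2}" for i
      using q(2)[OF _ \<open>j < k\<close>, of i] that herm_commute_zero by blast
  qed (use w(2) R'[OF that] in auto)
  then obtain v' where v': "\<And>j. j < k \<Longrightarrow> norm (v' j - v j) < \<eta>" "\<And>j i. j < k \<Longrightarrow> i < 2 \<Longrightarrow> herm \<sigma> (w i) (v' j) = 0"
    by (metis lessThan_iff)
  have v'V: "v' j \<in> V" if "j < k" for j by (rule eta(2)[of v', OF v'(1) that])
  have v'g: "image_dim (vec.span (v' ` {..<k})) = generic_dim k" by (rule eta(3)[OF v'(1)])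
  have v'w: "herm \<sigma> (v' j) (w i) = 0" if "j < k" "i < 2" for i j
    using v'(2)[OF that] herm_commute_zero by blast
  let ?H1 = "{x \<in> UNIV. herm \<sigma> x (w 0) = 0}"
  let ?H2 = "{x \<in> ?H1. herm \<sigma> x (w 1) = 0}"
  have H1: "vec.subspace ?H1" by (rule subspace_orth[OF vec.subspace_UNIV])
  have "image_dim UNIV \<le> image_dim ?H1 + 1"
    by (rule image_dim_hyperplane[of k v', OF k(1,3) v'V v'g vec.subspace_UNIV UNIV_I]) (use v'w in auto)
  moreover have "image_dim ?H1 \<le> image_dim ?H2 + 1"
    by (rule image_dim_hyperplane[of k v', OF k(1,3) v'V v'g H1]) (use v'w in auto)
  moreover have "image_dim (vec.span (w ` {..<2})) + image_dim ?H2 \<le> image_dim UNIV"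
  proof (rule image_dim_orth)
    fix z x assume z: "z \<in> vec.span (w ` {..<2})" and x: "x \<in> ?H2"
    show "herm \<sigma> z x = 0"
    proof (rule herm_span_zero[OF _ z vec.span_base[of x "{x}"]])
      fix z' x' assume "z' \<in> w ` {..<2}" "x' \<in> {x}"
      then show "herm \<sigma> z' x' = 0" using x by (auto simp: less_2_cases_iff herm_commute_zero[of \<sigma> _ x])
    qed simp
  qed
  ultimately show ?thesis using w(3) by linarith
qed

lemma line_image:
  assumes "z \<in> V" "w \<in> V"
  shows "vec.dim (f ` (vec.span {z, w} \<inter> V)) \<le> 2"
proof -
  let ?v = "\<lambda>j::nat. if j = 0 then z else w"
  have "?v ` {..<2} = {z, w}" by (auto simp: less_2_cases_iff image_iff intro: exI[of _ 1])
  moreover have "?v j \<in> V" for j using assms by simp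
  then have "image_dim (vec.span (?v ` {..<2})) \<le> generic_dim 2" by (rule generic_dim_ge)
  ultimately show ?thesis using generic_dim_2 by (simp only: image_dim_def)
qed

end

section \<open>Maps of lines to lines are linear\<close>

lemma closed_complex_subspace:
  fixes Y :: "(complex^'n::finite) set"
  assumes "vec.subspace Y"
  shows "closed Y"
proof -
  have "r *\<^sub>R x \<in> Y" if "x \<in> Y" for r x
  proof -
    have "r *\<^sub>R x = of_real r *s x" unfolding vec_eq_iff by simp (simp add: scaleR_conv_of_real)
    then show ?thesis using that assms by (simp add: vec.subspace_scale)
  qed
  then have "subspace Y" using assms unfolding subspace_def vec.subspace_def by blast
  then show ?thesis by (rule closed_subspace)
qed

lemma small_scalar:
  fixes x :: "complex^'n::finite"
  assumes "\<epsilon> > 0"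
  obtains t :: real where "t > 0" "norm (complex_of_real t *s x) < \<epsilon>"
proof -
  have n: "0 < norm x + 1" by (rule add_nonneg_pos) auto
  show ?thesis
  proof (rule that[of "\<epsilon> / (norm x + 1)"])
    show "\<epsilon> / (norm x + 1) > 0" using assms n by simp
    have "norm (complex_of_real (\<epsilon> / (norm x + 1)) *s x) = \<epsilon> / (norm x + 1) * norm x"
      unfolding norm_vector_scaleC norm_of_real using assms n by simp
    also have "\<dots> < \<epsilon> / (norm x + 1) * (norm x + 1)" using assms n by (intro mult_strict_left_mono) auto
    also have "\<dots> = \<epsilon>" using n by simp
    finally show "norm (complex_of_real (\<epsilon> / (norm x + 1)) *s x) < \<epsilon>" .
  qed
qed

lemma subspace_scale_cancel:
  assumes "vec.subspace Y" "c *s x \<in> Y" "c \<noteq> (0::complex)"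
  shows "x \<in> (Y :: (complex^'n::finite) set)"
proof -
  have "(1 / c) *s (c *s x) \<in> Y" using assms(1,2) by (rule vec.subspace_scale)
  then show ?thesis using assms(3) by simp
qed

lemma open_avoids_subspace:
  fixes S :: "(complex^'n::finite) set"
  assumes "open \<Omega>" "z0 \<in> \<Omega>" and S: "vec.subspace S" "S \<noteq> UNIV"
  obtains z where "z \<in> \<Omega>" "z \<notin> S"
proof (cases "z0 \<in> S")
  case False
  then show ?thesis using that assms by blast
next
  case True
  obtain x where x: "x \<notin> S" using S by blast
  obtain r where r: "r > 0" "ball z0 r \<subseteq> \<Omega>" using assms open_contains_ball by blast
  obtain t :: real where t: "t > 0" "norm (complex_of_real t *s x) < r" using small_scalar[OF r(1)] by blast
  have "z0 + complex_of_real t *s x \<in> \<Omega>" using r(2) t(2) ball_add by blast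
  moreover have "z0 + complex_of_real t *s x \<notin> S"
  proof
    assume "z0 + complex_of_real t *s x \<in> S"
    then have "(z0 + complex_of_real t *s x) - z0 \<in> S" using True S(1) vec.subspace_diff by blast
    then have "complex_of_real t *s x \<in> S" by simp
    then show False using subspace_scale_cancel[OF S(1)] x t(1) by auto
  qed
  ultimately show ?thesis by (rule that)
qed

text \<open>Modulo \<open>Y\<close> every vector of an open set is an eigenvector, and codimension
  two provides directions independent of a given \<open>z\<close> modulo \<open>Y\<close>. Comparing
  the eigenvalues at \<open>z + v'\<close>, \<open>z - v'\<close> and \<open>z\<close> shows that
  they agree. A plane \<open>Y\<close> serves to compare two base points, and \<open>Y = {0}\<close>
  to obtain conformality.\<close>

lemma eigen_modulo:
  fixes G :: "complex^'n::finite \<Rightarrow> complex^'n"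
  assumes G: "Vector_Spaces.linear (*s) (*s) G" and \<Omega>: "open \<Omega>" "\<Omega> \<noteq> {}"
    and Y: "vec.subspace Y" "vec.dim Y + 2 \<le> CARD('n)"
    and ev: "\<And>z. z \<in> \<Omega> \<Longrightarrow> \<exists>\<mu>. G z - \<mu> *s z \<in> Y"
  shows "\<exists>\<mu>. \<forall>z. G z - \<mu> *s z \<in> Y"
proof -
  interpret G: Vector_Spaces.linear "(*s)" "(*s)" G by (rule G)
  have full: "vec.dim (UNIV :: (complex^'n) set) = CARD('n)" by (simp add: vec.dimension_def card_cart_basis)
  have YU: "Y \<noteq> UNIV" using Y(2) full by auto
  obtain z0 where "z0 \<in> \<Omega>" using \<Omega>(2) by blast
  then obtain z where z: "z \<in> \<Omega>" "z \<notin> Y" using open_avoids_subspace[OF \<Omega>(1) _ Y(1) YU] by blast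
  obtain r where r: "r > 0" "ball z r \<subseteq> \<Omega>" using \<Omega>(1) z(1) open_contains_ball by blast
  obtain \<mu> where mu: "G z - \<mu> *s z \<in> Y" using ev[OF z(1)] by blast
  let ?Y' = "vec.span (insert z Y)"
  have "vec.dim ?Y' \<le> vec.dim Y + 1" by (simp add: vec.dim_insert)
  then have Y'U: "?Y' \<noteq> UNIV" using Y(2) full by (metis Suc_eq_plus1 add_2_eq_Suc' not_less_eq_eq order_trans)
  have YY': "Y \<subseteq> ?Y'" "z \<in> ?Y'" using vec.span_base[of _ "insert z Y"] by auto
  have out: "G v - \<mu> *s v \<in> Y" if v: "v \<notin> ?Y'" for v
  proof -
    obtain t :: real where t: "t > 0" "norm (complex_of_real t *s v) < r" using small_scalar[OF r(1)] by blast
    define v' where "v' = complex_of_real t *s v"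
    have v'Y: "v' \<notin> ?Y'"
      using subspace_scale_cancel[OF vec.subspace_span, of "complex_of_real t" v "insert z Y"] v t(1) unfolding v'_def by auto
    have "z + v' \<in> \<Omega>" using r(2) t(2) ball_add[of z v' r] unfolding v'_def by blast
    then obtain \<mu>1 where m1: "G (z + v') - \<mu>1 *s (z + v') \<in> Y" using ev by blast
    have "z + (- v') \<in> \<Omega>" using r(2) t(2) ball_add[of z "- v'" r] unfolding v'_def by auto
    then obtain \<mu>2 where m2: "G (z + (- v')) - \<mu>2 *s (z + (- v')) \<in> Y" using ev by blast
    \<comment> \<open>The second difference removes \<open>G\<close> by linearity and leaves a
      relation between \<open>z\<close> and \<open>v'\<close> modulo \<open>Y\<close>.\<close>
    have "(G z - \<mu> *s z) + (G z - \<mu> *s z) - (G (z + v') - \<mu>1 *s (z + v')) - (G (z + (- v')) - \<mu>2 *s (z + (- v'))) \<in> Y"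
      by (rule vec.subspace_diff[OF Y(1) vec.subspace_diff[OF Y(1) vec.subspace_add[OF Y(1) mu mu] m1] m2])
    also have "(G z - \<mu> *s z) + (G z - \<mu> *s z) - (G (z + v') - \<mu>1 *s (z + v')) - (G (z + (- v')) - \<mu>2 *s (z + (- v')))
      = (\<mu>1 + \<mu>2 - 2 * \<mu>) *s z + (\<mu>1 - \<mu>2) *s v'"
      by (simp add: G.add G.neg G.diff vec_eq_iff algebra_simps)
    finally have comb: "(\<mu>1 + \<mu>2 - 2 * \<mu>) *s z + (\<mu>1 - \<mu>2) *s v' \<in> Y" .
    have eq: "\<mu>1 = \<mu>2"
    proof (rule ccontr)
      assume ne: "\<mu>1 \<noteq> \<mu>2"
      have "((\<mu>1 + \<mu>2 - 2 * \<mu>) *s z + (\<mu>1 - \<mu>2) *s v') - (\<mu>1 + \<mu>2 - 2 * \<mu>) *s z \<in> ?Y'"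
        using comb YY' by (intro vec.span_diff vec.span_scale) auto
      then have c: "(\<mu>1 - \<mu>2) *s v' \<in> ?Y'" by (simp only: add_diff_cancel_left')
      have "\<mu>1 - \<mu>2 \<noteq> 0" using ne by simp
      then show False using subspace_scale_cancel[OF vec.subspace_span c] v'Y by blast
    qed
    have "\<mu>1 = \<mu>"
    proof (rule ccontr)
      assume ne: "\<mu>1 \<noteq> \<mu>"
      have c: "(\<mu>1 + \<mu>2 - 2 * \<mu>) *s z \<in> Y" using comb unfolding eq by simp
      have "\<mu>1 + \<mu>2 - 2 * \<mu> \<noteq> 0" using ne unfolding eq by simp
      then show False using subspace_scale_cancel[OF Y(1) c] z(2) by blast
    qed
    then have "G (z + v') - \<mu> *s (z + v') \<in> Y" using m1 by simp
    from vec.subspace_diff[OF Y(1) this mu]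
    have "(G (z + v') - \<mu> *s (z + v')) - (G z - \<mu> *s z) \<in> Y" .
    also have "(G (z + v') - \<mu> *s (z + v')) - (G z - \<mu> *s z) = complex_of_real t *s (G v - \<mu> *s v)"
      unfolding v'_def G.add G.scale by (simp add: vec_eq_iff algebra_simps)
    finally have c: "complex_of_real t *s (G v - \<mu> *s v) \<in> Y" .
    show ?thesis by (rule subspace_scale_cancel[OF Y(1) c]) (use t(1) in simp)
  qed
  obtain w where w: "w \<notin> ?Y'" using Y'U by blast
  \<comment> \<open>A vector of \<open>?Y'\<close> is the difference of two vectors outside it,
    where the claim is known.\<close>
  have "G v - \<mu> *s v \<in> Y" for v
  proof (cases "v \<in> ?Y'")
    case True
    have vw: "v + w \<notin> ?Y'" using vec.span_diff[OF _ True, of "v + w"] w by auto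
    have "(G (v + w) - \<mu> *s (v + w)) - (G w - \<mu> *s w) \<in> Y"
      by (rule vec.subspace_diff[OF Y(1) out[OF vw] out[OF w]])
    also have "(G (v + w) - \<mu> *s (v + w)) - (G w - \<mu> *s w) = G v - \<mu> *s v"
      by (simp add: G.add vec_eq_iff algebra_simps)
    finally show ?thesis .
  qed (rule out)
  then show ?thesis by blast
qed

lemma injective_of_rank:
  fixes L :: "complex^'n::finite \<Rightarrow> complex^'m::finite"
  assumes L: "Vector_Spaces.linear (*s) (*s) L" and d: "CARD('n) \<le> vec.dim (range L)"
  shows "inj L"
proof -
  interpret L: Vector_Spaces.linear "(*s)" "(*s)" L by (rule L)
  have "x = 0" if Lx: "L x = 0" for x
  proof (rule ccontr)
    assume "x \<noteq> 0"
    then have ix: "vec.independent {x}" by simp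
    obtain B where B: "{x} \<subseteq> B" "B \<subseteq> UNIV" "vec.independent B" "UNIV \<subseteq> vec.span B"
      by (rule vec.maximal_independent_subset_extend[OF subset_UNIV ix], rule that)
    have fB: "finite B" using B(3) by (simp add: vec.finiteI_independent)
    have "card B = vec.dim (UNIV :: (complex^'n) set)" using B(2,4,3) by (rule vec.basis_card_eq_dim)
    then have cB: "card B = CARD('n)" by (simp add: vec.dimension_def card_cart_basis)
    have "range L \<subseteq> vec.span (L ` (B - {x}))"
    proof
      fix y assume "y \<in> range L"
      then obtain z where z: "y = L z" by blast
      have "z \<in> vec.span B" using B(4) by blast
      then have "L z \<in> vec.span (L ` (B - {x}))"
      proof (induction rule: vec.span_induct_alt)
        case base
        then show ?case by (simp add: L.zero vec.span_zero)
      next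
        case (step c v w)
        have "L v \<in> vec.span (L ` (B - {x}))"
        proof (cases "v = x")
          case True
          then show ?thesis using Lx by (simp add: vec.span_zero)
        next
          case False
          then show ?thesis using step(1) by (intro vec.span_base) blast
        qed
        then show ?case using step(2) by (simp add: L.add L.scale vec.span_add vec.span_scale)
      qed
      then show "y \<in> vec.span (L ` (B - {x}))" using z by simp
    qed
    then have "vec.dim (range L) \<le> card (L ` (B - {x}))" using fB by (intro vec.dim_le_card) auto
    also have "\<dots> \<le> card (B - {x})" using fB by (intro card_image_le) auto
    also have "\<dots> < card B" using fB B(1) by (intro psubset_card_mono) auto
    finally show False using d cB by simp
  qed
  then show ?thesis unfolding vec.linear_inj_iff_eq_0[OF L] by blast
qed

lemma range_dim_le: "Vector_Spaces.linear (*s) (*s) L \<Longrightarrow> vec.dim (range (L :: complex^'n::finite \<Rightarrow> complex^'m::finite)) \<le> CARD('n)"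
  using vec.dim_image_le[of L UNIV] by (simp add: vec.dimension_def card_cart_basis)

lemma herm_right_cancel:
  assumes nz: "\<forall>i. \<sigma> i \<noteq> 0" and "\<And>x. herm \<sigma> x u = herm \<sigma> x v"
  shows "u = v"
proof -
  have "u $ i = v $ i" for i
    using assms(2)[of "axis i 1"] nz unfolding herm_axis_left by simp
  then show ?thesis by (simp add: vec_eq_iff)
qed

text \<open>The double orthogonal of a line is the line: with \<open>z1\<close> normalised by
  \<open>herm \<sigma> z1 w = 1\<close>, subtracting a multiple of \<open>z1\<close> moves any
  \<open>z\<close> into the orthogonal complement of \<open>w\<close>.\<close>

lemma herm_double_orthogonal:
  assumes nz: "\<forall>i. \<sigma> i \<noteq> 0" and w: "w \<noteq> 0" and h: "\<And>z. herm \<sigma> z w = 0 \<Longrightarrow> herm \<sigma> z u = 0"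
  shows "\<exists>\<mu>. u = \<mu> *s w"
proof -
  obtain z0 where z0: "herm \<sigma> z0 w \<noteq> 0"
    using herm_right_cancel[OF nz, of w 0] w by (auto simp: herm_simps)
  define z1 where "z1 = (1 / herm \<sigma> z0 w) *s z0"
  have z1: "herm \<sigma> z1 w = 1" unfolding z1_def using z0 by (simp add: herm_simps)
  have "u = cnj (herm \<sigma> z1 u) *s w"
  proof (rule herm_right_cancel[OF nz])
    fix z
    have "herm \<sigma> (z - herm \<sigma> z w *s z1) u = 0" by (rule h) (simp add: herm_simps z1)
    then show "herm \<sigma> z u = herm \<sigma> z (cnj (herm \<sigma> z1 u) *s w)" by (simp add: herm_simps mult.commute)
  qed
  then show ?thesis by blast
qed

lemma span_pair: "x \<in> vec.span {a, b} \<longleftrightarrow> (\<exists>s t. x = s *s a + t *s (b :: complex^'n::finite))"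
proof
  assume "x \<in> vec.span {a, b}"
  then obtain s where "x - s *s a \<in> vec.span {b}" unfolding vec.span_breakdown_eq by blast
  then obtain t where "x - s *s a = t *s b" unfolding vec.span_singleton by blast
  then have "x = s *s a + t *s b" by (simp add: algebra_simps)
  then show "\<exists>s t. x = s *s a + t *s b" by blast
next
  assume "\<exists>s t. x = s *s a + t *s b"
  then obtain s t where "x = s *s a + t *s b" by blast
  then show "x \<in> vec.span {a, b}" by (simp add: vec.span_add vec.span_scale vec.span_base)
qed

lemma span_single: "x \<in> vec.span {a} \<longleftrightarrow> (\<exists>s. x = s *s (a :: complex^'n::finite))"
  unfolding vec.span_singleton by blast

section \<open>Reconstruction of the germ from its tangent directions\<close>

context orthogonal_germ
begin

lemma card_n: "4 \<le> CARD('n)"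
proof -
  obtain k where "0 < k" "k < m" "generic_dim (Suc k) \<le> generic_dim k + 1" by (rule small_growth)
  then show ?thesis using two_m by linarith
qed

text \<open>Difference quotients in the direction \<open>x\<close> with real steps lie in
  \<open>Y\<close>, and \<open>Y\<close> is closed.\<close>

lemma derivative_in_subspace:
  assumes z: "z \<in> V" and D: "(f has_derivative D) (at z)" and Y: "vec.subspace Y" "f z \<in> Y"
    and path: "\<And>t::real. z + complex_of_real t *s x \<in> V \<Longrightarrow> f (z + complex_of_real t *s x) \<in> Y"
  shows "D x \<in> Y"
proof -
  interpret D: bounded_linear D using D by (rule has_derivative_bounded_linear)
  have "D x \<in> closure Y"
    unfolding closure_approachable
  proof (intro allI impI)
    fix e :: real assume e: "e > 0"
    have n: "0 < norm x + 1" by (rule add_nonneg_pos) auto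
    define e' where "e' = e / (norm x + 1)"
    have e': "e' > 0" unfolding e'_def using e n by simp
    obtain d where d: "d > 0" "\<And>y. norm (y - z) < d \<Longrightarrow> norm (f y - f z - D (y - z)) \<le> e' * norm (y - z)"
      using D e' unfolding has_derivative_at_alt by blast
    obtain r where r: "r > 0" "ball z r \<subseteq> V" using z open_ball open_contains_ball by blast
    have dr: "min d r > 0" using d r by simp
    obtain t :: real where t: "t > 0" "norm (complex_of_real t *s x) < min d r" using small_scalar[OF dr] by blast
    define u where "u = complex_of_real t *s x"
    have uR: "u = t *\<^sub>R x" unfolding u_def vec_eq_iff by simp (simp add: scaleR_conv_of_real)
    have nu: "norm u < d" "norm u < r" using t(2) by (auto simp: u_def)
    have zu: "z + u \<in> V" using r(2) ball_add[of z u r] nu(2) by blast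
    have fY: "f (z + u) \<in> Y" unfolding u_def by (rule path) (use zu u_def in simp)
    let ?y = "complex_of_real (1 / t) *s (f (z + u) - f z)"
    have yR: "?y = (1 / t) *\<^sub>R (f (z + u) - f z)"
      unfolding vec_eq_iff by simp (simp add: scaleR_conv_of_real diff_divide_distrib)
    have "?y \<in> Y" using fY Y by (intro vec.subspace_scale vec.subspace_diff)
    moreover have "dist ?y (D x) < e"
    proof -
      have Du: "D u = t *\<^sub>R D x" unfolding uR by (rule D.scaleR)
      have "?y - D x = (1 / t) *\<^sub>R (f (z + u) - f z - D u)"
        unfolding yR Du using t(1) by (simp add: scaleR_diff_right[of _ "f (z + u) - f z"])
      then have "norm (?y - D x) = (1 / t) * norm (f (z + u) - f z - D u)" using t(1) by simp
      also have "\<dots> \<le> (1 / t) * (e' * norm u)"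
        using d(2)[of "z + u"] nu(1) t(1) by (intro mult_left_mono) auto
      also have "\<dots> = e' * norm x" unfolding uR using t(1) by simp
      also have "\<dots> < e' * (norm x + 1)" using e' by (intro mult_strict_left_mono) auto
      also have "\<dots> = e" unfolding e'_def using n by simp
      finally show ?thesis by (simp add: dist_norm)
    qed
    ultimately show "\<exists>y\<in>Y. dist y (D x) < e" by blast
  qed
  then show ?thesis using closed_complex_subspace[OF Y(1)] by simp
qed

text \<open>The values on the line through \<open>z\<close> and \<open>z + x\<close> span at most
  two dimensions, and both \<open>f z\<close> and \<open>D x\<close> lie in that span. Being
  independent they generate it.\<close>

lemma tangent_line:
  assumes z: "z \<in> V" and D: "(f has_derivative D) (at z)" and fz: "f z \<noteq> 0"
    and x: "D x \<notin> vec.span {f z}" and w: "z + x \<in> V"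
  shows "f (z + x) \<in> vec.span {f z, D x}"
proof -
  let ?P = "vec.span {z, z + x}"
  let ?Y = "vec.span (f ` (?P \<inter> V))"
  have zP: "z \<in> ?P" and wP: "z + x \<in> ?P" by (auto intro: vec.span_base)
  have xP: "x \<in> ?P" using vec.span_diff[OF wP zP] by simp
  have fzY: "f z \<in> ?Y" and fwY: "f (z + x) \<in> ?Y" using zP wP z w by (auto intro!: vec.span_base simp del: mem_ball)
  have DY: "D x \<in> ?Y"
  proof (rule derivative_in_subspace[OF z D vec.subspace_span fzY])
    fix t :: real assume V: "z + complex_of_real t *s x \<in> V"
    have "z + complex_of_real t *s x \<in> ?P" using zP xP by (intro vec.span_add vec.span_scale)
    then show "f (z + complex_of_real t *s x) \<in> ?Y" using V by (intro vec.span_base) blast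
  qed
  have dY: "vec.dim ?Y \<le> 2" using line_image[OF z w] by simp
  have "vec.dim {D x, f z} = 2" using x fz by (simp add: vec.dim_insert)
  then have "vec.span {D x, f z} = vec.span ?Y"
    using dY fzY DY by (intro vec.dim_eq_span) auto
  then have "vec.span {D x, f z} = ?Y" by (simp only: vec.span_span)
  then show ?thesis using fwY by (simp add: insert_commute)
qed

lemma image_rank_ge: "open W \<Longrightarrow> w \<in> W \<Longrightarrow> W \<subseteq> V \<Longrightarrow> vec.dim T \<le> vec.dim (f ` W)"
proof -
  assume W: "open W" "w \<in> W" "W \<subseteq> V"
  obtain r where r: "r > 0" "ball w r \<subseteq> W" using W open_contains_ball by blast
  have "w \<in> V" using W by blast
  then have "image_dim UNIV \<le> vec.dim (f ` (UNIV \<inter> V \<inter> ball w r))"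
    by (intro image_dim_local vec.subspace_UNIV UNIV_I r)
  also have "\<dots> \<le> vec.dim (f ` W)" using r(2) by (intro vec.dim_subset) blast
  finally show ?thesis by (simp add: image_dim_def)
qed

lemma image_span_open: "open W \<Longrightarrow> w \<in> W \<Longrightarrow> W \<subseteq> V \<Longrightarrow> vec.span (f ` W) = T"
  using image_rank_ge[of W w] by (intro vec.dim_eq_span) auto

text \<open>If the derivative were always parallel to the value, the quotients of the components of
  \<open>f\<close> would have derivative zero on a small ball where one component does not vanish.
  There \<open>f\<close> would take its values in a single line, against \<open>T_dim\<close> and
  \<open>card_n\<close>.\<close>

lemma moving_point:
  assumes W: "open W" "w \<in> W" "W \<subseteq> V"
  obtains z D x where "z \<in> W" "f z \<noteq> 0" "Vector_Spaces.linear (*s) (*s) D" "(f has_derivative D) (at z)"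
    "D x \<notin> vec.span {f z}"
proof (rule ccontr)
  note obtained = that
  assume neg: "\<not> thesis"
  have parallel: "D x \<in> vec.span {f z}"
    if "z \<in> W" "f z \<noteq> 0" "Vector_Spaces.linear (*s) (*s) D" "(f has_derivative D) (at z)" for z D x
    using obtained[OF that, of x] neg by blast
  obtain r0 where r0: "r0 > 0" "ball w r0 \<subseteq> W" using W open_contains_ball by blast
  have wV: "w \<in> V" using W by blast
  obtain z1 where z1: "z1 \<in> V" "norm (z1 - w) < r0" "f z1 \<noteq> 0" using nonzero_dense[OF wV r0(1)] by blast
  have z1W: "z1 \<in> W" using r0(2) z1(2) by (auto simp: dist_norm norm_minus_commute)
  obtain i where i: "f z1 $ i \<noteq> 0" using z1(3) by (auto simp: vec_eq_iff)
  obtain r1 where r1: "r1 > 0" "ball z1 r1 \<subseteq> W" using W(1) z1W open_contains_ball by blast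
  have "isCont (\<lambda>z. f z $ i) z1" using isCont[OF z1(1)] by (rule continuous_component)
  then obtain r2 where r2: "r2 > 0" "\<And>z. dist z z1 < r2 \<Longrightarrow> dist (f z $ i) (f z1 $ i) < norm (f z1 $ i)"
    unfolding continuous_at_eps_delta using i by (metis zero_less_norm_iff)
  define B where "B = ball z1 (min r1 r2)"
  have B: "open B" "convex B" "z1 \<in> B" "B \<subseteq> W" "B \<subseteq> V"
    unfolding B_def using r1 r2 W(3) by (auto simp: subset_eq)
  have fi: "f z $ i \<noteq> 0" if "z \<in> B" for z
    using r2(2)[of z] that unfolding B_def by (auto simp: dist_commute dist_norm)
  have const: "f z $ j / f z $ i = f z1 $ j / f z1 $ i" if z: "z \<in> B" for z j
  proof -
    have "((\<lambda>z. f z $ j / f z $ i) has_derivative (\<lambda>h. 0)) (at y within B)" if y: "y \<in> B" for y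
    proof -
      have yV: "y \<in> V" using y B by blast
      obtain D where D: "Vector_Spaces.linear (*s) (*s) D" "(f has_derivative D) (at y)"
        using derivative[OF yV] by blast
      have fy: "f y \<noteq> 0" using fi[OF y] by auto
      have yW: "y \<in> W" using y B by blast
      have d: "((\<lambda>z. f z $ l) has_derivative (\<lambda>h. D h $ l)) (at y within B)" for l
        by (rule bounded_linear.has_derivative[OF bounded_linear_vec_nth has_derivative_at_withinI[OF D(2)]])
      have "((\<lambda>z. f z $ j / f z $ i) has_derivative
          (\<lambda>h. (D h $ j * f y $ i - f y $ j * D h $ i) / (f y $ i * f y $ i))) (at y within B)"
        by (rule has_derivative_divide'[OF d d fi[OF y]])
      moreover have "(\<lambda>h. (D h $ j * f y $ i - f y $ j * D h $ i) / (f y $ i * f y $ i)) = (\<lambda>h. 0)"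
      proof
        fix h
        obtain c where "D h = c *s f y" using parallel[OF yW fy D, of h] unfolding span_single by blast
        then show "(D h $ j * f y $ i - f y $ j * D h $ i) / (f y $ i * f y $ i) = 0" by simp
      qed
      ultimately show ?thesis by simp
    qed
    then obtain c where "\<And>y. y \<in> B \<Longrightarrow> f y $ j / f y $ i = c"
      using has_derivative_zero_constant[OF B(2), of "\<lambda>z. f z $ j / f z $ i"] by blast
    then show ?thesis using z B(3) by simp
  qed
  have "f ` B \<subseteq> vec.span {f z1}"
  proof
    fix y assume "y \<in> f ` B"
    then obtain z where z: "z \<in> B" "y = f z" by blast
    have "y = (f z $ i / f z1 $ i) *s f z1"
      using const[OF z(1)] fi[OF z(1)] i z(2) by (simp add: vec_eq_iff field_simps)
    then show "y \<in> vec.span {f z1}" by (simp add: vec.span_scale vec.span_base)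
  qed
  then have "vec.dim (f ` B) \<le> card {f z1}" by (rule vec.dim_le_card) simp
  moreover have "vec.dim T \<le> vec.dim (f ` B)" by (rule image_rank_ge[OF B(1,3,5)])
  ultimately show False using T_dim card_n by simp
qed

lemma span_T_eq:
  fixes L :: "complex^'n \<Rightarrow> complex^'m"
  assumes L: "Vector_Spaces.linear (*s) (*s) L" and sub: "T \<subseteq> range L"
  shows "inj L" "range L = T"
proof -
  interpret L: Vector_Spaces.linear "(*s)" "(*s)" L by (rule L)
  have "vec.dim T \<le> vec.dim (range L)" using sub by (rule vec.dim_subset)
  then show "inj L" using injective_of_rank[OF L] T_dim by linarith
  have r: "vec.subspace (range L)" by (rule L.subspace_image) (rule vec.subspace_UNIV)
  have "vec.dim (range L) \<le> vec.dim T" using range_dim_le[OF L] T_dim by linarith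
  then show "range L = T" using vec.subspace_dim_equal[OF vec.subspace_span r sub] by simp
qed

text \<open>Outside \<open>Bad\<close>, \<open>tangent_line\<close> gives the claim with the
  derivative at \<open>z0\<close> in the role of \<open>L\<close>. This already yields
  \<open>T \<subseteq> range L\<close>, so \<open>L\<close> is injective; then \<open>Bad\<close>
  consists of multiples of \<open>z0\<close>, where homogeneity gives the claim.\<close>

lemma projection_linear:
  assumes W: "open W" "w \<in> W" "W \<subseteq> V"
  shows "\<exists>z0 L. z0 \<in> W \<and> Vector_Spaces.linear (*s) (*s) L \<and> T \<subseteq> range L \<and> L z0 = f z0 \<and> f z0 \<noteq> 0 \<and>
    (\<forall>z\<in>V. f z \<in> vec.span {L z0, L z})"
proof -
  obtain z0 D x0 where z0: "z0 \<in> W" "f z0 \<noteq> 0" and D: "Vector_Spaces.linear (*s) (*s) D" "(f has_derivative D) (at z0)"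
    and x0: "D x0 \<notin> vec.span {f z0}"
    by (rule moving_point[OF W], rule that)
  interpret D: Vector_Spaces.linear "(*s)" "(*s)" D by (rule D(1))
  have z0V: "z0 \<in> V" using z0 W by blast
  have "D z0 \<in> vec.span {f z0}"
  proof (rule derivative_in_subspace[OF z0V D(2) vec.subspace_span vec.span_base[OF singletonI]])
    fix t :: real assume V: "z0 + complex_of_real t *s z0 \<in> V"
    have e: "z0 + complex_of_real t *s z0 = (1 + complex_of_real t) *s z0" by (simp add: vec_eq_iff algebra_simps)
    obtain k where "f (z0 + complex_of_real t *s z0) = k *s f z0" using homog[OF z0V, of "1 + complex_of_real t"] V unfolding e by blast
    then show "f (z0 + complex_of_real t *s z0) \<in> vec.span {f z0}" unfolding span_single by blast
  qed
  then obtain \<mu> where mu: "D z0 = \<mu> *s f z0" unfolding span_single by blast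
  have "z0 \<noteq> 0" using z0V zero_notin by auto
  then obtain i where i: "z0 $ i \<noteq> 0" by (auto simp: vec_eq_iff)
  \<comment> \<open>The lift need not be homogeneous of degree one, so \<open>D z0\<close> is only
    some multiple of \<open>f z0\<close>. The added term normalises \<open>L z0 = f z0\<close> and
    is invisible modulo \<open>f z0\<close>; coordinate \<open>i\<close> acts as a functional that
    is nonzero at \<open>z0\<close>.\<close>
  define L where "L x = D x + ((1 - \<mu>) * (x $ i / z0 $ i)) *s f z0" for x
  have L: "Vector_Spaces.linear (*s) (*s) L"
    by (rule clinearI) (simp_all add: L_def D.add D.scale vec_eq_iff field_simps i)
  interpret L: Vector_Spaces.linear "(*s)" "(*s)" L by (rule L)
  have Lz0: "L z0 = f z0" unfolding L_def mu using i by (simp add: vec_eq_iff algebra_simps)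
  define Bad where "Bad = {z. L z \<in> vec.span {f z0}}"
  have Bad: "vec.subspace Bad"
    unfolding Bad_def vec.subspace_def by (auto simp: L.zero L.add L.scale vec.span_zero vec.span_add vec.span_scale)
  have DL: "D (z - z0) \<in> vec.span {f z0} \<longleftrightarrow> z \<in> Bad" "D (z - z0) \<in> vec.span {f z0, L z}" for z
  proof -
    have e: "D (z - z0) = L z + (- ((1 - \<mu>) * (z $ i / z0 $ i)) - \<mu>) *s f z0"
      unfolding L_def D.diff mu by (simp add: vec_eq_iff algebra_simps)
    have s: "c *s f z0 \<in> vec.span {f z0}" for c by (intro vec.span_scale vec.span_base) simp
    show "D (z - z0) \<in> vec.span {f z0} \<longleftrightarrow> z \<in> Bad"
      unfolding Bad_def mem_Collect_eq e using vec.span_add_eq2[OF s] by blast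
    show "D (z - z0) \<in> vec.span {f z0, L z}"
      unfolding e by (intro vec.span_add vec.span_scale vec.span_base) auto
  qed
  have good: "f z \<in> vec.span {f z0, L z}" if z: "z \<in> V" "z \<notin> Bad" for z
  proof -
    have "f (z0 + (z - z0)) \<in> vec.span {f z0, D (z - z0)}"
      by (rule tangent_line[OF z0V D(2) z0(2)]) (use DL(1) z in auto)
    then have "f z \<in> vec.span {f z0, D (z - z0)}" by simp
    also have "\<dots> \<subseteq> vec.span {f z0, L z}"
      by (rule vec.span_minimal[OF _ vec.subspace_span]) (use DL(2)[of z] in \<open>auto intro: vec.span_base\<close>)
    finally show ?thesis .
  qed
  have BadU: "Bad \<noteq> UNIV"
  proof
    assume "Bad = UNIV"
    then have "x0 + z0 \<in> Bad" by simp
    then show False using DL(1)[of "x0 + z0"] x0 by simp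
  qed
  have oG: "open (V - Bad)" by (intro open_Diff open_ball closed_complex_subspace Bad)
  obtain z1 where z1: "z1 \<in> V" "z1 \<notin> Bad" by (rule open_avoids_subspace[OF open_ball z0V Bad BadU], rule that)
  have "f ` (V - Bad) \<subseteq> range L"
  proof
    fix y assume "y \<in> f ` (V - Bad)"
    then obtain z where z: "z \<in> V" "z \<notin> Bad" "y = f z" by blast
    then obtain s t where "y = s *s f z0 + t *s L z" using good[OF z(1,2)] unfolding span_pair by blast
    then have "y = L (s *s z0 + t *s z)" by (simp add: L.add L.scale Lz0)
    then show "y \<in> range L" by blast
  qed
  moreover have "vec.subspace (range L)" by (rule L.subspace_image) (rule vec.subspace_UNIV)
  ultimately have "vec.span (f ` (V - Bad)) \<subseteq> range L" by (rule vec.span_minimal)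
  moreover have "vec.span (f ` (V - Bad)) = T"
    by (rule image_span_open[OF oG, of z1]) (use z1 in auto)
  ultimately have TL: "T \<subseteq> range L" by simp
  have all: "f z \<in> vec.span {L z0, L z}" if z: "z \<in> V" for z
  proof (cases "z \<in> Bad")
    case False
    then show ?thesis using good[OF z] Lz0 by simp
  next
    case True
    then obtain s where "L z = s *s L z0" unfolding Bad_def span_single Lz0 by blast
    then have "L z = L (s *s z0)" by (simp add: L.scale)
    then have "z = s *s z0" using span_T_eq(1)[OF L TL] by (meson injD)
    then obtain k where "f z = k *s f z0" using homog[OF z0V, of s] z by blast
    then have "f z = k *s L z0 + 0 *s L z" by (simp add: Lz0)
    then show ?thesis unfolding span_pair by blast
  qed
  show ?thesis using z0 L TL Lz0 all by blast
qed

text \<open>Two base points with independent values confine \<open>f z\<close> to the span of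
  \<open>L0 z0, L0 z\<close> and to that of \<open>L1 z1, L1 z\<close>. Transported to the source by
  \<open>L0\<close>, the comparison map \<open>G\<close> is a scalar modulo the plane
  \<open>?Y\<close> through \<open>z0\<close> and \<open>y1\<close>. Splitting off its
  \<open>y1\<close> part yields \<open>L'\<close>, which agrees with \<open>G\<close> modulo
  \<open>y1\<close> and with a multiple of the identity modulo \<open>z0\<close>; hence
  \<open>L0 (L' z)\<close> lies in both spans and carries \<open>f z\<close> for \<open>z\<close>
  outside \<open>?Y\<close>.\<close>

lemma linear_germ:
  "\<exists>L. Vector_Spaces.linear (*s) (*s) L \<and> inj L \<and> range L = T \<and> (\<forall>z\<in>V. f z \<in> vec.span {L z})"
proof -
  have oS: "open {z \<in> V. f z \<notin> vec.span {y}}" for y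
  proof -
    have "continuous_on V f" using isCont by (simp add: continuous_at_imp_continuous_on)
    then have "open (V \<inter> f -` (- vec.span {y}))"
      by (rule continuous_open_preimage[OF _ open_ball open_Compl[OF closed_complex_subspace[OF vec.subspace_span]]])
    moreover have "V \<inter> f -` (- vec.span {y}) = {z \<in> V. f z \<notin> vec.span {y}}" by auto
    ultimately show ?thesis by simp
  qed
  have neS: "\<exists>z\<in>V. f z \<notin> vec.span {y}" for y
  proof (rule ccontr)
    assume "\<not> ?thesis"
    then have "f ` V \<subseteq> vec.span {y}" by blast
    then have "vec.dim (f ` V) \<le> card {y}" by (rule vec.dim_le_card) simp
    then show False using T_dim card_n by simp
  qed
  obtain z0 L0 where L0: "z0 \<in> V" "Vector_Spaces.linear (*s) (*s) L0" "T \<subseteq> range L0" "L0 z0 = f z0" "f z0 \<noteq> 0"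
    "\<forall>z\<in>V. f z \<in> vec.span {L0 z0, L0 z}"
    using projection_linear[OF open_ball pV order_refl] by (elim exE conjE)
  obtain w1 where w1: "w1 \<in> {z \<in> V. f z \<notin> vec.span {f z0}}" using neS by blast
  have sub1: "{z \<in> V. f z \<notin> vec.span {f z0}} \<subseteq> V" by blast
  obtain z1 L1 where L1: "z1 \<in> {z \<in> V. f z \<notin> vec.span {f z0}}" "Vector_Spaces.linear (*s) (*s) L1" "T \<subseteq> range L1" "L1 z1 = f z1"
    "f z1 \<noteq> 0" "\<forall>z\<in>V. f z \<in> vec.span {L1 z1, L1 z}"
    using projection_linear[OF oS w1 sub1] by (elim exE conjE)
  have z1: "z1 \<in> V" "f z1 \<notin> vec.span {f z0}" using L1(1) by auto
  interpret L0: Vector_Spaces.linear "(*s)" "(*s)" L0 by (rule L0(2))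
  interpret L1: Vector_Spaces.linear "(*s)" "(*s)" L1 by (rule L1(2))
  note inj0 = span_T_eq[OF L0(2,3)] and inj1 = span_T_eq[OF L1(2,3)]
  obtain g where g: "Vector_Spaces.linear (*s) (*s) g" "g \<circ> L0 = id"
    using vec.linear_injective_left_inverse[OF L0(2) inj0(1)] by (elim exE conjE)
  interpret g: Vector_Spaces.linear "(*s)" "(*s)" g by (rule g(1))
  define G where "G = g \<circ> L1"
  have G: "Vector_Spaces.linear (*s) (*s) G"
    by (rule clinearI) (simp_all add: G_def L1.add L1.scale g.add g.scale)
  interpret G: Vector_Spaces.linear "(*s)" "(*s)" G by (rule G)
  have gL0: "g (L0 x) = x" for x using g(2) by (metis comp_apply id_apply)
  have L0G: "L0 (G x) = L1 x" for x
  proof -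
    have "L1 x \<in> range L0" using inj0(2) inj1(2) by blast
    then obtain y where "L1 x = L0 y" by blast
    then show ?thesis by (simp add: G_def gL0)
  qed
  have L0inj: "x = y" if "L0 x = L0 y" for x y using that inj0(1) by (meson injD)
  define y1 where "y1 = G z1"
  have fz1: "f z1 = L0 y1" unfolding y1_def L0G L1(4) ..
  have y1: "\<nexists>s. y1 = s *s z0"
  proof
    assume "\<exists>s. y1 = s *s z0"
    then obtain s where "y1 = s *s z0" by blast
    then have "f z1 = s *s f z0" using fz1 L0(4) by (simp add: L0.scale)
    then show False using z1(2) unfolding span_single by blast
  qed
  have z0n: "z0 \<noteq> 0" using L0(4,5) by (auto simp: L0.zero)
  let ?Y = "vec.span {z0, y1}"
  have dY: "vec.dim ?Y \<le> 2" using vec.dim_le_card'[of "{z0, y1}"] by (simp add: card_insert_if split: if_splits)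
  have Y4: "vec.dim ?Y + 2 \<le> CARD('n)" using dY card_n by linarith
  have x0: "\<exists>s t. f z = L0 (s *s z0 + t *s z)" if "z \<in> V" for z
    using L0(6)[rule_format, OF that] unfolding span_pair by (auto simp: L0.add L0.scale)
  have x1: "\<exists>s t. f z = L0 (s *s y1 + t *s G z)" if zV: "z \<in> V" for z
  proof -
    obtain s t where "f z = s *s L1 z1 + t *s L1 z" using L1(6)[rule_format, OF zV] unfolding span_pair by blast
    then have "f z = L0 (s *s y1 + t *s G z)" by (simp add: L0.add L0.scale L0G y1_def)
    then show ?thesis by blast
  qed
  \<comment> \<open>Points with value parallel to \<open>f z1\<close> are excluded because there the
    coefficient \<open>t'\<close> of \<open>G z\<close> may vanish.\<close>
  let ?\<Omega> = "{z \<in> V. f z \<notin> vec.span {f z1}}"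
  have ev: "\<exists>\<mu>. G z - \<mu> *s z \<in> ?Y" if z: "z \<in> ?\<Omega>" for z
  proof -
    have zV: "z \<in> V" using z by blast
    obtain s t where 0: "f z = L0 (s *s z0 + t *s z)" using x0[OF zV] by blast
    obtain s' t' where 1: "f z = L0 (s' *s y1 + t' *s G z)" using x1[OF zV] by blast
    have eq: "s *s z0 + t *s z = s' *s y1 + t' *s G z" using 0 1 by (intro L0inj) simp
    have "t' \<noteq> 0"
    proof
      assume "t' = 0"
      then have "f z = s' *s f z1" using 1 fz1 by (simp add: L0.scale)
      then show False using z unfolding span_single by blast
    qed
    have "t' *s (G z - (t / t') *s z) = s *s z0 + (- s') *s y1"
      using eq \<open>t' \<noteq> 0\<close> by (simp add: vec_eq_iff algebra_simps)
    also have "\<dots> \<in> ?Y" unfolding span_pair by blast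
    finally have "G z - (t / t') *s z \<in> ?Y" using subspace_scale_cancel[OF vec.subspace_span] \<open>t' \<noteq> 0\<close> by blast
    then show ?thesis by blast
  qed
  have "?\<Omega> \<noteq> {}" using neS by blast
  then obtain \<mu> where mu: "\<And>z. G z - \<mu> *s z \<in> ?Y"
    using eigen_modulo[OF G oS _ vec.subspace_span Y4 ev] by blast
  have Ginj: "inj G"
  proof (rule injI)
    fix x y assume "G x = G y"
    then have "L1 x = L1 y" using L0G by metis
    then show "x = y" using inj1(1) by (meson injD)
  qed
  have mun: "\<mu> \<noteq> 0"
  proof
    assume "\<mu> = 0"
    then have "range G \<subseteq> ?Y" using mu by auto
    moreover have "surj G" using G Ginj by (rule vec.linear_inj_imp_surj)
    ultimately have "vec.dim (UNIV :: (complex^'n) set) \<le> vec.dim ?Y" by (intro vec.dim_subset) simp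
    then show False using dY card_n by (simp add: vec.dimension_def card_cart_basis)
  qed
  \<comment> \<open>A functional that vanishes at \<open>z0\<close> and is 1 at \<open>y1\<close>
    reads off the \<open>y1\<close> coefficient of vectors in \<open>?Y\<close>.\<close>
  have "\<exists>c. herm \<sigma> z0 c = 0 \<and> herm \<sigma> y1 c = 1"
  proof -
    let ?a = "\<lambda>b::bool. if b then y1 else z0"
    have a: "?a ` UNIV = {y1, z0}" by (auto simp: image_iff UNIV_bool)
    have yz: "y1 \<notin> vec.span {z0}" using y1 unfolding span_single by blast
    have "vec.independent {y1, z0}"
      using z0n yz by (intro vec.independent_insertI) (auto simp: vec.independent_empty)
    moreover have "inj_on ?a UNIV" using y1[unfolded not_ex, rule_format, of 1] by (auto simp: inj_on_def)
    ultimately obtain c where "\<And>i j. i \<in> UNIV \<Longrightarrow> j \<in> UNIV \<Longrightarrow> herm \<sigma> (?a j) (c i) = (if i = j then 1 else 0)"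
      using dual_tuple[OF nz, of ?a UNIV] unfolding a by blast
    from this[of True False] this[of True True] show ?thesis by auto
  qed
  then obtain c where c: "herm \<sigma> z0 c = 0" "herm \<sigma> y1 c = 1" by blast
  define \<omega> where "\<omega> x = herm \<sigma> (G x - \<mu> *s x) c" for x
  define L' where "L' x = G x - \<omega> x *s y1" for x
  have L'0: "\<exists>a. L' x = \<mu> *s x + a *s z0" for x
  proof -
    obtain s t where st: "G x - \<mu> *s x = s *s z0 + t *s y1" using mu[of x] unfolding span_pair by blast
    have "\<omega> x = t" unfolding \<omega>_def st by (simp add: herm_simps c)
    moreover have "G x = \<mu> *s x + s *s z0 + t *s y1" using st by (simp add: algebra_simps)
    ultimately have "L' x = \<mu> *s x + s *s z0" by (simp add: L'_def)
    then show ?thesis by blast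
  qed
  define L where "L x = L0 (L' x)" for x
  have L'lin: "L' (x + y) = L' x + L' y" "L' (k *s x) = k *s L' x" for x y k
    unfolding L'_def \<omega>_def by (simp_all add: G.add G.scale herm_simps vec_eq_iff algebra_simps)
  have L: "Vector_Spaces.linear (*s) (*s) L"
    by (rule clinearI) (simp_all add: L_def L'lin L0.add L0.scale)
  interpret L: Vector_Spaces.linear "(*s)" "(*s)" L by (rule L)
  have good: "f z \<in> vec.span {L z}" if z: "z \<in> V" "z \<notin> ?Y" for z
  proof -
    obtain a where a: "L' z = \<mu> *s z + a *s z0" using L'0 by blast
    obtain s t where 0: "f z = L0 (s *s z0 + t *s z)" using x0[OF z(1)] by blast
    obtain s' t' where 1: "f z = L0 (s' *s y1 + t' *s G z)" using x1[OF z(1)] by blast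
    have eq: "s *s z0 + t *s z = s' *s y1 + t' *s G z" using 0 1 by (intro L0inj) simp
    have Gz: "G z = L' z + \<omega> z *s y1" by (simp add: L'_def)
    \<comment> \<open>Both expressions for \<open>f z\<close> are compared in terms of
      \<open>z\<close>, \<open>z0\<close> and \<open>y1\<close>. For \<open>z\<close> outside
      \<open>?Y\<close> the coefficients of \<open>z\<close> must agree, and then the
      \<open>y1\<close> coefficient vanishes because \<open>y1\<close> is not a multiple of
      \<open>z0\<close>.\<close>
    have comb: "(t - t' * \<mu>) *s z = (t' * a - s) *s z0 + (s' + t' * \<omega> z) *s y1"
      using eq unfolding Gz a by (simp add: vec_eq_iff algebra_simps)
    have tt: "t = t' * \<mu>"
    proof (rule ccontr)
      assume "t \<noteq> t' * \<mu>"
      then have ne: "t - t' * \<mu> \<noteq> 0" by simp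
      have "(t - t' * \<mu>) *s z \<in> ?Y" unfolding comb span_pair by blast
      then show False using subspace_scale_cancel[OF vec.subspace_span _ ne] z(2) by blast
    qed
    have sy: "s' + t' * \<omega> z = 0"
    proof (rule ccontr)
      assume ne: "s' + t' * \<omega> z \<noteq> 0"
      have "(s' + t' * \<omega> z) *s y1 = (s - t' * a) *s z0"
        using comb tt by (simp add: vec_eq_iff algebra_simps)
      then have "y1 = ((s - t' * a) / (s' + t' * \<omega> z)) *s z0"
        using ne by (simp add: vec_eq_iff field_simps)
      then show False using y1 by blast
    qed
    have "s' *s y1 + t' *s G z = (s' + t' * \<omega> z) *s y1 + t' *s L' z"
      unfolding Gz by (simp add: vec_eq_iff algebra_simps)
    also have "\<dots> = t' *s L' z" using sy by simp
    finally have "f z = t' *s L z" using 1 by (simp add: L_def L0.scale)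
    then show ?thesis unfolding span_single by blast
  qed
  have YU: "?Y \<noteq> UNIV"
  proof
    assume "?Y = UNIV"
    then have "vec.dim (UNIV :: (complex^'n) set) \<le> 2" using dY by metis
    then show False using card_n by (simp add: vec.dimension_def card_cart_basis)
  qed
  have oG: "open (V - ?Y)" by (intro open_Diff open_ball closed_complex_subspace vec.subspace_span)
  obtain w where w: "w \<in> V" "w \<notin> ?Y" by (rule open_avoids_subspace[OF open_ball pV vec.subspace_span YU], rule that)
  have "f ` (V - ?Y) \<subseteq> range L"
  proof
    fix y assume "y \<in> f ` (V - ?Y)"
    then obtain z where z: "z \<in> V" "z \<notin> ?Y" "y = f z" by blast
    then obtain s where "y = s *s L z" using good[OF z(1,2)] unfolding span_single by blast
    then have "y = L (s *s z)" by (simp add: L.scale)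
    then show "y \<in> range L" by blast
  qed
  moreover have "vec.subspace (range L)" by (rule L.subspace_image) (rule vec.subspace_UNIV)
  ultimately have "vec.span (f ` (V - ?Y)) \<subseteq> range L" by (rule vec.span_minimal)
  moreover have "vec.span (f ` (V - ?Y)) = T"
    by (rule image_span_open[OF oG, of w]) (use w in auto)
  ultimately have TL: "T \<subseteq> range L" by simp
  note Lfin = span_T_eq[OF L TL]
  have "f z \<in> vec.span {L z}" if z: "z \<in> V" for z
  proof (cases "z \<in> ?Y")
    case False
    then show ?thesis using good z by blast
  next
    case True
    \<comment> \<open>For \<open>z\<close> in \<open>?Y\<close>, the complex line from
      \<open>z\<close> to \<open>w\<close> meets \<open>?Y\<close> only at \<open>z\<close>. At its
      other points in the ball \<open>f\<close> and \<open>L\<close> are dependent, and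
      \<open>rank_continuation\<close> extends this to the parameter 0.\<close>
    define J where "J = {t. z + t *s (w - z) \<in> V}"
    have oJ: "open J" unfolding J_def by (rule line_preimage(1))
    have cJ: "connected J" unfolding J_def by (rule convex_connected, rule line_preimage(2))
    have 0: "0 \<in> J" unfolding J_def using z by simp
    define h where "h b t = (if b then f (z + t *s (w - z)) else L z + t *s L (w - z))" for b :: bool and t
    have hol: "(\<lambda>t. h b t $ i) holomorphic_on J" for b i
    proof (cases b)
      case True
      then have e: "(\<lambda>t. h b t $ i) = (\<lambda>t. f (z + t *s (w - z)) $ i)" unfolding h_def by auto
      show ?thesis unfolding e by (rule line_holomorphic) (simp only: J_def mem_Collect_eq)
    next
      case False
      then show ?thesis unfolding h_def by (auto intro!: holomorphic_intros)
    qed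
    have hrange: "(\<lambda>b. h b t) ` UNIV = {f (z + t *s (w - z)), L (z + t *s (w - z))}" for t
    proof -
      have "L (z + t *s (w - z)) = L z + t *s L (w - z)" by (simp only: L.add L.scale)
      then show ?thesis unfolding h_def UNIV_bool by auto
    qed
    have small: "vec.dim ((\<lambda>b. h b t) ` UNIV) \<le> 1" if t: "t \<in> J - {0}" for t
    proof -
      let ?x = "z + t *s (w - z)"
      have "?x \<notin> ?Y"
      proof
        assume "?x \<in> ?Y"
        then have "?x - (1 - t) *s z \<in> ?Y" using True by (intro vec.span_diff vec.span_scale)
        also have "?x - (1 - t) *s z = t *s w" by (simp add: vec_eq_iff algebra_simps)
        finally show False using subspace_scale_cancel[OF vec.subspace_span] t w(2) by auto
      qed
      then have "f ?x \<in> vec.span {L ?x}" using good t unfolding J_def by blast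
      then have "(\<lambda>b. h b t) ` UNIV \<subseteq> vec.span {L ?x}" unfolding hrange by (auto intro: vec.span_base)
      then have "vec.dim ((\<lambda>b. h b t) ` UNIV) \<le> card {L ?x}" by (rule vec.dim_le_card) simp
      then show ?thesis by simp
    qed
    have lim: "0 islimpt (J - {0})" using oJ 0 by (metis interior_open interior_limit_point islimpt_punctured Diff_iff)
    have d1: "vec.dim ((\<lambda>b. h b 0) ` UNIV) \<le> 1"
    proof (rule ccontr)
      assume "\<not> ?thesis"
      then have two: "2 \<le> vec.dim ((\<lambda>b. h b 0) ` UNIV)" by simp
      have "\<exists>t\<in>J - {0}. 2 \<le> vec.dim ((\<lambda>b. h b t) ` UNIV)"
        by (rule rank_continuation[where g = h, OF oJ cJ hol 0 two 0 lim Diff_subset])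
      then obtain t where t: "t \<in> J - {0}" "2 \<le> vec.dim ((\<lambda>b. h b t) ` UNIV)" by (elim bexE)
      then show False using small[OF t(1)] by linarith
    qed
    have "z \<noteq> 0" using z zero_notin by auto
    then have Lz: "L z \<noteq> 0" using Lfin(1) L.zero by (metis injD)
    have "vec.dim {f z, L z} \<le> 1" using d1 unfolding hrange by simp
    moreover have "vec.dim {L z} = 1" using Lz by (simp add: vec.dim_insert)
    ultimately have le: "vec.dim {f z, L z} \<le> vec.dim {L z}" by linarith
    have "vec.span {L z} = vec.span {f z, L z}" by (rule vec.dim_eq_span[OF _ le]) simp
    then show ?thesis using vec.span_base[of "f z" "{f z, L z}"] by simp
  qed
  then show ?thesis using L Lfin by (intro exI[of _ L] conjI ballI)
qed

text \<open>The form pulled back by \<open>L\<close> is \<open>herm \<sigma> z (G w)\<close> for a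
  linear \<open>G\<close>. Preservation of orthogonality puts \<open>G w\<close> into the double
  orthogonal of \<open>w\<close> for \<open>w\<close> in an open set, so \<open>eigen_modulo\<close>
  makes \<open>G\<close> a scalar. Hermitian symmetry makes the factor real, and a zero factor would
  make \<open>T\<close> totally isotropic.\<close>

lemma isometric_germ:
  "\<exists>L c. Vector_Spaces.linear (*s) (*s) L \<and> range L = T \<and> (\<forall>z\<in>V. f z \<in> vec.span {L z}) \<and>
    c \<noteq> 0 \<and> (\<forall>z w. herm \<tau> (L z) (L w) = complex_of_real c * herm \<sigma> z w)"
proof -
  obtain L where L: "Vector_Spaces.linear (*s) (*s) L" "inj L" "range L = T" "\<forall>z\<in>V. f z \<in> vec.span {L z}"
    using linear_germ by (elim exE conjE)
  interpret L: Vector_Spaces.linear "(*s)" "(*s)" L by (rule L(1))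
  have "\<forall>w. \<exists>u. \<forall>z. herm \<tau> (L z) (L w) = herm \<sigma> z u"
  proof
    fix w
    obtain u where "\<And>z. herm \<tau> (L z) (L w) = herm \<sigma> z u"
      by (rule herm_rep[OF nz, of "\<lambda>z. herm \<tau> (L z) (L w)"]) (auto simp: L.add L.scale herm_simps)
    then show "\<exists>u. \<forall>z. herm \<tau> (L z) (L w) = herm \<sigma> z u" by blast
  qed
  then obtain G where G: "\<And>w z. herm \<tau> (L z) (L w) = herm \<sigma> z (G w)" by metis
  have Glin: "Vector_Spaces.linear (*s) (*s) G"
  proof (rule clinearI)
    show "G (x + y) = G x + G y" for x y
      by (rule herm_right_cancel[OF nz]) (simp add: herm_add_right L.add flip: G)
    show "G (k *s x) = k *s G x" for k x
      by (rule herm_right_cancel[OF nz]) (simp add: herm_scale_right L.scale flip: G)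
  qed
  have n1: "1 < CARD('n)" using card_n by simp
  \<comment> \<open>Orthogonality transfers to \<open>L\<close> only for points of the ball with
    nonzero values, so an orthogonal pair \<open>a\<close>, \<open>b\<close> of such points serves
    as a base.\<close>
  obtain v b where v: "\<And>j. j < 1 \<Longrightarrow> v j \<in> V" "image_dim (vec.span (v ` {..<1::nat})) = generic_dim 1"
    and b: "b \<in> V" "f b \<noteq> 0" and vb: "\<And>j. j < 1 \<Longrightarrow> herm \<sigma> (v j) b = 0"
    using generic_orthogonal_point[OF zero_less_one n1] by blast
  define a where "a = v 0"
  have a: "a \<in> V" "herm \<sigma> b a = 0" using v(1)[of 0] vb[of 0] herm_commute_zero[of \<sigma> a b] by (auto simp: a_def)
  have fa: "f a \<noteq> 0" using v(2) image_dim_point[OF a(1)] generic_dim_1 by (auto simp: a_def lessThan_Suc)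
  have nbhd: "\<exists>r>0. \<forall>x. norm (x - y) < r \<longrightarrow> x \<in> V \<and> f x \<noteq> 0" if y: "y \<in> V" "f y \<noteq> 0" for y
  proof -
    obtain r1 where r1: "r1 > 0" "ball y r1 \<subseteq> V" using y open_ball open_contains_ball by blast
    obtain r2 where r2: "r2 > 0" "\<And>x. dist x y < r2 \<Longrightarrow> dist (f x) (f y) < norm (f y)"
      using isCont[OF y(1)] y(2) unfolding continuous_at_eps_delta by (metis zero_less_norm_iff)
    have "x \<in> V \<and> f x \<noteq> 0" if "norm (x - y) < min r1 r2" for x
      using that r1(2) r2(2)[of x] by (auto simp: dist_norm norm_minus_commute subset_eq)
    then show ?thesis using r1 r2 by (intro exI[of _ "min r1 r2"]) auto
  qed
  obtain \<epsilon> where eps: "\<epsilon> > 0" "\<forall>x. norm (x - a) < \<epsilon> \<longrightarrow> x \<in> V \<and> f x \<noteq> 0" using nbhd[OF a(1) fa] by (elim exE conjE)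
  obtain \<delta>1 where d1: "\<delta>1 > 0" "\<forall>x. norm (x - b) < \<delta>1 \<longrightarrow> x \<in> V \<and> f x \<noteq> 0" using nbhd[OF b] by (elim exE conjE)
  have "b \<noteq> 0" using b(1) zero_notin by auto
  then have ind: "inj_on (\<lambda>_::nat. b) {0}" "vec.independent ((\<lambda>_::nat. b) ` {0})" by auto
  obtain \<delta>2 where d2: "\<delta>2 > 0" "\<And>a' x. (\<And>i. i \<in> {0::nat} \<Longrightarrow> norm (a' i - b) < \<delta>2) \<Longrightarrow> norm x \<le> norm a \<Longrightarrow>
      (\<And>i. i \<in> {0::nat} \<Longrightarrow> herm \<sigma> b x = 0) \<Longrightarrow> \<exists>b'. norm (b' - x) < \<epsilon> \<and> (\<forall>i\<in>{0}. herm \<sigma> (a' i) b' = 0)"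
    using orthogonal_perturbation[OF nz _ ind eps(1), of "norm a"] by blast
  have key: "herm \<tau> (L x) (L y) = 0" if xy: "x \<in> V" "y \<in> V" "f x \<noteq> 0" "f y \<noteq> 0" "herm \<sigma> x y = 0" for x y
  proof -
    obtain s where s: "f x = s *s L x" using L(4) xy(1) unfolding span_single by blast
    obtain t where t: "f y = t *s L y" using L(4) xy(2) unfolding span_single by blast
    have "s * (cnj t * herm \<tau> (L x) (L y)) = 0" using orth[OF xy(1,2,5)] unfolding s t herm_simps by (simp only: mult_ac)
    moreover have "s \<noteq> 0" "t \<noteq> 0" using s t xy(3,4) by auto
    ultimately show ?thesis by simp
  qed
  have ev: "\<exists>\<mu>. G w - \<mu> *s w \<in> {0}" if w: "w \<in> ball b (min \<delta>1 \<delta>2)" for w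
  proof -
    have nw: "norm (w - b) < \<delta>1" "norm (w - b) < \<delta>2" using w by (auto simp: dist_norm norm_minus_commute)
    have wV: "w \<in> V" "f w \<noteq> 0" using d1(2) nw(1) by auto
    have w0: "w \<noteq> 0" using wV(1) zero_notin by auto
    obtain a' where a': "norm (a' - a) < \<epsilon>" "herm \<sigma> w a' = 0" using d2(2)[of "\<lambda>_. w" a] nw(2) a(2) by auto
    have a'w: "herm \<sigma> a' w = 0" using a'(2) herm_commute_zero by blast
    have a'V: "a' \<in> V" "f a' \<noteq> 0" using eps(2) a'(1) by auto
    have "herm \<sigma> z (G w) = 0" if z: "herm \<sigma> z w = 0" for z
    proof -
      have "\<epsilon> - norm (a' - a) > 0" using a'(1) by simp
      then obtain t :: real where t: "t > 0" "norm (complex_of_real t *s z) < \<epsilon> - norm (a' - a)" by (rule small_scalar)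
      \<comment> \<open>An arbitrary \<open>z\<close> orthogonal to \<open>w\<close> need not lie in
        the ball. Added with a small factor to \<open>a'\<close>, itself orthogonal to
        \<open>w\<close>, it gives a point of the ball with nonzero value, and the contribution of
        \<open>a'\<close> drops out again.\<close>
      let ?x = "a' + complex_of_real t *s z"
      have "norm (?x - a) \<le> norm (a' - a) + norm (complex_of_real t *s z)"
        using norm_triangle_ineq[of "a' - a" "complex_of_real t *s z"] by (simp add: algebra_simps)
      then have "norm (?x - a) < \<epsilon>" using t(2) by linarith
      then have xV: "?x \<in> V" "f ?x \<noteq> 0" using eps(2) by auto
      have "herm \<sigma> ?x w = 0" using a'w z by (simp add: herm_simps)
      then have "herm \<tau> (L ?x) (L w) = 0" using key xV wV by blast
      moreover have "herm \<tau> (L a') (L w) = 0" using key a'V wV a'w by blast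
      ultimately have "herm \<tau> (L z) (L w) = 0" using t(1) by (simp add: L.add L.scale herm_simps)
      then show ?thesis by (simp add: G)
    qed
    then obtain \<mu> where "G w = \<mu> *s w" using herm_double_orthogonal[OF nz w0] by blast
    then show ?thesis by (intro exI[of _ \<mu>]) simp
  qed
  have ne: "ball b (min \<delta>1 \<delta>2) \<noteq> {}" using d1 d2 by simp
  have d0: "vec.dim {0 :: complex^'n} + 2 \<le> CARD('n)" using card_n by (simp add: vec.dim_insert)
  have s0: "vec.subspace {0 :: complex^'n}" by (rule vec.subspace_single_0)
  obtain \<mu> where mu: "\<forall>w. G w - \<mu> *s w \<in> {0}"
    using eigen_modulo[OF Glin open_ball ne s0 d0 ev] by blast
  have Gmu: "G w = \<mu> *s w" for w using mu by auto
  define c where "c = cnj \<mu>"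
  have c: "herm \<tau> (L z) (L w) = c * herm \<sigma> z w" for z w unfolding G Gmu c_def by (simp add: herm_simps)
  fix i :: 'n
  have "cnj c = c"
  proof -
    let ?e = "axis i (1::complex)"
    have e: "herm \<sigma> ?e ?e = of_real (\<sigma> i)" unfolding herm_axis_right by (simp add: axis_def)
    have "cnj (herm \<tau> (L ?e) (L ?e)) = herm \<tau> (L ?e) (L ?e)" by (rule herm_cnj)
    then show ?thesis unfolding c e using nz by simp
  qed
  then have cr: "c = complex_of_real (Re c)" by (simp add: complex_eq_iff)
  have "c \<noteq> 0"
  proof
    assume c0: "c = 0"
    have "f b = 0"
    proof (rule nondeg)
      show fbT: "f b \<in> T" using b(1) by (intro vec.span_base) blast
      show "herm \<tau> (f b) y = 0" if "y \<in> T" for y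
      proof -
        have "f b \<in> range L" unfolding L(3) by (rule fbT)
        then obtain u where "f b = L u" by (elim rangeE)
        moreover have "y \<in> range L" unfolding L(3) by (rule that)
        then obtain u' where "y = L u'" by (elim rangeE)
        ultimately show ?thesis using c c0 by simp
      qed
    qed
    then show False using b(2) by simp
  qed
  then have r: "Re c \<noteq> 0" using cr by (metis of_real_0)
  have cL: "\<forall>z w. herm \<tau> (L z) (L w) = complex_of_real (Re c) * herm \<sigma> z w"
    by (simp only: cr[symmetric] c) simp
  show ?thesis using L(1,3,4) r cL by (intro exI[of _ L] exI[of _ "Re c"] conjI)
qed

end

section \<open>Globalization\<close>

lemma idx_bij: "bij_betw (idx :: 'n::{finite,linorder} \<Rightarrow> nat) UNIV {..<CARD('n)}"
proof -
  have less: "idx i < idx j" if "i < j" for i j :: 'n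
    unfolding idx_def by (rule psubset_card_mono) (use that in auto)
  have inj: "inj (idx :: 'n \<Rightarrow> nat)"
    by (rule injI) (metis less linorder_neqE less_irrefl)
  have "idx i < CARD('n)" for i :: 'n
    unfolding idx_def by (rule psubset_card_mono) auto
  then have sub: "range (idx :: 'n \<Rightarrow> nat) \<subseteq> {..<CARD('n)}" by auto
  have "range (idx :: 'n \<Rightarrow> nat) = {..<CARD('n)}"
    by (rule card_subset_eq[OF finite_lessThan sub]) (simp add: card_image[OF inj])
  then show ?thesis using inj by (simp add: bij_betw_def)
qed

lemma card_idx: "A \<subseteq> {..<CARD('n)} \<Longrightarrow> card {i :: 'n::{finite,linorder}. idx i \<in> A} = card A"
proof -
  assume A: "A \<subseteq> {..<CARD('n)}"
  have "idx ` {i :: 'n. idx i \<in> A} = A"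
  proof
    show "A \<subseteq> idx ` {i :: 'n. idx i \<in> A}"
    proof
      fix k assume k: "k \<in> A"
      then have "k \<in> range (idx :: 'n \<Rightarrow> nat)" using A idx_bij[where ?'n = 'n] unfolding bij_betw_def by blast
      then show "k \<in> idx ` {i :: 'n. idx i \<in> A}" using k by blast
    qed
  qed auto
  moreover have "inj_on idx {i :: 'n. idx i \<in> A}"
    using idx_bij[where ?'n = 'n] unfolding bij_betw_def by (rule inj_on_subset[OF conjunct1]) simp
  ultimately show ?thesis using card_image by fastforce
qed

definition real_sig :: "nat \<Rightarrow> nat \<Rightarrow> 'n::{finite,linorder} \<Rightarrow> real" where
  "real_sig r s i = (if idx i < r then 1 else if idx i < r + s then -1 else 0)"

lemma hform_herm: "hform r s = herm (real_sig r s)"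
  unfolding hform_def herm_def sig_def real_sig_def by (intro ext sum.cong) auto

lemma card_real_sig:
  assumes "r + s \<le> CARD('n::{finite,linorder})"
  shows "card {i :: 'n. real_sig r s i > 0} = r" "card {i :: 'n. real_sig r s i < 0} = s"
proof -
  have "{i :: 'n. real_sig r s i > 0} = {i. idx i \<in> {..<r}}" unfolding real_sig_def by auto
  then show "card {i :: 'n. real_sig r s i > 0} = r" using card_idx[of "{..<r}", where ?'n = 'n] assms by auto
  have "{i :: 'n. real_sig r s i < 0} = {i. idx i \<in> {r..<r + s}}" unfolding real_sig_def by auto
  moreover have "{r..<r + s} \<subseteq> {..<CARD('n)}" using assms by auto
  ultimately show "card {i :: 'n. real_sig r s i < 0} = s" using card_idx[of "{r..<r + s}", where ?'n = 'n] by simp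
qed

text \<open>If \<open>x\<close> in \<open>W\<close> vanishes at all coordinates with
  \<open>s * \<tau> i > 0\<close>, its norm is a sum of terms of one sign that is zero, so
  \<open>x\<close> is orthogonal to everything and vanishes by \<open>nd\<close>. Hence
  \<open>W\<close> embeds into these coordinates. The choices \<open>s = 1\<close> and
  \<open>s = -1\<close> give both bounds of the signature.\<close>

lemma isotropic_dim_le:
  fixes W :: "(complex^'m::finite) set"
  assumes W: "vec.subspace W" and iso: "\<And>x y. x \<in> W \<Longrightarrow> y \<in> W \<Longrightarrow> herm \<tau> x y = 0"
    and nd: "\<And>x. x \<in> W \<Longrightarrow> (\<And>y. herm \<tau> x y = 0) \<Longrightarrow> x = 0" and s: "s \<noteq> (0 :: real)"
  shows "vec.dim W \<le> card {i. s * \<tau> i > 0}"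
proof -
  let ?P = "{i. s * \<tau> i > 0}"
  let ?B = "(\<lambda>i. axis i (1::complex)) ` ?P"
  have "{x \<in> W. \<forall>b\<in>?B. herm (\<lambda>_. 1) x b = 0} \<subseteq> {0}"
  proof
    fix x assume "x \<in> {x \<in> W. \<forall>b\<in>?B. herm (\<lambda>_. 1) x b = 0}"
    then have x: "x \<in> W" "\<And>i. i \<in> ?P \<Longrightarrow> x $ i = 0" by (auto simp: herm_axis_right)
    have le: "s * \<tau> i * (norm (x$i))\<^sup>2 \<le> 0" for i
    proof (cases "i \<in> ?P")
      case False
      then show ?thesis by (simp add: mult_nonpos_nonneg)
    qed (use x in simp)
    have "(\<Sum>i\<in>UNIV. s * \<tau> i * (norm (x$i))\<^sup>2) = s * (\<Sum>i\<in>UNIV. \<tau> i * (norm (x$i))\<^sup>2)"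
      by (simp add: sum_distrib_left mult.assoc)
    also have "(\<Sum>i\<in>UNIV. \<tau> i * (norm (x$i))\<^sup>2) = 0"
      using iso[OF x(1) x(1)] unfolding herm_self of_real_eq_0_iff .
    finally have "(\<Sum>i\<in>UNIV. - (s * \<tau> i * (norm (x$i))\<^sup>2)) = 0" by (simp add: sum_negf)
    then have "\<forall>i\<in>UNIV. - (s * \<tau> i * (norm (x$i))\<^sup>2) = 0"
      using le by (subst (asm) sum_nonneg_eq_0_iff) auto
    then have "\<tau> i = 0 \<or> x$i = 0" for i using s by auto
    then have "herm \<tau> x y = 0" for y
      unfolding herm_def by (intro sum.neutral) (metis mult_zero_left mult_zero_right of_real_0)
    then show "x \<in> {0}" using nd[OF x(1)] by simp
  qed
  then have "vec.dim {x \<in> W. \<forall>b\<in>?B. herm (\<lambda>_. 1) x b = 0} = 0" by (simp only: vec.dim_eq_0)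
  moreover have "vec.dim W \<le> vec.dim {x \<in> W. \<forall>b\<in>?B. herm (\<lambda>_. 1) x b = 0} + card ?B"
    by (rule dim_orth_finite[OF W]) simp
  moreover have "card ?B \<le> card ?P" by (rule card_image_le) simp
  ultimately show ?thesis by linarith
qed

section \<open>Division by the radical and choice of lifts\<close>

text \<open>The quotient of \<open>S\<close> by \<open>R\<close> is realised inside the same space:
  a basis of \<open>R\<close> is extended to one of \<open>S\<close>, and \<open>\<pi>\<close> kills
  the former and fixes the added vectors.\<close>

lemma radical_splitting:
  fixes R S :: "(complex^'m::finite) set"
  assumes R: "vec.subspace R" and S: "vec.subspace S" and RS: "R \<subseteq> S"
  obtains \<pi> :: "complex^'m \<Rightarrow> complex^'m" where "Vector_Spaces.linear (*s) (*s) \<pi>"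
    "\<And>x. x \<in> R \<Longrightarrow> \<pi> x = 0" "\<And>x. x \<in> S \<Longrightarrow> x - \<pi> x \<in> R"
proof -
  obtain B where B: "B \<subseteq> R" "vec.independent B" "R \<subseteq> vec.span B" "card B = vec.dim R"
    by (rule vec.basis_exists[of R], rule that)
  have BS: "B \<subseteq> S" using B(1) RS by simp
  obtain C where C: "B \<subseteq> C" "C \<subseteq> S" "vec.independent C" "S \<subseteq> vec.span C"
    by (rule vec.maximal_independent_subset_extend[OF BS B(2)], rule that)
  obtain \<pi> where pi: "Vector_Spaces.linear (*s) (*s) \<pi>" "\<forall>x\<in>C. \<pi> x = (if x \<in> B then 0 else x :: complex^'m)"
    using vec.linear_independent_extend[OF C(3), of "\<lambda>x. if x \<in> B then 0 else x"] by blast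
  interpret pi: Vector_Spaces.linear "(*s)" "(*s)" \<pi> by (rule pi(1))
  show ?thesis
  proof (rule that[OF pi(1)])
    fix x assume "x \<in> R"
    then have "x \<in> vec.span B" using B(3) by blast
    then show "\<pi> x = 0"
    proof (induction rule: vec.span_induct_alt)
      case (step c v w)
      have "\<pi> v = 0" using pi(2) C(1) step(1) by auto
      then show ?case using step(2) by (simp add: pi.add pi.scale)
    qed (rule pi.zero)
  next
    fix x assume "x \<in> S"
    then have "x \<in> vec.span C" using C(4) by blast
    then show "x - \<pi> x \<in> R"
    proof (induction rule: vec.span_induct_alt)
      case base
      show ?case using R by (simp add: pi.zero vec.subspace_0)
    next
      case (step c v w)
      have v: "v - \<pi> v \<in> R" using pi(2) step(1) B(1) R by (auto simp: vec.subspace_0)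
      have "c *s v + w - \<pi> (c *s v + w) = c *s (v - \<pi> v) + (w - \<pi> w)"
        by (simp add: pi.add pi.scale vec_eq_iff algebra_simps)
      also have "\<dots> \<in> R" by (rule vec.subspace_add[OF R vec.subspace_scale[OF R v] step(2)])
      finally show ?case .
    qed
  qed
qed

lemma complex_linear_bounded:
  fixes L :: "complex^'n::finite \<Rightarrow> complex^'m::finite"
  assumes "Vector_Spaces.linear (*s) (*s) L"
  shows "bounded_linear L"
proof -
  interpret L: Vector_Spaces.linear "(*s)" "(*s)" L by (rule assms)
  have r: "r *\<^sub>R x = complex_of_real r *s x" for r and x :: "complex^'k::finite"
    unfolding vec_eq_iff by simp (simp add: scaleR_conv_of_real)
  have "linear L" by (rule linearI) (simp_all add: L.add r L.scale)
  then show ?thesis by (simp add: linear_conv_bounded_linear)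
qed

lemma dim_insert_scale:
  fixes x :: "complex^'m::finite"
  assumes "k \<noteq> 0"
  shows "vec.dim (insert (k *s x) A) = vec.dim (insert x A)"
proof (rule vec.span_eq_dim, rule equalityI; rule vec.span_minimal[OF _ vec.subspace_span])
  show "insert (k *s x) A \<subseteq> vec.span (insert x A)"
    by (auto intro: vec.span_base vec.span_scale)
  have "x = (1 / k) *s (k *s x)" using assms by simp
  also have "\<dots> \<in> vec.span (insert (k *s x) A)" by (intro vec.span_scale vec.span_base) simp
  finally show "insert x A \<subseteq> vec.span (insert (k *s x) A)" by (auto intro: vec.span_base)
qed

lemma holomorphic_lift:
  assumes F: "proj_hol_map U F" and z: "z \<in> U"
  obtains \<epsilon> f where "\<epsilon> > 0" "ball z \<epsilon> \<subseteq> U"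
    "\<And>w. w \<in> ball z \<epsilon> \<Longrightarrow> \<exists>L. Vector_Spaces.linear (*s) (*s) L \<and> (f has_derivative L) (at w)"
    "\<And>w. w \<in> ball z \<epsilon> \<Longrightarrow> \<exists>k. k \<noteq> 0 \<and> f w = k *s F w"
proof -
  obtain V f where V: "z \<in> V" "V \<subseteq> U" "cholo_on f V" "\<forall>w\<in>V. f w \<noteq> 0 \<and> pequiv (F w) (f w)"
    using F z unfolding proj_hol_map_def by blast
  have "open V" using V(3) unfolding cholo_on_def by blast
  then obtain \<epsilon> where e: "\<epsilon> > 0" "ball z \<epsilon> \<subseteq> V" using V(1) open_contains_ball by blast
  show ?thesis
  proof (rule that[OF e(1)])
    show "ball z \<epsilon> \<subseteq> U" using e(2) V(2) by blast
    show "\<exists>L. Vector_Spaces.linear (*s) (*s) L \<and> (f has_derivative L) (at w)" if "w \<in> ball z \<epsilon>" for w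
      using V(3) e(2) that unfolding cholo_on_def clinear_def by blast
    show "\<exists>k. k \<noteq> 0 \<and> f w = k *s F w" if "w \<in> ball z \<epsilon>" for w
      using V(4) e(2) that unfolding pequiv_def by blast
  qed
qed

section \<open>Propagation over the connected domain\<close>

text \<open>Rescaling \<open>F w\<close> leaves the dimension unchanged, so \<open>F\<close> may be
  exchanged for local holomorphic lifts even though \<open>F\<close> itself need not be continuous.
  In a ball with a lift, validity on a smaller ball spreads along complex lines by
  \<open>rank_continuation\<close>; hence the disjoint open sets \<open>G\<close> and
  \<open>H\<close> cover \<open>U\<close>, and connectedness leaves only \<open>G\<close>.\<close>

lemma rank_propagation:
  fixes F L :: "complex^'n::{finite,linorder} \<Rightarrow> complex^'m::{finite,linorder}" and R :: "(complex^'m::{finite,linorder}) set"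
  assumes U: "open U" "connected U" and F: "proj_hol_map U F" and L: "Vector_Spaces.linear (*s) (*s) L"
    and W: "p \<in> U" "\<epsilon>0 > 0" "\<And>w. w \<in> ball p \<epsilon>0 \<Longrightarrow> vec.dim (insert (F w) (insert (L w) R)) \<le> \<delta>"
    and z: "z \<in> U"
  shows "vec.dim (insert (F z) (insert (L z) R)) \<le> \<delta>"
proof -
  interpret L: Vector_Spaces.linear "(*s)" "(*s)" L by (rule L)
  define P where "P w \<longleftrightarrow> vec.dim (insert (F w) (insert (L w) R)) \<le> \<delta>" for w
  define G where "G = interior {w. P w}"
  have oG: "open G" unfolding G_def by (rule open_interior)
  have spread: "\<exists>\<epsilon>>0. ball z \<epsilon> \<subseteq> G \<or> ball z \<epsilon> \<inter> G = {}" if zU: "z \<in> U" for z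
  proof -
    obtain \<epsilon> f where f: "\<epsilon> > 0" "ball z \<epsilon> \<subseteq> U"
      "\<And>w. w \<in> ball z \<epsilon> \<Longrightarrow> \<exists>L. Vector_Spaces.linear (*s) (*s) L \<and> (f has_derivative L) (at w)"
      "\<And>w. w \<in> ball z \<epsilon> \<Longrightarrow> \<exists>k. k \<noteq> 0 \<and> f w = k *s F w"
      using holomorphic_lift[OF F zU] by blast
    interpret holomorphic_germ f z \<epsilon> by unfold_locales (rule f(1), rule f(3))
    have Pf: "P w \<longleftrightarrow> vec.dim (insert (f w) (insert (L w) R)) \<le> \<delta>" if w: "w \<in> ball z \<epsilon>" for w
    proof -
      obtain k where "k \<noteq> 0" "f w = k *s F w" using f(4)[OF w] by blast
      then show ?thesis unfolding P_def by (simp add: dim_insert_scale)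
    qed
    have "ball z \<epsilon> \<subseteq> G" if ne: "ball z \<epsilon> \<inter> G \<noteq> {}"
    proof -
      obtain a where a: "a \<in> ball z \<epsilon>" "a \<in> G" using ne by blast
      obtain r where r: "r > 0" "ball a r \<subseteq> {w. P w}" using a(2) unfolding G_def mem_interior by (elim exE conjE)
      have all: "P y" if y: "y \<in> ball z \<epsilon>" for y
      proof (rule ccontr)
        assume "\<not> P y"
        then have ny: "\<delta> + 1 \<le> vec.dim (insert (f y) (insert (L y) R))" using Pf[OF y] by simp
        define J where "J = {t. a + t *s (y - a) \<in> ball z \<epsilon>}"
        define X where "X = J \<inter> {t. a + t *s (y - a) \<in> ball a r}"
        \<comment> \<open>The vectors whose rank is continued: the lift, the linear map, and each
          element of \<open>R\<close> as a constant function.\<close>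
        define A where "A = insert f (insert L ((\<lambda>r _. r) ` R))"
        have oJ: "open J" unfolding J_def by (rule line_preimage(1))
        have cJ: "connected J" unfolding J_def by (rule convex_connected, rule line_preimage(2))
        have J0: "0 \<in> J" unfolding J_def using a by simp
        have J1: "1 \<in> J" unfolding J_def using y by simp
        have "open X" unfolding X_def by (intro open_Int oJ line_preimage(1))
        moreover have "0 \<in> X" unfolding X_def using J0 r(1) by simp
        ultimately have lim: "0 islimpt X" by (intro interior_limit_point) (simp add: interior_open)
        have hol: "(\<lambda>t. c (a + t *s (y - a)) $ i) holomorphic_on J" if cA: "c \<in> A" for c i
        proof -
          consider "c = f" | "c = L" | q where "c = (\<lambda>_. q)" using cA unfolding A_def by (elim insertE imageE)
          then show ?thesis
          proof cases
            case 1
            show ?thesis unfolding 1 by (rule line_holomorphic) (simp only: J_def mem_Collect_eq)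
          next
            case 2
            show ?thesis unfolding 2 L.add L.scale by (auto intro!: holomorphic_intros)
          next
            case 3
            then show ?thesis by simp
          qed
        qed
        have A: "(\<lambda>c. c x) ` A = insert (f x) (insert (L x) R)" for x
          unfolding A_def image_insert image_image by simp
        have ny': "\<delta> + 1 \<le> vec.dim ((\<lambda>c. c (a + 1 *s (y - a))) ` A)" using ny unfolding A by simp
        have "\<exists>t\<in>X. \<delta> + 1 \<le> vec.dim ((\<lambda>c. c (a + t *s (y - a))) ` A)"
          by (rule rank_continuation[where g = "\<lambda>c t. c (a + t *s (y - a))", OF oJ cJ hol J1 ny' J0 lim]) (auto simp: X_def)
        then obtain t where t: "t \<in> X" "\<delta> + 1 \<le> vec.dim ((\<lambda>c. c (a + t *s (y - a))) ` A)" by (elim bexE)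
        have tz: "a + t *s (y - a) \<in> ball z \<epsilon>" and "a + t *s (y - a) \<in> ball a r"
          using t(1) unfolding X_def J_def by auto
        then have "P (a + t *s (y - a))" using r(2) by blast
        then show False using t(2) Pf[OF tz] unfolding A by linarith
      qed
      have "ball z \<epsilon> \<subseteq> {w. P w}" using all by (intro subsetI CollectI)
      then show ?thesis unfolding G_def by (rule interior_maximal[OF _ open_ball])
    qed
    then show ?thesis using f(1) by blast
  qed
  define H where "H = interior (- G)"
  have oH: "open H" unfolding H_def by (rule open_interior)
  have cover: "U \<subseteq> G \<union> H"
  proof
    fix z assume "z \<in> U"
    then obtain \<epsilon> where e: "\<epsilon> > 0" "ball z \<epsilon> \<subseteq> G \<or> ball z \<epsilon> \<inter> G = {}" using spread by blast
    have z: "z \<in> ball z \<epsilon>" using e(1) by simp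
    from e(2) show "z \<in> G \<union> H"
    proof
      assume "ball z \<epsilon> \<subseteq> G"
      then show ?thesis using z by blast
    next
      assume "ball z \<epsilon> \<inter> G = {}"
      then have "ball z \<epsilon> \<subseteq> - G" by blast
      then have "ball z \<epsilon> \<subseteq> H" unfolding H_def by (rule interior_maximal[OF _ open_ball])
      then show ?thesis using z by blast
    qed
  qed
  have disj: "G \<inter> H \<inter> U = {}" using interior_subset[of "- G"] unfolding H_def by blast
  have "ball p \<epsilon>0 \<subseteq> {w. P w}" unfolding P_def using W(3) by (intro subsetI CollectI)
  then have "ball p \<epsilon>0 \<subseteq> G" unfolding G_def by (rule interior_maximal[OF _ open_ball])
  then have "p \<in> G" using W(2) by auto
  then have "G \<inter> U \<noteq> {}" using W(1) by blast
  then have "H \<inter> U = {}" using connectedD[OF U(2) oG oH disj cover] by blast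
  then have "z \<in> G" using cover z by blast
  then have "z \<in> {w. P w}" unfolding G_def using interior_subset by (rule subsetD[rotated])
  then show ?thesis unfolding P_def by simp
qed

section \<open>Orthogonal splitting of the target\<close>

lemma proj_along_eq:
  assumes A: "vec.subspace A" and B: "vec.subspace B" and AB: "A \<inter> B = {0}" and "a \<in> A" "b \<in> B"
  shows "proj_along A B (a + b) = a"
  unfolding proj_along_def
proof (rule the_equality)
  show "a \<in> A \<and> a + b - a \<in> B" using assms by simp
  fix a' assume a': "a' \<in> A \<and> a + b - a' \<in> B"
  have "(a + b - a') - b \<in> B" by (rule vec.subspace_diff[OF B]) (use a' assms in auto)
  moreover have "(a + b - a') - b = a - a'" by simp
  moreover have "a - a' \<in> A" by (rule vec.subspace_diff[OF A]) (use a' assms in auto)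
  ultimately have "a - a' \<in> A \<inter> B" by simp
  then show "a' = a" using AB by simp
qed

text \<open>As \<open>M\<close> multiplies a nondegenerate form by \<open>c \<noteq> 0\<close>, its
  range \<open>A\<close> is nondegenerate and the orthogonal space \<open>B\<close> is a true
  complement. It contains \<open>R\<close>, so the two projections of \<open>F z\<close> are a
  multiple of \<open>M z\<close> and an element of the null space \<open>R\<close>.\<close>

lemma conformal_splitting:
  fixes F M :: "complex^'n::{finite,linorder} \<Rightarrow> complex^'m::{finite,linorder}"
  assumes nz: "\<forall>i. \<sigma> i \<noteq> 0" and M: "Vector_Spaces.linear (*s) (*s) M"
    and iso: "\<And>z w. herm \<tau> (M z) (M w) = c * herm \<sigma> z w" and c: "c \<noteq> 0"
    and R: "vec.subspace R" "\<And>x y. x \<in> R \<Longrightarrow> y \<in> R \<Longrightarrow> herm \<tau> x y = 0" "\<And>x z. x \<in> R \<Longrightarrow> herm \<tau> (M z) x = 0"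
    and F: "\<And>z. z \<in> U \<Longrightarrow> \<exists>\<mu> x. x \<in> R \<and> F z = \<mu> *s M z + x" and nR: "\<exists>z\<in>U. F z \<notin> R" and U0: "0 \<notin> U"
    and \<tau>: "hform r' s' = herm \<tau>" and \<sigma>: "hform r s = herm \<sigma>"
  shows "quasi_linear r' s' U F" "c = 1 \<Longrightarrow> quasi_standard r s r' s' U F"
proof -
  interpret M: Vector_Spaces.linear "(*s)" "(*s)" M by (rule M)
  have cM: "clinear M" unfolding clinear_def by (rule M)
  define A where "A = range M"
  define B where "B = {x. \<forall>a\<in>A. herm \<tau> a x = 0}"
  have Minj: "z = 0" if "M z = 0" for z
  proof (rule herm_right_cancel[OF nz])
    fix x
    have "c * herm \<sigma> x z = 0" unfolding iso[symmetric] that by (rule herm_zero_right)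
    then show "herm \<sigma> x z = herm \<sigma> x 0" using c by (simp add: herm_simps)
  qed
  have Mn: "M z \<noteq> 0" if "z \<in> U" for z using Minj[of z] that U0 by auto
  have A: "vec.subspace A" unfolding A_def by (rule M.subspace_image) (rule vec.subspace_UNIV)
  have B: "vec.subspace B" unfolding B_def vec.subspace_def by (auto simp: herm_simps)
  have RB: "R \<subseteq> B" unfolding B_def A_def using R(3) by auto
  have AB: "A \<inter> B = {0}"
  proof
    show "A \<inter> B \<subseteq> {0}"
    proof
      fix x assume x: "x \<in> A \<inter> B"
      then obtain z where z: "x = M z" unfolding A_def by blast
      have "herm \<sigma> w z = herm \<sigma> w 0" for w
      proof -
        have "\<forall>a\<in>A. herm \<tau> a x = 0" using x unfolding B_def by simp
        moreover have "M w \<in> A" unfolding A_def by (rule rangeI)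
        ultimately have "herm \<tau> (M w) (M z) = 0" using z by simp
        then show ?thesis using c unfolding iso by (simp add: herm_simps)
      qed
      then have "z = 0" by (rule herm_right_cancel[OF nz])
      then show "x \<in> {0}" using z by (simp add: M.zero)
    qed
    show "{0} \<subseteq> A \<inter> B" using A B by (simp add: vec.subspace_0)
  qed
  have sum: "\<exists>a\<in>A. \<exists>b\<in>B. x = a + b" for x
  proof -
    \<comment> \<open>The component of \<open>x\<close> in \<open>A\<close> comes from representing
      \<open>herm \<tau> (M w) x\<close>, as a functional of \<open>w\<close>, by a vector of the
      source.\<close>
    obtain u where u: "\<And>w. herm \<tau> (M w) x = herm \<sigma> w u"
      by (rule herm_rep[OF nz, of "\<lambda>w. herm \<tau> (M w) x"]) (auto simp: M.add M.scale herm_simps)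
    define a where "a = M ((1 / cnj c) *s u)"
    have "herm \<tau> (M w) (x - a) = 0" for w
      unfolding a_def herm_diff_right iso u herm_scale_right using c by simp
    then have "x - a \<in> B" unfolding B_def A_def by blast
    moreover have "a \<in> A" unfolding a_def A_def by blast
    moreover have "x = a + (x - a)" by simp
    ultimately show ?thesis by blast
  qed
  obtain z1 where z1: "z1 \<in> U" "F z1 \<notin> R" using nR by blast
  have z1M: "M z1 \<noteq> 0" by (rule Mn[OF z1(1)])
  have AM: "M x \<in> A" for x unfolding A_def by blast
  have key: "(is_linear U F \<and> (c = 1 \<longrightarrow> is_standard r s r' s' U F)) \<or>
    (orth_decomp r' s' A B \<and> linear_into A U (\<lambda>z. proj_along A B (F z)) \<and>
      null_map r' s' U (\<lambda>z. proj_along B A (F z)) \<and> (c = 1 \<longrightarrow> standard_into r s r' s' A U (\<lambda>z. proj_along A B (F z))))"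
  \<comment> \<open>\<open>orth_decomp\<close> requires nonzero summands. If \<open>B\<close> is
    zero, so is \<open>R\<close>, and \<open>F\<close> is induced by \<open>M\<close>
    directly.\<close>
  proof (cases "B = {0}")
    case True
    then have R0: "R \<subseteq> {0}" using RB by simp
    have FM: "\<exists>\<mu>. F z = \<mu> *s M z" if zU: "z \<in> U" for z
    proof -
      obtain \<mu> x where "x \<in> R" "F z = \<mu> *s M z + x" using F[OF zU] by blast
      then have "F z = \<mu> *s M z" using R0 by auto
      then show ?thesis by blast
    qed
    have "F z1 \<noteq> 0" using z1(2) R(1) by (metis vec.subspace_0)
    then have ex: "\<exists>z\<in>U. M z \<noteq> 0 \<and> F z \<noteq> 0" using z1(1) z1M by blast
    have pe: "\<forall>z\<in>U. M z \<noteq> 0 \<and> F z \<noteq> 0 \<longrightarrow> pequiv (M z) (F z)"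
    proof (intro ballI impI)
      fix z assume z: "z \<in> U" "M z \<noteq> 0 \<and> F z \<noteq> 0"
      then obtain \<mu> where "F z = \<mu> *s M z" using FM by blast
      moreover from this have "\<mu> \<noteq> 0" using z(2) by auto
      ultimately show "pequiv (M z) (F z)" unfolding pequiv_def by blast
    qed
    have "is_linear U F" unfolding is_linear_def linear_into_def using cM ex pe by blast
    moreover have "is_standard r s r' s' U F" if c1: "c = 1"
    proof -
      have h: "\<forall>u v. hform r' s' (M u) (M v) = hform r s u v" unfolding \<tau> \<sigma> iso c1 by simp
      show ?thesis unfolding is_standard_def standard_into_def using cM ex pe h by blast
    qed
    ultimately show ?thesis by blast
  next
    case False
    have "M z1 \<in> A" by (rule AM)
    then have A0: "A \<noteq> {0}" using z1M by blast
    have perp: "\<forall>a\<in>A. \<forall>b\<in>B. hform r' s' a b = 0" unfolding \<tau> B_def by blast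
    have dec: "orth_decomp r' s' A B"
      unfolding orth_decomp_def using A B A0 False AB sum perp by blast
    have pr: "\<exists>\<mu>. proj_along A B (F z) = \<mu> *s M z \<and> proj_along B A (F z) \<in> R \<and> (F z \<notin> R \<longrightarrow> \<mu> \<noteq> 0)" if zU: "z \<in> U" for z
    proof -
      obtain \<mu> x where x: "x \<in> R" "F z = \<mu> *s M z + x" using F[OF zU] by blast
      have mA: "\<mu> *s M z \<in> A" by (rule vec.subspace_scale[OF A AM])
      have xB: "x \<in> B" using x(1) RB by blast
      have 1: "proj_along A B (F z) = \<mu> *s M z" unfolding x(2) by (rule proj_along_eq[OF A B AB mA xB])
      have "B \<inter> A = {0}" using AB by blast
      then have "proj_along B A (x + \<mu> *s M z) = x" by (rule proj_along_eq[OF B A _ xB mA])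
      then have 2: "proj_along B A (F z) \<in> R" unfolding x(2) using x(1) by (simp add: add.commute)
      have "F z \<notin> R \<longrightarrow> \<mu> \<noteq> 0" using x by auto
      then show ?thesis using 1 2 by blast
    qed
    have ex: "\<exists>z\<in>U. M z \<noteq> 0 \<and> proj_along A B (F z) \<noteq> 0"
    proof -
      obtain \<mu> where "proj_along A B (F z1) = \<mu> *s M z1" "\<mu> \<noteq> 0" using pr[OF z1(1)] z1(2) by blast
      then have "proj_along A B (F z1) \<noteq> 0" using z1M by simp
      then show ?thesis using z1(1) z1M by blast
    qed
    have pe: "\<forall>z\<in>U. M z \<noteq> 0 \<and> proj_along A B (F z) \<noteq> 0 \<longrightarrow> pequiv (M z) (proj_along A B (F z))"
    proof (intro ballI impI)
      fix z assume z: "z \<in> U" "M z \<noteq> 0 \<and> proj_along A B (F z) \<noteq> 0"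
      then obtain \<mu> where "proj_along A B (F z) = \<mu> *s M z" using pr by blast
      moreover from this have "\<mu> \<noteq> 0" using z(2) by auto
      ultimately show "pequiv (M z) (proj_along A B (F z))" unfolding pequiv_def by blast
    qed
    have AM': "\<forall>x. M x \<in> A" using AM by blast
    have lin: "linear_into A U (\<lambda>z. proj_along A B (F z))"
      unfolding linear_into_def using cM AM' ex pe by blast
    have nR: "null_space r' s' R" unfolding null_space_def \<tau> using R(1,2) by blast
    have nul: "null_map r' s' U (\<lambda>z. proj_along B A (F z))"
      unfolding null_map_def using nR pr by blast
    have "standard_into r s r' s' A U (\<lambda>z. proj_along A B (F z))" if c1: "c = 1"
    proof -
      have h: "\<forall>u v. hform r' s' (M u) (M v) = hform r s u v" unfolding \<tau> \<sigma> iso c1 by simp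
      show ?thesis unfolding standard_into_def using cM AM' ex pe h by blast
    qed
    then show ?thesis using dec lin nul by blast
  qed
  show "quasi_linear r' s' U F" unfolding quasi_linear_def using key by blast
  show "quasi_standard r s r' s' U F" if "c = 1" unfolding quasi_standard_def using key that by blast
qed

section \<open>From the germ at a null point to the projective map\<close>

theorem mainTheorem12:
  fixes r s r' s' :: nat
    and U :: "(complex^('n::{finite,linorder})) set"
    and F :: "complex^('n::{finite,linorder}) \<Rightarrow> complex^('m::{finite,linorder})"
  assumes src_dim: "CARD('n) = r + s"
    and tgt_dim: "r' + s' \<le> CARD('m)"
    and U_open: "open U" and U_conn: "connected U" and U_nz: "0 \<notin> U"
    and U_cone: "\<forall>z\<in>U. \<forall>c::complex. c \<noteq> 0 \<longrightarrow> c *s z \<in> U"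
    and U_null: "\<exists>z\<in>U. hform r s z z = 0"
    and F_orth: "local_orthogonal r s r' s' U F"
    and dims: "int (min r' s') \<le> 2 * int (min r s) - 2"
  shows "(is_null r' s' U F \<or> quasi_linear r' s' U F) \<and>
         (((\<exists>z\<in>U. Re (hform r s z z) > 0 \<and> Re (hform r' s' (F z) (F z)) > 0) \<or>
           (\<exists>z\<in>U. Re (hform r s z z) < 0 \<and> Re (hform r' s' (F z) (F z)) < 0))
          \<longrightarrow> quasi_standard r s r' s' U F)"
proof -
  define \<sigma> :: "'n \<Rightarrow> real" where "\<sigma> = real_sig r s"
  define \<tau> :: "'m \<Rightarrow> real" where "\<tau> = real_sig r' s'"
  have hs: "hform r s = herm \<sigma>" and ht: "hform r' s' = herm \<tau>" unfolding \<sigma>_def \<tau>_def by (rule hform_herm)+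
  have nz: "\<forall>i. \<sigma> i \<noteq> 0"
  proof
    fix i :: 'n
    have "idx i < r + s" using idx_bij[where ?'n = 'n] src_dim unfolding bij_betw_def by auto
    then show "\<sigma> i \<noteq> 0" unfolding \<sigma>_def real_sig_def by auto
  qed
  have Fp: "proj_hol_map U F" and Fo: "\<And>p q. p \<in> U \<Longrightarrow> q \<in> U \<Longrightarrow> herm \<sigma> p q = 0 \<Longrightarrow> herm \<tau> (F p) (F q) = 0"
    using F_orth unfolding local_orthogonal_def hs ht by auto
  obtain p where p: "p \<in> U" "herm \<sigma> p p = 0" using U_null unfolding hs by blast
  obtain \<rho> f0 where f0: "\<rho> > 0" "ball p \<rho> \<subseteq> U"
    "\<And>w. w \<in> ball p \<rho> \<Longrightarrow> \<exists>L. Vector_Spaces.linear (*s) (*s) L \<and> (f0 has_derivative L) (at w)"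
    "\<And>w. w \<in> ball p \<rho> \<Longrightarrow> \<exists>k. k \<noteq> 0 \<and> f0 w = k *s F w"
    using holomorphic_lift[OF Fp p(1)] by blast
  define S where "S = vec.span (f0 ` ball p \<rho>)"
  \<comment> \<open>The radical of the form on the span of the lifted values; it is the null space
    that receives the remainder of \<open>F\<close> next to the linear part.\<close>
  define R where "R = {x \<in> S. \<forall>y\<in>S. herm \<tau> x y = 0}"
  have S: "vec.subspace S" unfolding S_def by (rule vec.subspace_span)
  have R: "vec.subspace R" unfolding R_def using S unfolding vec.subspace_def by (auto simp: herm_simps)
  have RS: "R \<subseteq> S" unfolding R_def by blast
  have RS0: "herm \<tau> x y = 0" "herm \<tau> y x = 0" if "x \<in> R" "y \<in> S" for x y
    using that herm_commute_zero[of \<tau> y x] unfolding R_def by auto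
  have nullR: "null_space r' s' R" unfolding null_space_def ht using R RS0(1) RS by blast
  obtain \<pi> where pi: "Vector_Spaces.linear (*s) (*s) \<pi>"
    "\<And>x. x \<in> R \<Longrightarrow> \<pi> x = 0" "\<And>x. x \<in> S \<Longrightarrow> x - \<pi> x \<in> R"
    using radical_splitting[OF R S RS] by blast
  interpret pi: Vector_Spaces.linear "(*s)" "(*s)" \<pi> by (rule pi(1))
  have piS: "\<pi> x \<in> S" if "x \<in> S" for x
    using vec.subspace_diff[OF S that, of "x - \<pi> x"] pi(3)[OF that] RS by auto
  have pih: "herm \<tau> (\<pi> x) y = herm \<tau> x y" "herm \<tau> y (\<pi> x) = herm \<tau> y x" if "x \<in> S" "y \<in> S" for x y
    using RS0[OF pi(3)[OF that(1)] that(2)] by (auto simp: herm_simps)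
  have f0S: "f0 w \<in> S" if "w \<in> ball p \<rho>" for w unfolding S_def using that by (intro vec.span_base) blast
  define f where "f w = \<pi> (f0 w)" for w
  have Tspan: "vec.span (f ` ball p \<rho>) = \<pi> ` S"
    unfolding f_def S_def using vec.linear_span_image[OF pi(1), of "f0 ` ball p \<rho>"] by (simp add: image_image)
  show ?thesis
  proof (cases "\<exists>z\<in>ball p \<rho>. f z \<noteq> 0")
    \<comment> \<open>The lift takes values in the radical near \<open>p\<close>, hence
      \<open>F\<close> does so on all of \<open>U\<close>. Then \<open>F\<close> is null, and the
      second claim is vacuous because no \<open>F z\<close> is positive or negative.\<close>
    case False
    have FR: "F w \<in> R" if w: "w \<in> ball p \<rho>" for w
    proof -
      obtain k where k: "k \<noteq> 0" "f0 w = k *s F w" using f0(4)[OF w] by blast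
      have "f0 w - \<pi> (f0 w) \<in> R" by (rule pi(3)[OF f0S[OF w]])
      moreover have "\<pi> (f0 w) = 0" using False w unfolding f_def by blast
      ultimately have "k *s F w \<in> R" unfolding k(2) by simp
      then show ?thesis using subspace_scale_cancel[OF R _ k(1)] by blast
    qed
    have spR: "vec.span R = R" using R by (rule vec.span_eq_iff[THEN iffD2])
    have lin0: "Vector_Spaces.linear (*s) (*s) ((\<lambda>x. 0) :: complex^'n::{finite,linorder} \<Rightarrow> complex^'m::{finite,linorder})" by (rule clinearI) auto
    have d0: "vec.dim (insert x (insert 0 R)) = (if x \<in> R then vec.dim R else vec.dim R + 1)" for x
    proof -
      have "insert 0 R = R" using R by (auto simp: vec.subspace_0)
      then show ?thesis by (simp add: vec.dim_insert spR)
    qed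
    have allR: "F z \<in> R" if z: "z \<in> U" for z
    proof -
      \<comment> \<open>Membership in \<open>R\<close> is expressed as a rank condition and
        propagated with the zero linear map.\<close>
      have "vec.dim (insert (F z) (insert 0 R)) \<le> vec.dim R"
        by (rule rank_propagation[OF U_open U_conn Fp lin0 p(1) f0(1) _ z]) (use FR d0 in auto)
      then show ?thesis unfolding d0 by (simp split: if_splits)
    qed
    have "is_null r' s' U F" unfolding is_null_def null_map_def using nullR allR by blast
    moreover have "herm \<tau> (F z) (F z) = 0" if "z \<in> U" for z
      using RS0(1)[OF allR[OF that]] allR[OF that] RS by blast
    ultimately show ?thesis unfolding ht by auto
  next
    case True
    define m where "m = min r s"
    interpret g: orthogonal_germ f p \<rho> \<sigma> \<tau> m
    proof
      show "\<rho> > 0" by (rule f0(1))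
      show "\<exists>L. Vector_Spaces.linear (*s) (*s) L \<and> (f has_derivative L) (at z)" if z: "z \<in> ball p \<rho>" for z
      proof -
        obtain L where L: "Vector_Spaces.linear (*s) (*s) L" "(f0 has_derivative L) (at z)" using f0(3)[OF z] by blast
        interpret L: Vector_Spaces.linear "(*s)" "(*s)" L by (rule L(1))
        have "(f has_derivative (\<lambda>h. \<pi> (L h))) (at z)"
          unfolding f_def by (rule bounded_linear.has_derivative[OF complex_linear_bounded[OF pi(1)] L(2)])
        moreover have "Vector_Spaces.linear (*s) (*s) (\<lambda>h. \<pi> (L h))"
          by (rule clinearI) (simp_all add: L.add L.scale pi.add pi.scale)
        ultimately show ?thesis by blast
      qed
      show "\<forall>i. \<sigma> i \<noteq> 0" by (rule nz)
      show "herm \<sigma> p p = 0" by (rule p(2))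
      show "0 \<notin> ball p \<rho>" using f0(2) U_nz by blast
      show "herm \<tau> (f z) (f w) = 0" if zw: "z \<in> ball p \<rho>" "w \<in> ball p \<rho>" "herm \<sigma> z w = 0" for z w
      proof -
        obtain k where k: "f0 z = k *s F z" using f0(4)[OF zw(1)] by blast
        obtain l where l: "f0 w = l *s F w" using f0(4)[OF zw(2)] by blast
        have "herm \<tau> (F z) (F w) = 0" using Fo zw f0(2) by blast
        then have "herm \<tau> (f0 z) (f0 w) = 0" unfolding k l herm_simps by simp
        then show ?thesis
          unfolding f_def pih(1)[OF f0S[OF zw(1)] piS[OF f0S[OF zw(2)]]] pih(2)[OF f0S[OF zw(2)] f0S[OF zw(1)]] .
      qed
      show "\<exists>k. k \<noteq> 0 \<and> f (c *s z) = k *s f z" if z: "z \<in> ball p \<rho>" "c *s z \<in> ball p \<rho>" for z c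
      proof -
        have "0 \<notin> ball p \<rho>" using f0(2) U_nz by blast
        then have "c \<noteq> 0" using z(2) by (auto simp del: mem_ball)
        then have "pequiv (F z) (F (c *s z))" using Fp z(1) f0(2) unfolding proj_hol_map_def by blast
        then obtain d where d: "d \<noteq> 0" "F (c *s z) = d *s F z" unfolding pequiv_def by blast
        obtain k where k: "k \<noteq> 0" "f0 z = k *s F z" using f0(4)[OF z(1)] by blast
        obtain l where l: "l \<noteq> 0" "f0 (c *s z) = l *s F (c *s z)" using f0(4)[OF z(2)] by blast
        have "f0 (c *s z) = (l * d / k) *s f0 z" unfolding l(2) d(2) k(2) using k(1) by (simp add: vec_eq_iff)
        then have "f (c *s z) = (l * d / k) *s f z" unfolding f_def by (simp add: pi.scale)
        moreover have "l * d / k \<noteq> 0" using k l d by simp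
        ultimately show ?thesis by blast
      qed
      show nd: "x = 0" if x: "x \<in> vec.span (f ` ball p \<rho>)" "\<And>y. y \<in> vec.span (f ` ball p \<rho>) \<Longrightarrow> herm \<tau> x y = 0" for x
      proof -
        obtain u where u: "u \<in> S" "x = \<pi> u" using x(1) unfolding Tspan by blast
        have "herm \<tau> u y = 0" if "y \<in> S" for y
        proof -
          have "herm \<tau> x (\<pi> y) = 0" using x(2)[of "\<pi> y"] that unfolding Tspan by blast
          then show ?thesis unfolding u(2) pih(1)[OF u(1) piS[OF that]] pih(2)[OF that u(1)] .
        qed
        then have "u \<in> R" unfolding R_def using u(1) by blast
        then show ?thesis using pi(2) u(2) by simp
      qed
      show "\<exists>z\<in>ball p \<rho>. f z \<noteq> 0" by (rule True)
      have "r + s \<le> CARD('n)" using src_dim by simp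
      note cs = card_real_sig[OF this]
      show "m \<le> card {i. \<sigma> i > 0}" "m \<le> card {i. \<sigma> i < 0}" unfolding \<sigma>_def cs m_def by auto
      show "vec.dim W + 2 \<le> 2 * m"
        if W: "vec.subspace W" "W \<subseteq> vec.span (f ` ball p \<rho>)" "\<And>x y. x \<in> W \<Longrightarrow> y \<in> W \<Longrightarrow> herm \<tau> x y = 0" for W
      proof -
        have ndW: "x = 0" if "x \<in> W" "\<And>y. herm \<tau> x y = 0" for x
          by (rule nd) (use that W(2) in auto)
        \<comment> \<open>The signs 1 and -1 bound \<open>W\<close> by both entries of the target
          signature, and the dimension hypothesis bounds their minimum by
          \<open>2 * m - 2\<close>.\<close>
        have "vec.dim W \<le> card {i. 1 * \<tau> i > 0}" by (rule isotropic_dim_le[OF W(1,3) ndW]) auto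
        moreover have "vec.dim W \<le> card {i. - 1 * \<tau> i > 0}" by (rule isotropic_dim_le[OF W(1,3) ndW]) auto
        ultimately have "vec.dim W \<le> min r' s'"
          using card_real_sig[OF tgt_dim] unfolding \<tau>_def by simp
        then show ?thesis using dims unfolding m_def by linarith
      qed
    qed
    obtain L c where L: "Vector_Spaces.linear (*s) (*s) L" "range L = vec.span (f ` ball p \<rho>)"
      "\<forall>z\<in>ball p \<rho>. f z \<in> vec.span {L z}" "c \<noteq> 0"
      "\<forall>z w. herm \<tau> (L z) (L w) = complex_of_real c * herm \<sigma> z w"
      using g.isometric_germ by (elim exE conjE)
    interpret L: Vector_Spaces.linear "(*s)" "(*s)" L by (rule L(1))
    have LS: "L z \<in> S" for z
    proof -
      have "L z \<in> \<pi> ` S" unfolding Tspan[symmetric] L(2)[symmetric] by (rule rangeI)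
      then show ?thesis using piS by auto
    qed
    have LR: "L z \<notin> R" if "z \<noteq> 0" for z
    proof
      assume "L z \<in> R"
      then have "herm \<sigma> w z = herm \<sigma> w 0" for w
        using RS0(2)[OF \<open>L z \<in> R\<close> LS[of w]] L(4,5) by (simp add: herm_simps)
      then have "z = 0" by (rule herm_right_cancel[OF nz])
      then show False using that by simp
    qed
    have spR: "vec.span R = R" using R by (rule vec.span_eq_iff[THEN iffD2])
    \<comment> \<open>This is the relation \<open>F w = \<mu> *s L w + x\<close> with
      \<open>x\<close> in \<open>R\<close>, written as a rank condition free of the local scalar, so
      that it can be propagated.\<close>
    have loc: "vec.dim (insert (F w) (insert (L w) R)) \<le> vec.dim R + 1" if w: "w \<in> ball p \<rho>" for w
    proof -
      obtain k where k: "k \<noteq> 0" "f0 w = k *s F w" using f0(4)[OF w] by blast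
      obtain t where t: "f w = t *s L w" using L(3) w unfolding span_single by blast
      have "f0 w - f w \<in> R" unfolding f_def by (rule pi(3)[OF f0S[OF w]])
      then have 1: "f0 w - f w \<in> vec.span (insert (L w) R)" by (intro vec.span_base) simp
      have 2: "f w \<in> vec.span (insert (L w) R)" unfolding t by (intro vec.span_scale vec.span_base) simp
      have "k *s F w \<in> vec.span (insert (L w) R)" using vec.span_add[OF 1 2] unfolding k(2) by simp
      then have "F w \<in> vec.span (insert (L w) R)" using subspace_scale_cancel[OF vec.subspace_span _ k(1)] by blast
      then show ?thesis by (simp add: vec.dim_insert)
    qed
    have Fform: "\<exists>\<mu> x. x \<in> R \<and> F z = \<mu> *s L z + x" if z: "z \<in> U" for z
    proof -
      have le: "vec.dim (insert (F z) (insert (L z) R)) \<le> vec.dim R + 1"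
        by (rule rank_propagation[OF U_open U_conn Fp L(1) p(1) f0(1) loc z])
      have "z \<noteq> 0" using z U_nz by auto
      then have "vec.dim (insert (L z) R) = vec.dim R + 1" using LR[of z] by (simp add: vec.dim_insert spR)
      then have "F z \<in> vec.span (insert (L z) R)" using le by (simp add: vec.dim_insert split: if_splits)
      then obtain \<mu> where "F z - \<mu> *s L z \<in> R" unfolding vec.span_breakdown_eq spR by blast
      moreover have "F z = \<mu> *s L z + (F z - \<mu> *s L z)" by simp
      ultimately show ?thesis by blast
    qed
    have nR: "\<exists>z\<in>U. F z \<notin> R"
    proof -
      obtain z where z: "z \<in> ball p \<rho>" "f z \<noteq> 0" using True by blast
      obtain k where k: "f0 z = k *s F z" using f0(4)[OF z(1)] by blast
      have "F z \<notin> R"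
      proof
        assume "F z \<in> R"
        then have "f0 z \<in> R" unfolding k by (rule vec.subspace_scale[OF R])
        then show False using z(2) pi(2) unfolding f_def by blast
      qed
      then show ?thesis using z(1) f0(2) by blast
    qed
    have RL: "herm \<tau> (L z) x = 0" if "x \<in> R" for x z by (rule RS0(2)[OF that LS])
    have RR: "herm \<tau> x y = 0" if "x \<in> R" "y \<in> R" for x y using RS0(1)[OF that(1)] that(2) RS by blast
    have c0: "complex_of_real c \<noteq> 0" using L(4) by simp
    have ql: "quasi_linear r' s' U F"
      by (rule conformal_splitting(1)[OF nz L(1) _ c0 R RR RL Fform nR U_nz ht hs]) (use L(5) in auto)
    \<comment> \<open>Dividing by the square root of a positive conformal factor turns
      \<open>L\<close> into an isometry \<open>M\<close>.\<close>
    have qs: "quasi_standard r s r' s' U F" if cpos: "c > 0"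
    proof -
      define k where "k = complex_of_real (sqrt c)"
      have k0: "k \<noteq> 0" unfolding k_def using cpos by simp
      have kk: "k * cnj k = complex_of_real c" unfolding k_def using cpos by (simp flip: of_real_mult)
      define M where "M z = (1 / k) *s L z" for z
      have M: "Vector_Spaces.linear (*s) (*s) M"
        by (rule clinearI) (simp_all add: M_def L.add L.scale vec_eq_iff algebra_simps)
      have isoM: "herm \<tau> (M z) (M w) = 1 * herm \<sigma> z w" for z w
        unfolding M_def herm_simps using L(5) k0 c0 by (simp flip: kk)
      have RM: "herm \<tau> (M z) x = 0" if "x \<in> R" for x z unfolding M_def herm_simps using RL[OF that] by simp
      have FM: "\<exists>\<mu> x. x \<in> R \<and> F z = \<mu> *s M z + x" if z: "z \<in> U" for z
      proof -
        obtain \<mu> x where x: "x \<in> R" "F z = \<mu> *s L z + x" using Fform[OF z] by blast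
        then have "F z = (\<mu> * k) *s M z + x" unfolding M_def using k0 by simp
        then show ?thesis using x(1) by blast
      qed
      show ?thesis
        by (rule conformal_splitting(2)[OF nz M isoM one_neq_zero R RR RM FM nR U_nz ht hs refl])
    qed
    \<comment> \<open>\<open>R\<close> is orthogonal to itself and to the range of \<open>L\<close>,
      so only \<open>\<mu> *s L z\<close> contributes, with factor
      \<open>(norm \<mu>)\<^sup>2 * c\<close>. A point whose sign is preserved therefore forces
      \<open>c > 0\<close>.\<close>
    have sign: "\<exists>a\<ge>0. Re (hform r' s' (F z) (F z)) = a * c * Re (hform r s z z)" if z: "z \<in> U" for z
    proof -
      obtain \<mu> x where x: "x \<in> R" "F z = \<mu> *s L z + x" using Fform[OF z] by blast
      have xL: "herm \<tau> x (L z) = 0" using RL[OF x(1)] herm_commute_zero by blast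
      have "herm \<tau> (F z) (F z) = \<mu> * (cnj \<mu> * (complex_of_real c * herm \<sigma> z z))"
        unfolding x(2) herm_simps using RL[OF x(1)] RR[OF x(1) x(1)] xL L(5) by simp
      also have "\<dots> = (\<mu> * cnj \<mu>) * (complex_of_real c * herm \<sigma> z z)" by (simp only: mult.assoc)
      also have "\<mu> * cnj \<mu> = complex_of_real ((norm \<mu>)\<^sup>2)" by (rule complex_norm_square[symmetric])
      finally have "Re (herm \<tau> (F z) (F z)) = (norm \<mu>)\<^sup>2 * c * Re (herm \<sigma> z z)" by simp
      then show ?thesis unfolding ht hs by (intro exI[of _ "(norm \<mu>)\<^sup>2"]) simp
    qed
    have cpos: "c > 0" if z: "z \<in> U" and h: "Re (hform r s z z) > 0 \<and> Re (hform r' s' (F z) (F z)) > 0 \<or>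
        Re (hform r s z z) < 0 \<and> Re (hform r' s' (F z) (F z)) < 0" for z
    proof -
      obtain a where a: "a \<ge> 0" "Re (hform r' s' (F z) (F z)) = a * c * Re (hform r s z z)" using sign[OF z] by blast
      then have "a * c > 0" using h by (auto simp: zero_less_mult_iff mult_less_0_iff)
      then show ?thesis using a(1) by (auto simp: zero_less_mult_iff)
    qed
    show ?thesis
    proof (intro conjI impI)
      show "is_null r' s' U F \<or> quasi_linear r' s' U F" using ql by (rule disjI2)
      assume "(\<exists>z\<in>U. Re (hform r s z z) > 0 \<and> Re (hform r' s' (F z) (F z)) > 0) \<or>
        (\<exists>z\<in>U. Re (hform r s z z) < 0 \<and> Re (hform r' s' (F z) (F z)) < 0)"
      then have "c > 0"
      proof
        assume "\<exists>z\<in>U. Re (hform r s z z) > 0 \<and> Re (hform r' s' (F z) (F z)) > 0"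
        then obtain z where z: "z \<in> U" "Re (hform r s z z) > 0 \<and> Re (hform r' s' (F z) (F z)) > 0" by (elim bexE)
        show ?thesis by (rule cpos[OF z(1) disjI1[OF z(2)]])
      next
        assume "\<exists>z\<in>U. Re (hform r s z z) < 0 \<and> Re (hform r' s' (F z) (F z)) < 0"
        then obtain z where z: "z \<in> U" "Re (hform r s z z) < 0 \<and> Re (hform r' s' (F z) (F z)) < 0" by (elim bexE)
        show ?thesis by (rule cpos[OF z(1) disjI2[OF z(2)]])
      qed
      then show "quasi_standard r s r' s' U F" by (rule qs)
    qed
  qed
qed

end
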